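(* Suppose that $0<\alpha,\beta<n$, $0<\mu<n-2\lambda$ and $p_0,q_0>1$, with $$\frac{n-1}{n}\frac{1}{p_0+1}+\frac{1}{q_0+1}=\frac{\alpha+\beta+\mu-\lambda}{n}.$$ Let $(u,v)\in L^{p_0+1}(\partial\mathbb{R}^n_+)\times L^{q_0+1}(\mathbb{R}^n_+)$ be a pair of positive solutions of the integral system $$\begin{cases}u(y)=\displaystyle\int_{\mathbb{R}^{n}_{+}}|x|^{-\beta}P_{\lambda}(x,y,\mu)v^{q_{0}}(x)|y|^{-\alpha}\,dx, & y\in\partial\mathbb{R}^{n}_{+},\\[2mm] v(x)=\displaystyle\int_{\partial\mathbb{R}^{n}_{+}}|y|^{-\alpha}P_{\lambda}(x,y,\mu)u^{p_{0}}(y)|x|^{-\beta}\,dy, & x\in\mathbb{R}^{n}_{+}.\end{cases}$$ (1) If $\frac{1}{q_{0}}-\frac{\mu+\beta-\lambda}{q_{0}n}>\frac{\beta-1}{n}$, then $$\lim_{|y|\to 0}u(y)|y|^{\alpha}=\int_{\mathbb{R}^{n}_{+}}\frac{x_{n}^{\lambda}v^{q_{0}}(x)}{|x|^{\mu+\beta}}\,dx.$$ (2) If $\frac{1}{p_{0}}-\frac{\mu+\alpha-\lambda+1}{p_{0}(n-1)}>\frac{\alpha}{n-1}$, then $$\lim_{|x|\to 0}\frac{v(x)|x|^{\beta}}{x_{n}^{\lambda}}=\int_{\partial\mathbb{R}^{n}_{+}}\frac{u^{p_{0}}(y)}{|y|^{\alpha+\mu}}\,dy.$$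
   Context: $n\ge 3$, $\lambda\ge 0$. $\mathbb{R}^n_+=\{x=(x',x_n)\in\mathbb{R}^{n-1}\times\mathbb{R}: x_n>0\}$, with boundary $\partial\mathbb{R}^n_+$ identified with $\mathbb{R}^{n-1}$. The kernel is $$P_{\lambda}(x,y,\mu)=\frac{x_{n}^{\lambda}}{\left(|x'-y|^{2}+x_{n}^{2}\right)^{\mu/2}},\qquad x=(x',x_n)\in\mathbb{R}^n_+,\ y\in\partial\mathbb{R}^n_+.$$ *)

theory Defs
  imports "HOL-Analysis.Analysis"
begin

text \<open>
  Points of \<open>R^n = R^(n-1) \<times> R\<close> are pairs \<open>x = (x', x\<^sub>n)\<close>, so \<open>x' = fst x\<close>, \<open>x\<^sub>n = snd x\<close>
  and \<open>n = CARD('m) + 1\<close>; the norm and the Lebesgue measure on the product type are the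
  Euclidean ones.  The boundary is identified with \<^typ>\<open>real ^ 'm\<close>.
\<close>

definition upper_half_space :: "((real ^ 'm) \<times> real) set" where
  "upper_half_space = {x. snd x > 0}"

definition P_kernel :: "real \<Rightarrow> (real ^ 'm) \<times> real \<Rightarrow> real ^ 'm \<Rightarrow> real \<Rightarrow> real" where
  "P_kernel lam x y \<mu> =
     snd x powr lam / ((norm (fst x - y))\<^sup>2 + (snd x)\<^sup>2) powr (\<mu> / 2)"

definition Lp_space :: "real \<Rightarrow> 'a measure \<Rightarrow> ('a \<Rightarrow> real) set" where
  "Lp_space p M = {f \<in> borel_measurable M. integrable M (\<lambda>x. \<bar>f x\<bar> powr p)}"

text \<open>
  A positive solution is a pair of functions with values in \<open>(0,\<infinity>)\<close> satisfying both equations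
  pointwise.  The integrands are nonnegative and the integrals are taken in \<open>[0,\<infinity>]\<close>, so the
  equations also express that they are finite.  The boundary point \<open>y = 0\<close> is left out,
  since the factor \<open>|y|^(-\<alpha>)\<close> is undefined (infinite) there.  Only the values of \<open>v\<close> on the
  open half space matter.
\<close>

definition positive_solution ::
  "real \<Rightarrow> real \<Rightarrow> real \<Rightarrow> real \<Rightarrow> real \<Rightarrow> real \<Rightarrow>
   (real ^ 'm \<Rightarrow> real) \<Rightarrow> ((real ^ 'm) \<times> real \<Rightarrow> real) \<Rightarrow> bool" where
  "positive_solution lam \<alpha> \<beta> \<mu> p0 q0 u v \<longleftrightarrow>
     (\<forall>y. y \<noteq> 0 \<longrightarrow> u y > 0) \<and>
     (\<forall>x\<in>upper_half_space. v x > 0) \<and>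
     (\<forall>y. y \<noteq> 0 \<longrightarrow>
        ennreal (u y) =
          (\<integral>\<^sup>+ x\<in>upper_half_space.
             ennreal (norm x powr (- \<beta>) * P_kernel lam x y \<mu> * v x powr q0 * norm y powr (- \<alpha>))
           \<partial>lebesgue)) \<and>
     (\<forall>x\<in>upper_half_space.
        ennreal (v x) =
          (\<integral>\<^sup>+ y.
             ennreal (norm y powr (- \<alpha>) * P_kernel lam x y \<mu> * u y powr p0 * norm x powr (- \<beta>))
           \<partial>lebesgue))"

end

(* Put f = u |y|^alpha and g = v |x|^beta / x_n^lam.  With the measures
   d sigma = |y|^(-alpha (p+1)) dy on the boundary and
   d tau = |x|^(-beta (q+1)) x_n^(lam (q+1)) dx on the half space the system becomes symmetric:
   f = integral of g^q d^(-mu) d tau,  g = integral of f^p d^(-mu) d sigma,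
   where f is in L^(p+1)(sigma), g is in L^(q+1)(tau) and d is the distance.
   Up to the factor |z|^(-(p+1)(a-A)), sigma has dimension (p+1) a at a point z away from the
   origin, but dimension (p+1) A at the origin, where a - A = alpha; likewise tau with
   (q+1) b and (q+1) B, where b - B = beta.  The balance condition reads mu = A + B, so the
   system is critical at the origin and subcritical (mu < a + b) elsewhere.

   The limit of f at the origin is at least the integral of g^q |x|^(-mu) by monotone
   convergence; suppose this integral is finite.  The only obstruction is the contribution of
   points with d(y,x) < eps (|y| + |x|).  There f <= 2 L f + S, where
   L h (y) = near integral of g^(q-1) d^(-mu) (near integral of f^(p-1) d^(-mu) h), and
   S collects far contributions.  If mu < 2 b, two applications of Hoelder's inequality give
   L 1 <= C eps^gamma uniformly, by subcriticality and scale invariance.  Since L is symmetric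
   with respect to f^(p-1) sigma, it is a contraction on L^2, so (f - 2 S)+ = 0, that is
   f <= 2 S.  If mu < 2 a, the same argument bounds g.  In both cases the near contribution
   tends to zero. *)
theory Submission
  imports Defs
begin

text \<open>Since \<open>mu < a + b\<close>, one of \<open>mu < 2 * b\<close> and
  \<open>mu < 2 * a\<close> holds. The first is exactly what makes \<open>d powr (- mu)\<close>
  locally integrable to the power (q + 1) / 2, the exponent left for the kernel once
  \<open>g powr (q - 1)\<close> is put into L^((q + 1) / (q - 1)). The obstacle is that smallness of
  L 1 gives a contraction in the sup norm, while boundedness of \<open>f\<close> is what has to be
  shown. The space L^2 with weight \<open>f powr (p - 1)\<close> is chosen because there the norm of
  \<open>f\<close> is the one finite quantity at hand, the integral of
  \<open>f powr (p + 1)\<close>. The conclusion (f - 2 S)+ = 0 is first obtained almost everywhere;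
  it becomes pointwise because f <= 2 L h + 2 S, with h = (f - 2 S)+, holds at every point and L
  sees h only through integrals. The far term S is in turn controlled by the integral at the origin:
  the far part of \<open>g\<close> is bounded by the share of one annulus in that integral. When
  \<open>g\<close> rather than \<open>f\<close> is bounded by its far term, a term remains that
  decays only because \<open>A > 0\<close>, and this is forced by \<open>f\<close> being in L^(p +
  1).\<close>

subsection \<open>Integral inequalities\<close>

text \<open>Young's inequality for \<open>u / U powr (1 / P)\<close> and
  \<open>v / V powr (1 / P')\<close>, multiplied by \<open>N\<close> and integrated. Positive upper
  bounds \<open>U\<close> and \<open>V\<close> instead of the integrals themselves dispose of the
  cases where an integral is zero or infinite.\<close>

lemma nn_integral_Holder_bound:
  fixes u v :: "'z \<Rightarrow> real"
  assumes [measurable]: "u \<in> borel_measurable M" "v \<in> borel_measurable M"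
    and nn: "\<And>z. z \<in> space M \<Longrightarrow> 0 \<le> u z" "\<And>z. z \<in> space M \<Longrightarrow> 0 \<le> v z"
    and P: "P > 1" "P' > 1" "1 / P + 1 / P' = 1"
    and UV: "U > 0" "V > 0"
    and u: "(\<integral>\<^sup>+z. ennreal (u z powr P) \<partial>M) \<le> ennreal U"
    and v: "(\<integral>\<^sup>+z. ennreal (v z powr P') \<partial>M) \<le> ennreal V"
  shows "(\<integral>\<^sup>+z. ennreal (u z * v z) \<partial>M) \<le> ennreal (U powr (1 / P) * V powr (1 / P'))"
proof -
  define N where "N = U powr (1 / P) * V powr (1 / P')"
  have N: "N > 0" using UV by (simp add: N_def)
  have *: "u z * v z \<le> (N / (U * P)) * u z powr P + (N / (V * P')) * v z powr P'"
    if z: "z \<in> space M" for z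
  proof -
    have "(u z / U powr (1 / P)) * (v z / V powr (1 / P'))
        \<le> (u z / U powr (1 / P)) powr P / P + (v z / V powr (1 / P')) powr P' / P'"
      using P nn[OF z] by (intro Youngs_inequality) auto
    also have "\<dots> = u z powr P / (U * P) + v z powr P' / (V * P')"
      using UV P nn[OF z] by (simp add: powr_divide powr_powr)
    finally have "N * ((u z / U powr (1 / P)) * (v z / V powr (1 / P')))
        \<le> N * (u z powr P / (U * P) + v z powr P' / (V * P'))"
      using N by (intro mult_left_mono) auto
    moreover have "N * ((u z / U powr (1 / P)) * (v z / V powr (1 / P'))) = u z * v z"
      using UV by (simp add: N_def field_simps)
    ultimately show ?thesis by (simp add: algebra_simps)
  qed
  have "(\<integral>\<^sup>+z. ennreal (u z * v z) \<partial>M)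
      \<le> (\<integral>\<^sup>+z. ennreal (N / (U * P)) * ennreal (u z powr P) + ennreal (N / (V * P')) * ennreal (v z powr P') \<partial>M)"
  proof (rule nn_integral_mono)
    fix z assume "z \<in> space M"
    then show "ennreal (u z * v z)
      \<le> ennreal (N / (U * P)) * ennreal (u z powr P) + ennreal (N / (V * P')) * ennreal (v z powr P')"
      using *[of z] N UV P
      by (simp add: ennreal_mult'[symmetric] ennreal_plus[symmetric] ennreal_leI del: ennreal_plus)
  qed
  also have "\<dots> = ennreal (N / (U * P)) * (\<integral>\<^sup>+z. ennreal (u z powr P) \<partial>M)
      + ennreal (N / (V * P')) * (\<integral>\<^sup>+z. ennreal (v z powr P') \<partial>M)"
    by (simp add: nn_integral_add nn_integral_cmult)
  also have "\<dots> \<le> ennreal (N / (U * P)) * ennreal U + ennreal (N / (V * P')) * ennreal V"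
    using u v by (intro add_mono mult_left_mono) auto
  also have "\<dots> = ennreal (N / (U * P) * U + N / (V * P') * V)"
    using N UV P by (simp add: ennreal_mult'[symmetric] ennreal_plus[symmetric] del: ennreal_plus)
  also have "N / (U * P) * U + N / (V * P') * V = N * (1 / P + 1 / P')"
    using UV by (simp add: field_simps)
  also have "\<dots> = N" using P by simp
  finally show ?thesis by (simp add: N_def)
qed

text \<open>Dyadic decomposition: on the layer \<open>t (Suc k) <= D < t k\<close> the integrand is
  at most \<open>t (Suc k) powr (- s)\<close>, and the layer has measure at most
  \<open>V * t k powr e\<close>. The series is geometric with ratio \<open>2 powr (s - e)\<close>,
  which is below 1 because \<open>s < e\<close>.\<close>

lemma nn_integral_powr_growth:
  fixes D :: "'z \<Rightarrow> real"
  assumes [measurable]: "D \<in> borel_measurable M"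
    and se: "0 \<le> s" "s < e" and rho: "\<rho> > 0" and V: "V \<ge> 0"
    and nn: "\<And>z. z \<in> space M \<Longrightarrow> 0 \<le> D z"
    and growth: "\<And>r. 0 < r \<Longrightarrow> r \<le> \<rho> \<Longrightarrow>
      emeasure M {z \<in> space M. D z < r} \<le> ennreal (V * r powr e)"
  shows "(\<integral>\<^sup>+z. ennreal (if D z < \<rho> then D z powr (- s) else 0) \<partial>M)
    \<le> ennreal (V * \<rho> powr (e - s) * (2 powr s / (1 - 2 powr (s - e))))"
proof -
  define t where "t k = \<rho> * (1/2) ^ k" for k :: nat
  have t: "t k > 0" "t k \<le> \<rho>" for k using rho by (auto simp: t_def power_le_one)
  define E where "E k = {z \<in> space M. D z < t k}" for k
  have [measurable]: "E k \<in> sets M" for k unfolding E_def by measurable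
  have pt: "ennreal (if D z < \<rho> then D z powr (- s) else 0)
      \<le> (\<Sum>k. ennreal (t (Suc k) powr (- s)) * indicator (E k) z)" if z: "z \<in> space M" for z
  proof (cases "0 < D z \<and> D z < \<rho>")
    case False
    \<comment> \<open>By convention \<open>0 powr (- s) = 0\<close>, so the zero set of
      \<open>D\<close> contributes nothing.\<close>
    then have "D z = 0 \<or> \<not> D z < \<rho>" using nn[OF z] by auto
    then show ?thesis by auto
  next
    case True
    have "\<exists>n. (1/2) ^ n < D z / \<rho>"
      using True by (intro real_arch_pow_inv) auto
    then have ex: "\<exists>n. t n \<le> D z" using True by (auto simp: t_def field_simps intro: less_imp_le)
    define n where "n = (LEAST n. t n \<le> D z)"
    have n: "t n \<le> D z" unfolding n_def using ex by (rule LeastI_ex)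
    have "n \<noteq> 0" using n True by (auto simp: t_def intro: ccontr)
    then obtain k where k: "n = Suc k" by (cases n) auto
    have "\<not> t k \<le> D z" using not_less_Least[of k "\<lambda>n. t n \<le> D z"] k n_def by auto
    then have zk: "z \<in> E k" using z by (auto simp: E_def)
    have "D z powr (- s) \<le> t (Suc k) powr (- s)"
      using n k se t by (intro powr_mono2') auto
    then have "ennreal (if D z < \<rho> then D z powr (- s) else 0)
      \<le> (\<Sum>j\<in>{k}. ennreal (t (Suc j) powr (- s)) * indicator (E j) z)"
      using True zk by (simp add: ennreal_leI)
    also have "\<dots> \<le> (\<Sum>k. ennreal (t (Suc k) powr (- s)) * indicator (E k) z)"
      by (rule sum_le_suminf) auto
    finally show ?thesis .
  qed
  define x where "x = (2::real) powr (s - e)"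
  have x: "0 < x" "x < 1" using se powr_less_mono[of "s - e" 0 2] by (auto simp: x_def)
  have "(\<integral>\<^sup>+z. ennreal (if D z < \<rho> then D z powr (- s) else 0) \<partial>M)
     \<le> (\<integral>\<^sup>+z. (\<Sum>k. ennreal (t (Suc k) powr (- s)) * indicator (E k) z) \<partial>M)"
    by (rule nn_integral_mono) (rule pt)
  also have "\<dots> = (\<Sum>k. ennreal (t (Suc k) powr (- s)) * emeasure M (E k))"
    by (subst nn_integral_suminf) (auto simp: nn_integral_cmult_indicator)
  also have "\<dots> \<le> (\<Sum>k. ennreal (V * \<rho> powr (e - s) * 2 powr s * x ^ k))"
  proof (intro suminf_le allI)
    fix k
    have eq: "t (Suc k) powr (- s) * (V * t k powr e) = V * \<rho> powr (e - s) * 2 powr s * x ^ k"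
    proof -
      have h: "t k = \<rho> * 2 powr (- real k)" for k
        by (simp add: t_def powr_minus powr_realpow power_one_over field_simps)
      have "t (Suc k) powr (- s) * t k powr e
          = \<rho> powr (- s) * 2 powr (s * (1 + real k)) * (\<rho> powr e * 2 powr (- real k * e))"
        using rho by (simp add: h powr_mult powr_powr algebra_simps)
      also have "\<dots> = (\<rho> powr (- s) * \<rho> powr e) * (2 powr (s * (1 + real k)) * 2 powr (- real k * e))"
        by simp
      also have "\<dots> = \<rho> powr (e - s) * 2 powr (s + real k * (s - e))"
        by (simp add: powr_add[symmetric] algebra_simps)
      also have "\<dots> = \<rho> powr (e - s) * (2 powr s * x ^ k)"
        by (simp add: powr_add x_def powr_powr powr_realpow[symmetric] mult.commute)
      finally show ?thesis by simp
    qed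
    have "ennreal (t (Suc k) powr (- s)) * emeasure M (E k)
      \<le> ennreal (t (Suc k) powr (- s)) * ennreal (V * t k powr e)"
      unfolding E_def using t by (intro mult_left_mono growth) auto
    also have "\<dots> = ennreal (V * \<rho> powr (e - s) * 2 powr s * x ^ k)"
      using V by (simp add: ennreal_mult'[symmetric] eq del: mult.assoc)
    finally show "ennreal (t (Suc k) powr (- s)) * emeasure M (E k)
      \<le> ennreal (V * \<rho> powr (e - s) * 2 powr s * x ^ k)" .
  qed auto
  also have "\<dots> = ennreal (\<Sum>k. V * \<rho> powr (e - s) * 2 powr s * x ^ k)"
    using x V by (intro suminf_ennreal2 summable_mult summable_geometric) auto
  also have "(\<Sum>k. V * \<rho> powr (e - s) * 2 powr s * x ^ k) = V * \<rho> powr (e - s) * 2 powr s * (1 / (1 - x))"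
    using x by (subst suminf_mult) (auto simp: suminf_geometric)
  finally show ?thesis by (simp add: x_def)
qed

text \<open>The absolute value lets one constant serve exponents of either sign; those met below,
  such as \<open>(q + 1) * B - mu\<close>, have no fixed sign.\<close>

lemma powr_le_comparable:
  fixes x y r e :: real
  assumes "x > 0" "y > 0" "x \<le> r * y" "y \<le> r * x" "r > 0"
  shows "x powr e \<le> r powr \<bar>e\<bar> * y powr e"
proof (cases "e \<ge> 0")
  case True
  then have "x powr e \<le> (r * y) powr e" using assms by (intro powr_mono2) auto
  then show ?thesis using True assms by (simp add: powr_mult)
next
  case False
  then have "x powr e \<le> (y / r) powr e" using assms by (intro powr_mono2') (auto simp: field_simps)
  then show ?thesis using False assms by (simp add: powr_divide powr_minus_divide)
qed

subsection \<open>Coupled potentials\<close>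

text \<open>The transformed system in a form invariant under exchanging its two sides.
  \<open>dx\<close> and \<open>dy\<close> measure how far apart two points with a common near point
  can be; the inequalities \<open>dx_le\<close> and \<open>dy_le\<close> through a point of the
  other side replace the triangle inequality, so \<open>dy\<close> may be larger than the distance.
  Growth is required only for radii up to half the distance to the origin, where the different
  dimension at the origin is not felt; the annulus conditions bound the measures from below at every
  scale.\<close>

locale coupled_potentials =
  fixes \<sigma> :: "'x measure" and \<tau> :: "'y measure"
    and d :: "'x \<Rightarrow> 'y \<Rightarrow> real" and dx :: "'x \<Rightarrow> 'x \<Rightarrow> real" and dy :: "'y \<Rightarrow> 'y \<Rightarrow> real"
    and nx :: "'x \<Rightarrow> real" and ny :: "'y \<Rightarrow> real"
    and p q A B a b mu c c' :: real
    and f :: "'x \<Rightarrow> real" and g :: "'y \<Rightarrow> real"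
  assumes sigma_finite: "sigma_finite_measure \<sigma>" "sigma_finite_measure \<tau>"
    and f_meas [measurable]: "f \<in> borel_measurable \<sigma>"
    and g_meas [measurable]: "g \<in> borel_measurable \<tau>"
    and nx_meas [measurable]: "nx \<in> borel_measurable \<sigma>"
    and ny_meas [measurable]: "ny \<in> borel_measurable \<tau>"
    and d_meas: "case_prod d \<in> borel_measurable (\<sigma> \<Otimes>\<^sub>M \<tau>)"
    and dx_meas: "\<And>y. y \<in> space \<sigma> \<Longrightarrow> dx y \<in> borel_measurable \<sigma>"
    and dy_meas: "\<And>x. x \<in> space \<tau> \<Longrightarrow> dy x \<in> borel_measurable \<tau>"
    and f_pos: "\<And>y. y \<in> space \<sigma> \<Longrightarrow> 0 < f y"
    and g_pos: "\<And>x. x \<in> space \<tau> \<Longrightarrow> 0 < g x"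
    and nx_pos: "\<And>y. y \<in> space \<sigma> \<Longrightarrow> 0 < nx y"
    and ny_pos: "\<And>x. x \<in> space \<tau> \<Longrightarrow> 0 < ny x"
    and d_pos: "\<And>y x. y \<in> space \<sigma> \<Longrightarrow> x \<in> space \<tau> \<Longrightarrow> 0 < d y x"
    and dx_nonneg: "\<And>y z. y \<in> space \<sigma> \<Longrightarrow> z \<in> space \<sigma> \<Longrightarrow> 0 \<le> dx y z"
    and dy_nonneg: "\<And>x z. x \<in> space \<tau> \<Longrightarrow> z \<in> space \<tau> \<Longrightarrow> 0 \<le> dy x z"
    and dx_AE: "\<And>y. y \<in> space \<sigma> \<Longrightarrow> AE z in \<sigma>. 0 < dx y z"
    and dy_AE: "\<And>x. x \<in> space \<tau> \<Longrightarrow> AE z in \<tau>. 0 < dy x z"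
    and nx_diff: "\<And>y x. y \<in> space \<sigma> \<Longrightarrow> x \<in> space \<tau> \<Longrightarrow> \<bar>nx y - ny x\<bar> \<le> d y x"
    and d_le: "\<And>y x. y \<in> space \<sigma> \<Longrightarrow> x \<in> space \<tau> \<Longrightarrow> d y x \<le> nx y + ny x"
    and dx_le: "\<And>y z x. y \<in> space \<sigma> \<Longrightarrow> z \<in> space \<sigma> \<Longrightarrow> x \<in> space \<tau> \<Longrightarrow> dx y z \<le> d y x + d z x"
    and dy_le: "\<And>x z y. x \<in> space \<tau> \<Longrightarrow> z \<in> space \<tau> \<Longrightarrow> y \<in> space \<sigma> \<Longrightarrow> dy x z \<le> d y x + d y z"
    and pq: "1 < p" "1 < q"
    and params: "0 < a" "0 < b" "mu = A + B" "0 < mu" "mu < a + b" "0 < c" "0 < c'"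
    and growth_xx: "\<And>y r. y \<in> space \<sigma> \<Longrightarrow> 0 < r \<Longrightarrow> r \<le> nx y / 2 \<Longrightarrow>
      emeasure \<sigma> {z \<in> space \<sigma>. dx y z < r}
        \<le> ennreal (c * nx y powr ((p + 1) * (A - a)) * r powr ((p + 1) * a))"
    and growth_xy: "\<And>y r. y \<in> space \<sigma> \<Longrightarrow> 0 < r \<Longrightarrow> r \<le> nx y / 2 \<Longrightarrow>
      emeasure \<tau> {x \<in> space \<tau>. d y x < r}
        \<le> ennreal (c * nx y powr ((q + 1) * (B - b)) * r powr ((q + 1) * b))"
    and growth_yx: "\<And>x r. x \<in> space \<tau> \<Longrightarrow> 0 < r \<Longrightarrow> r \<le> ny x / 2 \<Longrightarrow>
      emeasure \<sigma> {y \<in> space \<sigma>. d y x < r}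
        \<le> ennreal (c * ny x powr ((p + 1) * (A - a)) * r powr ((p + 1) * a))"
    and growth_yy: "\<And>x r. x \<in> space \<tau> \<Longrightarrow> 0 < r \<Longrightarrow> r \<le> ny x / 2 \<Longrightarrow>
      emeasure \<tau> {z \<in> space \<tau>. dy x z < r}
        \<le> ennreal (c * ny x powr ((q + 1) * (B - b)) * r powr ((q + 1) * b))"
    and annulus_x: "\<And>R. 0 < R \<Longrightarrow>
      ennreal (c' * R powr ((p + 1) * A)) \<le> emeasure \<sigma> {y \<in> space \<sigma>. R < nx y \<and> nx y < 2 * R}"
    and annulus_y: "\<And>R. 0 < R \<Longrightarrow>
      ennreal (c' * R powr ((q + 1) * B)) \<le> emeasure \<tau> {x \<in> space \<tau>. R < ny x \<and> ny x < 2 * R}"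
    and f_eq: "\<And>y. y \<in> space \<sigma> \<Longrightarrow>
      ennreal (f y) = (\<integral>\<^sup>+x. ennreal (g x powr q * d y x powr (- mu)) \<partial>\<tau>)"
    and g_eq: "\<And>x. x \<in> space \<tau> \<Longrightarrow>
      ennreal (g x) = (\<integral>\<^sup>+y. ennreal (f y powr p * d y x powr (- mu)) \<partial>\<sigma>)"
    and f_norm: "(\<integral>\<^sup>+y. ennreal (f y powr (p + 1)) \<partial>\<sigma>) < \<infinity>"
    and g_norm: "(\<integral>\<^sup>+x. ennreal (g x powr (q + 1)) \<partial>\<tau>) < \<infinity>"
begin

text \<open>The hypotheses are closed under exchanging \<open>\<sigma>, f, p, A, a\<close> with
  \<open>\<tau>, g, q, B, b\<close>, so each statement about \<open>f\<close> yields its mirror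
  image about \<open>g\<close>.\<close>

lemma swap: "coupled_potentials \<tau> \<sigma> (\<lambda>x y. d y x) dy dx ny nx q p B A b a mu c c' g f"
proof (rule coupled_potentials.intro)
  show "(\<lambda>(x, y). d y x) \<in> borel_measurable (\<tau> \<Otimes>\<^sub>M \<sigma>)"
    using measurable_pair_swap[OF d_meas] by (simp add: case_prod_unfold)
  show "\<bar>ny x - nx y\<bar> \<le> d y x" if "x \<in> space \<tau>" "y \<in> space \<sigma>" for x y
    using nx_diff[OF that(2,1)] by (simp add: abs_minus_commute)
  show "d y x \<le> ny x + nx y" if "x \<in> space \<tau>" "y \<in> space \<sigma>" for x y
    using d_le[OF that(2,1)] by simp
  show "mu = B + A" "mu < b + a" using params by simp_all
  show "ennreal (g x) = (\<integral>\<^sup>+y. ennreal (f y powr p * d y x powr (- mu)) \<partial>\<sigma>)" if "x \<in> space \<tau>" for x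
    by (rule g_eq[OF that])
  show "ennreal (f y) = (\<integral>\<^sup>+x. ennreal (g x powr q * d y x powr (- mu)) \<partial>\<tau>)" if "y \<in> space \<sigma>" for y
    by (rule f_eq[OF that])
qed (rule sigma_finite g_meas f_meas ny_meas nx_meas dy_meas dx_meas g_pos f_pos ny_pos nx_pos
    d_pos dy_nonneg dx_nonneg dy_AE dx_AE dy_le dx_le pq params growth_yy growth_yx growth_xy growth_xx
    annulus_y annulus_x g_norm f_norm; assumption)+

lemma measurable_d [measurable (raw)]:
  assumes "u \<in> N \<rightarrow>\<^sub>M \<sigma>" "v \<in> N \<rightarrow>\<^sub>M \<tau>"
  shows "(\<lambda>z. d (u z) (v z)) \<in> borel_measurable N"
proof -
  have "(\<lambda>z. case_prod d (u z, v z)) \<in> borel_measurable N"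
    using assms by (intro measurable_compose[OF _ d_meas]) measurable
  then show ?thesis by simp
qed

text \<open>The threshold is relative to the size of both points: this makes the truncation scale
  invariant, symmetric under \<open>swap\<close>, and confined to pairs of comparable size.\<close>

definition near_kernel :: "real \<Rightarrow> 'x \<Rightarrow> 'y \<Rightarrow> real" where
  "near_kernel \<epsilon> y x = (if d y x < \<epsilon> * (nx y + ny x) then d y x powr (- mu) else 0)"

text \<open>A radial substitute for the integral defining \<open>f\<close>, with
  \<open>d y x\<close> replaced by its upper bound \<open>nx y + ny x\<close>. It bounds
  \<open>f\<close> from below, and up to the factor \<open>\<epsilon> powr (- mu)\<close> it bounds
  the far part of \<open>f\<close> from above.\<close>

definition g_potential :: "real \<Rightarrow> ennreal" where
  "g_potential r = (\<integral>\<^sup>+x. ennreal (g x powr q * (r + ny x) powr (- mu)) \<partial>\<tau>)"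

definition f_potential :: "real \<Rightarrow> ennreal" where
  "f_potential r = (\<integral>\<^sup>+y. ennreal (f y powr p * (r + nx y) powr (- mu)) \<partial>\<sigma>)"

lemma measurable_near_kernel [measurable (raw)]:
  assumes [measurable]: "u \<in> N \<rightarrow>\<^sub>M \<sigma>" "v \<in> N \<rightarrow>\<^sub>M \<tau>"
  shows "(\<lambda>z. near_kernel \<epsilon> (u z) (v z)) \<in> borel_measurable N"
  unfolding near_kernel_def by measurable

lemma near_kernel_nonneg [simp]: "0 \<le> near_kernel \<epsilon> y x"
  by (simp add: near_kernel_def)

text \<open>By \<open>nx_diff\<close>, the sizes of two near points differ by at most a thirtieth of
  their sum, so the factor 2 is generous.\<close>

lemma near_comparable:
  assumes "y \<in> space \<sigma>" "x \<in> space \<tau>" "0 < \<epsilon>" "\<epsilon> \<le> 1 / 30" "d y x < \<epsilon> * (nx y + ny x)"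
  shows "nx y \<le> 2 * ny x" "ny x \<le> 2 * nx y" "d y x < 3 * \<epsilon> * nx y" "d y x < 3 * \<epsilon> * ny x"
proof -
  note * = nx_diff[OF assms(1,2)] nx_pos[OF assms(1)] ny_pos[OF assms(2)]
  have "\<epsilon> * (nx y + ny x) \<le> 1 / 30 * (nx y + ny x)"
    using * assms by (intro mult_right_mono) auto
  then have "d y x < 1 / 30 * (nx y + ny x)" using assms(5) by linarith
  then show 1: "nx y \<le> 2 * ny x" "ny x \<le> 2 * nx y" using * by (auto simp: abs_le_iff)
  have "\<epsilon> * (nx y + ny x) \<le> \<epsilon> * (3 * nx y)" "\<epsilon> * (nx y + ny x) \<le> \<epsilon> * (3 * ny x)"
    using 1 assms by (auto intro!: mult_left_mono)
  then show "d y x < 3 * \<epsilon> * nx y" "d y x < 3 * \<epsilon> * ny x" using assms(5) by auto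
qed

lemma g_potential_antimono:
  assumes "0 \<le> r" "r \<le> r'"
  shows "g_potential r' \<le> g_potential r"
  unfolding g_potential_def
proof (rule nn_integral_mono)
  fix x assume x: "x \<in> space \<tau>"
  show "ennreal (g x powr q * (r' + ny x) powr (- mu)) \<le> ennreal (g x powr q * (r + ny x) powr (- mu))"
    using assms ny_pos[OF x] params by (intro ennreal_leI mult_left_mono powr_mono2') auto
qed

text \<open>Pointwise, \<open>t * r + ny x <= t * (r + ny x)\<close> for \<open>t >= 1\<close>.
  Together with monotonicity this is a Harnack property: the potential is comparable at comparable
  radii.\<close>

lemma g_potential_scale:
  assumes "0 < r" "1 \<le> t"
  shows "g_potential r \<le> ennreal (t powr mu) * g_potential (t * r)"
proof -
  have "g_potential r \<le> (\<integral>\<^sup>+x. ennreal (t powr mu) * ennreal (g x powr q * (t * r + ny x) powr (- mu)) \<partial>\<tau>)"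
    unfolding g_potential_def
  proof (rule nn_integral_mono)
    fix x assume x: "x \<in> space \<tau>"
    have "(r + ny x) powr (- mu) = t powr mu * (t * (r + ny x)) powr (- mu)"
      using assms ny_pos[OF x] by (subst powr_mult) (simp_all add: powr_minus)
    also have "\<dots> \<le> t powr mu * (t * r + ny x) powr (- mu)"
      using assms ny_pos[OF x] params
      by (intro mult_left_mono powr_mono2') (auto simp: algebra_simps intro: add_pos_pos)
    finally have "g x powr q * (r + ny x) powr (- mu) \<le> t powr mu * (g x powr q * (t * r + ny x) powr (- mu))"
      by (metis mult.left_commute mult_left_mono powr_ge_zero)
    then show "ennreal (g x powr q * (r + ny x) powr (- mu))
        \<le> ennreal (t powr mu) * ennreal (g x powr q * (t * r + ny x) powr (- mu))"
      by (simp add: ennreal_mult'[symmetric] ennreal_leI)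
  qed
  also have "\<dots> = ennreal (t powr mu) * g_potential (t * r)"
    unfolding g_potential_def by (simp add: nn_integral_cmult)
  finally show ?thesis .
qed

lemma g_potential_le_f:
  assumes y: "y \<in> space \<sigma>"
  shows "g_potential (nx y) \<le> ennreal (f y)"
  unfolding f_eq[OF y] g_potential_def
proof (rule nn_integral_mono)
  fix x assume x: "x \<in> space \<tau>"
  show "ennreal (g x powr q * (nx y + ny x) powr (- mu)) \<le> ennreal (g x powr q * d y x powr (- mu))"
    using d_pos[OF y x] d_le[OF y x] params
    by (intro ennreal_leI mult_left_mono powr_mono2') auto
qed

lemma annulus_x_nonempty:
  assumes "0 < R" shows "\<exists>y\<in>space \<sigma>. R < nx y \<and> nx y < 2 * R"
proof (rule ccontr)
  assume "\<not> ?thesis"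
  then have "{y \<in> space \<sigma>. R < nx y \<and> nx y < 2 * R} = {}" by auto
  then have "emeasure \<sigma> {y \<in> space \<sigma>. R < nx y \<and> nx y < 2 * R} = 0" by (simp only: emeasure_empty)
  then have "c' * R powr ((p + 1) * A) \<le> 0" using annulus_x[OF assms] by (simp add: ennreal_eq_0_iff)
  moreover have "0 < c' * R powr ((p + 1) * A)" using assms params by simp
  ultimately show False by simp
qed

text \<open>Finiteness comes from the equation: \<open>f\<close> is real valued at some point closer
  to the origin than \<open>r\<close>, and such a point exists because annuli have positive
  measure.\<close>

lemma g_potential_finite:
  assumes "0 < r" shows "g_potential r < \<infinity>"
proof -
  obtain y where y: "y \<in> space \<sigma>" "nx y < r" using annulus_x_nonempty[of "r / 2"] assms by auto
  have "g_potential r \<le> g_potential (nx y)"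
    using y nx_pos[OF y(1)] by (intro g_potential_antimono) auto
  also have "\<dots> \<le> ennreal (f y)" by (rule g_potential_le_f[OF y(1)])
  finally show ?thesis using le_less_trans by fastforce
qed

text \<open>Outside the near region \<open>d y x\<close> is at least \<open>\<epsilon>\<close> times
  its largest possible value \<open>nx y + ny x\<close>, so the radial potential controls the
  rest.\<close>

lemma f_near_far:
  assumes y: "y \<in> space \<sigma>" and e: "0 < \<epsilon>"
  shows "ennreal (f y) \<le> (\<integral>\<^sup>+x. ennreal (near_kernel \<epsilon> y x * g x powr q) \<partial>\<tau>)
    + ennreal (\<epsilon> powr (- mu)) * g_potential (nx y)"
proof -
  have "ennreal (f y) \<le> (\<integral>\<^sup>+x. ennreal (near_kernel \<epsilon> y x * g x powr q)
     + ennreal (\<epsilon> powr (- mu)) * ennreal (g x powr q * (nx y + ny x) powr (- mu)) \<partial>\<tau>)"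
    unfolding f_eq[OF y]
  proof (rule nn_integral_mono)
    fix x assume x: "x \<in> space \<tau>"
    have "d y x powr (- mu) \<le> near_kernel \<epsilon> y x + \<epsilon> powr (- mu) * (nx y + ny x) powr (- mu)"
    proof (cases "d y x < \<epsilon> * (nx y + ny x)")
      case True then show ?thesis by (simp add: near_kernel_def)
    next
      case False
      have "d y x powr (- mu) \<le> (\<epsilon> * (nx y + ny x)) powr (- mu)"
        using False e nx_pos[OF y] ny_pos[OF x] params by (intro powr_mono2') auto
      then show ?thesis using e nx_pos[OF y] ny_pos[OF x] False by (simp add: powr_mult near_kernel_def)
    qed
    from mult_left_mono[OF this, of "g x powr q"]
    show "ennreal (g x powr q * d y x powr (- mu)) \<le> ennreal (near_kernel \<epsilon> y x * g x powr q)
     + ennreal (\<epsilon> powr (- mu)) * ennreal (g x powr q * (nx y + ny x) powr (- mu))"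
      by (simp add: ennreal_mult'[symmetric] ennreal_plus[symmetric] ennreal_leI algebra_simps del: ennreal_plus)
  qed
  also have "\<dots> = (\<integral>\<^sup>+x. ennreal (near_kernel \<epsilon> y x * g x powr q) \<partial>\<tau>)
    + ennreal (\<epsilon> powr (- mu)) * g_potential (nx y)"
    unfolding g_potential_def using y by (simp add: nn_integral_add nn_integral_cmult)
  finally show ?thesis .
qed

text \<open>The sum of the dyadic series in \<open>nn_integral_powr_growth\<close>, with growth
  exponent \<open>e\<close>.\<close>

definition geo :: "real \<Rightarrow> real \<Rightarrow> real" where
  "geo s e = 2 powr s / (1 - 2 powr (s - e))"

lemma geo_pos: "s < e \<Longrightarrow> 0 < geo s e"
  using powr_less_mono[of "s - e" 0 2] by (auto simp: geo_def)

lemma powr_int_xy: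
  assumes y: "y \<in> space \<sigma>" and s: "0 \<le> s" "s < (q + 1) * b" and r: "0 < \<rho>" "\<rho> \<le> nx y / 2"
  shows "(\<integral>\<^sup>+x. ennreal (if d y x < \<rho> then d y x powr (- s) else 0) \<partial>\<tau>)
    \<le> ennreal (c * nx y powr ((q + 1) * (B - b)) * \<rho> powr ((q + 1) * b - s) * geo s ((q + 1) * b))"
  unfolding geo_def using y s r params growth_xy[OF y] d_pos[OF y]
  by (intro nn_integral_powr_growth) (auto intro: less_imp_le)

lemma powr_int_xx:
  assumes y: "y \<in> space \<sigma>" and s: "0 \<le> s" "s < (p + 1) * a" and r: "0 < \<rho>" "\<rho> \<le> nx y / 2"
  shows "(\<integral>\<^sup>+z. ennreal (if dx y z < \<rho> then dx y z powr (- s) else 0) \<partial>\<sigma>)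
    \<le> ennreal (c * nx y powr ((p + 1) * (A - a)) * \<rho> powr ((p + 1) * a - s) * geo s ((p + 1) * a))"
  unfolding geo_def using y s r params growth_xx[OF y] dx_nonneg[OF y] dx_meas
  by (intro nn_integral_powr_growth) auto

text \<open>The condition is local integrability of \<open>d y x powr (- mu)\<close> against
  \<open>\<tau>\<close>, which has dimension \<open>(q + 1) * b\<close> at \<open>y\<close>. The
  power of \<open>nx y\<close> combines the growth factor with the radius \<open>nx y / 2\<close>,
  which contains all near points.\<close>

lemma near_kernel_integral:
  assumes "mu < (q + 1) * b"
  shows "\<exists>C>0. \<forall>\<epsilon> y. 0 < \<epsilon> \<longrightarrow> \<epsilon> \<le> 1 / 30 \<longrightarrow> y \<in> space \<sigma> \<longrightarrow>
    (\<integral>\<^sup>+x. ennreal (near_kernel \<epsilon> y x) \<partial>\<tau>) \<le> ennreal (C * nx y powr ((q + 1) * B - mu))"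
proof (intro exI conjI allI impI)
  define C where "C = c * (1/2) powr ((q + 1) * b - mu) * geo mu ((q + 1) * b)"
  show "0 < C" unfolding C_def using params geo_pos[OF assms] by simp
  fix \<epsilon> :: real and y assume e: "0 < \<epsilon>" "\<epsilon> \<le> 1 / 30" and y: "y \<in> space \<sigma>"
  have R: "0 < nx y" using nx_pos[OF y] .
  have "(\<integral>\<^sup>+x. ennreal (near_kernel \<epsilon> y x) \<partial>\<tau>)
    \<le> (\<integral>\<^sup>+x. ennreal (if d y x < nx y / 2 then d y x powr (- mu) else 0) \<partial>\<tau>)"
  proof (rule nn_integral_mono)
    fix x assume x: "x \<in> space \<tau>"
    have "3 * \<epsilon> * nx y \<le> 1 / 10 * nx y" using e R by (intro mult_right_mono) auto
    then have "d y x < nx y / 2" if "d y x < \<epsilon> * (nx y + ny x)"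
      using near_comparable(3)[OF y x e that] R by linarith
    then show "ennreal (near_kernel \<epsilon> y x) \<le> ennreal (if d y x < nx y / 2 then d y x powr (- mu) else 0)"
      by (auto simp: near_kernel_def)
  qed
  also have "\<dots> \<le> ennreal (c * nx y powr ((q + 1) * (B - b)) * (nx y / 2) powr ((q + 1) * b - mu)
      * geo mu ((q + 1) * b))"
    using assms params R by (intro powr_int_xy y) auto
  also have "c * nx y powr ((q + 1) * (B - b)) * (nx y / 2) powr ((q + 1) * b - mu) * geo mu ((q + 1) * b)
     = C * (nx y powr ((q + 1) * (B - b)) * nx y powr ((q + 1) * b - mu))"
    using R by (simp add: C_def powr_divide powr_one_eq_one)
  also have "nx y powr ((q + 1) * (B - b)) * nx y powr ((q + 1) * b - mu) = nx y powr ((q + 1) * B - mu)"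
    by (simp add: powr_add[symmetric] algebra_simps)
  finally show "(\<integral>\<^sup>+x. ennreal (near_kernel \<epsilon> y x) \<partial>\<tau>) \<le> ennreal (C * nx y powr ((q + 1) * B - mu))" .
qed

lemma sigma_finite_x: "sigma_finite_measure \<sigma>" and sigma_finite_y: "sigma_finite_measure \<tau>"
  and pair_sigma_finite_xy: "pair_sigma_finite \<sigma> \<tau>"
  using sigma_finite by (auto simp: pair_sigma_finite_def)

subsection \<open>The local operator\<close>

lemma near_pair:
  assumes y: "y \<in> space \<sigma>" and z: "z \<in> space \<sigma>" and x: "x \<in> space \<tau>" and e: "0 < \<epsilon>" "\<epsilon> \<le> 1 / 30"
    and near: "d y x < \<epsilon> * (nx y + ny x)" "d z x < \<epsilon> * (nx z + ny x)"
  shows "nx z \<le> 4 * nx y" "nx y \<le> 4 * nx z" "dx y z < nx y / 2"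
    "d y x < 3 * \<epsilon> * nx y" "d z x < 3 * \<epsilon> * nx z"
proof -
  note n1 = near_comparable[OF y x e near(1)] and n2 = near_comparable[OF z x e near(2)]
  show zy: "nx z \<le> 4 * nx y" "nx y \<le> 4 * nx z" using n1 n2 by auto
  show "d y x < 3 * \<epsilon> * nx y" "d z x < 3 * \<epsilon> * nx z" using n1 n2 by auto
  have "3 * \<epsilon> * nx y \<le> 1 / 10 * nx y" "3 * \<epsilon> * nx z \<le> 1 / 10 * nx z"
    using e nx_pos[OF y] nx_pos[OF z] by (auto intro!: mult_right_mono)
  then show "dx y z < nx y / 2" using dx_le[OF y z x] n1(3) n2(3) zy nx_pos[OF y] by linarith
qed

text \<open>Of the distances from \<open>x\<close> to \<open>y\<close> and \<open>z\<close>, the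
  larger is at least \<open>dx y z / 2\<close>. A part \<open>\<theta>\<close> of its exponent is
  spent on \<open>dx y z\<close>, the rest on the smaller distance. What remains is one kernel with
  exponent \<open>t = 2 * s - \<theta> < (q + 1) * b\<close>, integrable over a ball of radius
  \<open>3 * \<epsilon> * nx y\<close> (or the same for \<open>z\<close>); that radius produces the
  positive power of \<open>\<epsilon>\<close>.\<close>

lemma product_kernel_integral:
  assumes s: "0 < s" "s < (q + 1) * b" and th: "0 \<le> \<theta>" "\<theta> \<le> s" "2 * s - (q + 1) * b < \<theta>"
    and Q: "Q > 0" "s = mu * Q"
  shows "\<exists>C>0. \<forall>\<epsilon> y z. 0 < \<epsilon> \<longrightarrow> \<epsilon> \<le> 1 / 30 \<longrightarrow> y \<in> space \<sigma> \<longrightarrow> z \<in> space \<sigma> \<longrightarrow> 0 < dx y z \<longrightarrow>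
    (\<integral>\<^sup>+x. ennreal ((near_kernel \<epsilon> y x * near_kernel \<epsilon> z x) powr Q) \<partial>\<tau>)
    \<le> ennreal (C * \<epsilon> powr ((q + 1) * b - 2 * s + \<theta>) * nx y powr ((q + 1) * B - 2 * s + \<theta>)
        * (if dx y z < nx y / 2 then dx y z powr (- \<theta>) else 0))"
proof -
  define e1 where "e1 = (q + 1) * b - 2 * s + \<theta>"
  define e2 where "e2 = (q + 1) * B - 2 * s + \<theta>"
  define t where "t = 2 * s - \<theta>"
  define G where "G = geo t ((q + 1) * b)"
  have t: "0 < t" "t < (q + 1) * b" "(q + 1) * b - t = e1" using s th by (auto simp: t_def e1_def)
  have G: "0 < G" unfolding G_def using t by (intro geo_pos)
  define C where "C = 2 powr \<theta> * c * 3 powr e1 * G * (1 + 4 powr \<bar>e2\<bar>)"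
  have C: "C > 0" using params G by (auto simp: C_def intro!: mult_pos_pos add_pos_pos)
  have ball: "(\<integral>\<^sup>+x. ennreal (if d y x < 3 * \<epsilon> * nx y then d y x powr (- t) else 0) \<partial>\<tau>)
      \<le> ennreal (c * 3 powr e1 * G * \<epsilon> powr e1 * nx y powr e2)"
    if y: "y \<in> space \<sigma>" and e: "0 < \<epsilon>" "\<epsilon> \<le> 1 / 30" for y and \<epsilon> :: real
  proof -
    have R: "0 < nx y" using nx_pos[OF y] .
    have "3 * \<epsilon> * nx y \<le> 1 / 2 * nx y" using e R by (intro mult_right_mono) auto
    then have "(\<integral>\<^sup>+x. ennreal (if d y x < 3 * \<epsilon> * nx y then d y x powr (- t) else 0) \<partial>\<tau>)
      \<le> ennreal (c * nx y powr ((q + 1) * (B - b)) * (3 * \<epsilon> * nx y) powr ((q + 1) * b - t) * geo t ((q + 1) * b))"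
      using e R t by (intro powr_int_xy y) auto
    also have "c * nx y powr ((q + 1) * (B - b)) * (3 * \<epsilon> * nx y) powr ((q + 1) * b - t) * geo t ((q + 1) * b)
      = c * 3 powr e1 * G * \<epsilon> powr e1 * (nx y powr ((q + 1) * (B - b)) * nx y powr e1)"
      using e R t by (simp add: powr_mult G_def)
    also have "nx y powr ((q + 1) * (B - b)) * nx y powr e1 = nx y powr e2"
      by (simp add: powr_add[symmetric] e1_def e2_def algebra_simps)
    finally show ?thesis .
  qed
  show ?thesis
  proof (intro exI[of _ C] conjI allI impI C, fold e1_def e2_def)
    fix \<epsilon> :: real and y z
    assume e: "0 < \<epsilon>" "\<epsilon> \<le> 1 / 30" and y: "y \<in> space \<sigma>" and z: "z \<in> space \<sigma>" and rho: "0 < dx y z"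
    define \<rho> where "\<rho> = dx y z"
    have rho: "0 < \<rho>" using rho by (simp add: \<rho>_def)
    define near where "near x \<longleftrightarrow> d y x < \<epsilon> * (nx y + ny x) \<and> d z x < \<epsilon> * (nx z + ny x)" for x
    have zero: "near_kernel \<epsilon> y x * near_kernel \<epsilon> z x = 0" if "\<not> near x" for x
      using that by (auto simp: near_def near_kernel_def)
    have "(\<integral>\<^sup>+x. ennreal ((near_kernel \<epsilon> y x * near_kernel \<epsilon> z x) powr Q) \<partial>\<tau>)
      \<le> ennreal (C * \<epsilon> powr e1 * nx y powr e2 * (if \<rho> < nx y / 2 then \<rho> powr (- \<theta>) else 0))"
    \<comment> \<open>A common near point is what makes \<open>nx y\<close> and \<open>nx z\<close>
      comparable and \<open>dx y z\<close> small; without one the integrand vanishes.\<close>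
    proof (cases "\<exists>x\<in>space \<tau>. near x")
      case False
      then have "(\<integral>\<^sup>+x. ennreal ((near_kernel \<epsilon> y x * near_kernel \<epsilon> z x) powr Q) \<partial>\<tau>) = (\<integral>\<^sup>+x. 0 \<partial>\<tau>)"
        using zero by (intro nn_integral_cong) auto
      then show ?thesis by simp
    next
      case True
      then obtain x0 where "x0 \<in> space \<tau>" "near x0" by auto
      then have zy: "nx z \<le> 4 * nx y" "nx y \<le> 4 * nx z" "\<rho> < nx y / 2"
        using near_pair[OF y z _ e] by (auto simp: near_def \<rho>_def)
      define \<kappa> where "\<kappa> w x = (if d w x < 3 * \<epsilon> * nx w then d w x powr (- t) else 0)" for w x
      have pt: "(near_kernel \<epsilon> y x * near_kernel \<epsilon> z x) powr Q \<le> (\<rho> / 2) powr (- \<theta>) * (\<kappa> y x + \<kappa> z x)"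
        if x: "x \<in> space \<tau>" for x
      proof (cases "near x")
        case False
        have "0 \<le> (\<rho> / 2) powr (- \<theta>) * (\<kappa> y x + \<kappa> z x)" by (simp add: \<kappa>_def)
        then show ?thesis by (simp only: zero[OF False]) simp
      next
        case near: True
        then have n: "d y x < 3 * \<epsilon> * nx y" "d z x < 3 * \<epsilon> * nx z"
          using near_pair(4,5)[OF y z x e] by (auto simp: near_def)
        have dp: "0 < d y x" "0 < d z x" using d_pos x y z by auto
        have aux: "u powr (- s) * w powr (- s) \<le> (\<rho> / 2) powr (- \<theta>) * u powr (- t)"
          if "0 < u" "u \<le> w" "\<rho> \<le> u + w" for u w
        proof -
          \<comment> \<open>The first factor is estimated by \<open>w >= \<rho> / 2\<close>, the
            second by \<open>w >= u\<close>.\<close>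
          have "w powr (- s) = w powr (- \<theta>) * w powr (- (s - \<theta>))"
            by (simp add: powr_add[symmetric])
          also have "\<dots> \<le> (\<rho> / 2) powr (- \<theta>) * u powr (- (s - \<theta>))"
            using that rho th by (intro mult_mono powr_mono2') auto
          finally have "u powr (- s) * w powr (- s) \<le> u powr (- s) * ((\<rho> / 2) powr (- \<theta>) * u powr (- (s - \<theta>)))"
            by (intro mult_left_mono) auto
          also have "\<dots> = (\<rho> / 2) powr (- \<theta>) * (u powr (- s) * u powr (- (s - \<theta>)))" by simp
          also have "u powr (- s) * u powr (- (s - \<theta>)) = u powr (- t)"
            by (simp add: powr_add[symmetric] t_def)
          finally show ?thesis .
        qed
        have "(near_kernel \<epsilon> y x * near_kernel \<epsilon> z x) powr Q = d y x powr (- s) * d z x powr (- s)"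
          using near dp Q by (simp add: near_def near_kernel_def powr_mult powr_powr)
        also have "\<dots> \<le> (\<rho> / 2) powr (- \<theta>) * (d y x powr (- t) + d z x powr (- t))"
        proof (cases "d y x \<le> d z x")
          case True
          have "d y x powr (- s) * d z x powr (- s) \<le> (\<rho> / 2) powr (- \<theta>) * d y x powr (- t)"
            using True dp dx_le[OF y z x] by (intro aux) (auto simp: \<rho>_def)
          also have "\<dots> \<le> (\<rho> / 2) powr (- \<theta>) * (d y x powr (- t) + d z x powr (- t))"
            by (intro mult_left_mono) auto
          finally show ?thesis .
        next
          case False
          have "d z x powr (- s) * d y x powr (- s) \<le> (\<rho> / 2) powr (- \<theta>) * d z x powr (- t)"
            using False dp dx_le[OF y z x] by (intro aux) (auto simp: \<rho>_def)
          also have "\<dots> \<le> (\<rho> / 2) powr (- \<theta>) * (d y x powr (- t) + d z x powr (- t))"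
            by (intro mult_left_mono) auto
          finally show ?thesis by (simp add: mult.commute)
        qed
        also have "\<dots> = (\<rho> / 2) powr (- \<theta>) * (\<kappa> y x + \<kappa> z x)" using n by (simp add: \<kappa>_def)
        finally show ?thesis .
      qed
      have \<kappa>0: "0 \<le> \<kappa> w x" for w x by (simp add: \<kappa>_def)
      have [measurable]: "(\<lambda>x. \<kappa> y x) \<in> borel_measurable \<tau>" "(\<lambda>x. \<kappa> z x) \<in> borel_measurable \<tau>"
        unfolding \<kappa>_def using y z by measurable
      have "(\<integral>\<^sup>+x. ennreal ((near_kernel \<epsilon> y x * near_kernel \<epsilon> z x) powr Q) \<partial>\<tau>)
        \<le> (\<integral>\<^sup>+x. ennreal ((\<rho> / 2) powr (- \<theta>)) * (ennreal (\<kappa> y x) + ennreal (\<kappa> z x)) \<partial>\<tau>)"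
        using pt \<kappa>0
        by (intro nn_integral_mono) (simp add: ennreal_mult'[symmetric] ennreal_plus[symmetric] ennreal_leI del: ennreal_plus)
      also have "\<dots> = ennreal ((\<rho> / 2) powr (- \<theta>)) * ((\<integral>\<^sup>+x. ennreal (\<kappa> y x) \<partial>\<tau>) + (\<integral>\<^sup>+x. ennreal (\<kappa> z x) \<partial>\<tau>))"
        by (simp add: nn_integral_cmult nn_integral_add)
      also have "\<dots> \<le> ennreal ((\<rho> / 2) powr (- \<theta>)) *
          (ennreal (c * 3 powr e1 * G * \<epsilon> powr e1 * nx y powr e2) + ennreal (c * 3 powr e1 * G * \<epsilon> powr e1 * nx z powr e2))"
        unfolding \<kappa>_def by (intro mult_left_mono add_mono ball y z e) auto
      also have "\<dots> \<le> ennreal ((\<rho> / 2) powr (- \<theta>)) *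
          (ennreal (c * 3 powr e1 * G * \<epsilon> powr e1 * nx y powr e2)
            + ennreal (c * 3 powr e1 * G * \<epsilon> powr e1 * (4 powr \<bar>e2\<bar> * nx y powr e2)))"
        using params G zy nx_pos[OF y] nx_pos[OF z]
        by (intro mult_left_mono add_left_mono ennreal_leI powr_le_comparable mult_nonneg_nonneg) auto
      also have "\<dots> = ennreal ((\<rho> / 2) powr (- \<theta>) *
          (c * 3 powr e1 * G * \<epsilon> powr e1 * nx y powr e2 + c * 3 powr e1 * G * \<epsilon> powr e1 * (4 powr \<bar>e2\<bar> * nx y powr e2)))"
        using params G by (simp add: ennreal_mult'[symmetric] ennreal_plus[symmetric] del: ennreal_plus)
      also have "(\<rho> / 2) powr (- \<theta>) *
          (c * 3 powr e1 * G * \<epsilon> powr e1 * nx y powr e2 + c * 3 powr e1 * G * \<epsilon> powr e1 * (4 powr \<bar>e2\<bar> * nx y powr e2))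
        = C * \<epsilon> powr e1 * nx y powr e2 * \<rho> powr (- \<theta>)"
        using rho by (simp add: C_def powr_divide powr_minus field_simps)
      finally show ?thesis using zy by simp
    qed
    then show "(\<integral>\<^sup>+x. ennreal ((near_kernel \<epsilon> y x * near_kernel \<epsilon> z x) powr Q) \<partial>\<tau>)
      \<le> ennreal (C * \<epsilon> powr e1 * nx y powr e2 * (if dx y z < nx y / 2 then dx y z powr (- \<theta>) else 0))"
      by (simp only: \<rho>_def)
  qed
qed

text \<open>The inner integral of the operator L applied to the constant function 1.\<close>

definition local_mass :: "real \<Rightarrow> 'y \<Rightarrow> ennreal" where
  "local_mass \<epsilon> x = (\<integral>\<^sup>+z. ennreal (near_kernel \<epsilon> z x * f z powr (p - 1)) \<partial>\<sigma>)"

lemma measurable_local_mass [measurable]: "local_mass \<epsilon> \<in> borel_measurable \<tau>"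
proof -
  interpret X: sigma_finite_measure \<sigma> by (rule sigma_finite_x)
  show ?thesis unfolding local_mass_def by measurable
qed

text \<open>After Fubini, Hoelder in \<open>x\<close> puts \<open>g powr (q - 1)\<close> into L^Q0,
  where its norm is that of \<open>g\<close> in L^(q + 1), and leaves the product of two near
  kernels in L^Q. This yields a power of \<open>dx y z\<close>; Hoelder in \<open>z\<close> then
  pairs it in L^P with \<open>f powr (p - 1)\<close> in L^P0. The hypothesis
  \<open>mu < 2 * b\<close> says \<open>s < (q + 1) * b\<close>.\<close>

lemma local_operator_small:
  assumes mu: "mu < 2 * b"
  shows "\<exists>C>0. \<exists>\<gamma>>0. \<forall>\<epsilon> y. 0 < \<epsilon> \<longrightarrow> \<epsilon> \<le> 1 / 30 \<longrightarrow> y \<in> space \<sigma> \<longrightarrow>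
    (\<integral>\<^sup>+x. ennreal (near_kernel \<epsilon> y x * g x powr (q - 1)) * local_mass \<epsilon> x \<partial>\<tau>) \<le> ennreal (C * \<epsilon> powr \<gamma>)"
proof -
  interpret pair_sigma_finite \<sigma> \<tau> by (rule pair_sigma_finite_xy)
  define Q where "Q = (q + 1) / 2"
  define Q0 where "Q0 = (q + 1) / (q - 1)"
  define P where "P = (p + 1) / 2"
  define P0 where "P0 = (p + 1) / (p - 1)"
  define s where "s = mu * Q"
  have "(q - 1) / (q + 1) + 2 / (q + 1) = (q + 1) / (q + 1)"
    "(p - 1) / (p + 1) + 2 / (p + 1) = (p + 1) / (p + 1)"
    by (simp_all only: add_divide_distrib[symmetric]) simp_all
  then have QP: "1 < Q" "1 < Q0" "1 < P" "1 < P0" "1 / Q0 + 1 / Q = 1" "1 / P0 + 1 / P = 1"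
    using pq by (auto simp: Q_def Q0_def P_def P0_def)
  have s: "0 < s" "s < (q + 1) * b" using params QP mu pq by (auto simp: s_def Q_def)
  have "2 * s - (q + 1) * b < 2 * a * Q"
  proof -
    have "(q + 1) * (mu - b) < (q + 1) * a" using params pq by (intro mult_strict_left_mono) auto
    then show ?thesis by (simp add: s_def Q_def algebra_simps)
  qed
  then have "max 0 (2 * s - (q + 1) * b) < min s (2 * a * Q)" using s params QP by auto
  \<comment> \<open>The lower bound on \<open>\<theta>\<close> makes the \<open>x\<close> integral
    converge, with a positive power of \<open>\<epsilon>\<close>;
    \<open>\<theta> < 2 * a * Q\<close> makes the \<open>z\<close> integral converge. They are
    compatible precisely because \<open>mu < a + b\<close>.\<close>
  then obtain \<theta> where "max 0 (2 * s - (q + 1) * b) < \<theta>" "\<theta> < min s (2 * a * Q)" using dense by blast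
  then have th: "0 < \<theta>" "2 * s - (q + 1) * b < \<theta>" "\<theta> < s" "\<theta> < 2 * a * Q" by auto
  define e1 where "e1 = (q + 1) * b - 2 * s + \<theta>"
  define e2 where "e2 = (q + 1) * B - 2 * s + \<theta>"
  have e1: "0 < e1" using th by (simp add: e1_def)
  obtain C1 where C1: "C1 > 0" and K: "\<And>\<epsilon> y z. 0 < \<epsilon> \<Longrightarrow> \<epsilon> \<le> 1 / 30 \<Longrightarrow> y \<in> space \<sigma> \<Longrightarrow> z \<in> space \<sigma> \<Longrightarrow>
      0 < dx y z \<Longrightarrow> (\<integral>\<^sup>+x. ennreal ((near_kernel \<epsilon> y x * near_kernel \<epsilon> z x) powr Q) \<partial>\<tau>)
    \<le> ennreal (C1 * \<epsilon> powr e1 * nx y powr e2 * (if dx y z < nx y / 2 then dx y z powr (- \<theta>) else 0))"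
    using product_kernel_integral[of s \<theta> Q] s th QP unfolding s_def e1_def e2_def by auto
  \<comment> \<open>The added 1 makes both bounds positive, as
    \<open>nn_integral_Holder_bound\<close> demands.\<close>
  define NG where "NG = enn2real (\<integral>\<^sup>+x. ennreal (g x powr (q + 1)) \<partial>\<tau>) + 1"
  define NF where "NF = enn2real (\<integral>\<^sup>+y. ennreal (f y powr (p + 1)) \<partial>\<sigma>) + 1"
  have N: "0 < NG" "0 < NF" by (auto simp: NG_def NF_def intro: add_nonneg_pos)
  have NG: "(\<integral>\<^sup>+x. ennreal ((g x powr (q - 1)) powr Q0) \<partial>\<tau>) \<le> ennreal NG"
    using g_norm pq by (simp add: powr_powr Q0_def NG_def ennreal_plus)
  have NF: "(\<integral>\<^sup>+y. ennreal ((f y powr (p - 1)) powr P0) \<partial>\<sigma>) \<le> ennreal NF"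
    using f_norm pq by (simp add: powr_powr P0_def NF_def ennreal_plus)
  define \<theta>' where "\<theta>' = \<theta> / Q * P"
  have "\<theta> / Q < 2 * a" using th QP by (simp add: field_simps)
  then have "\<theta> / Q * P < 2 * a * P" using QP by (intro mult_strict_right_mono) auto
  then have th': "0 \<le> \<theta>'" "\<theta>' < (p + 1) * a"
    using th QP by (auto simp: \<theta>'_def P_def mult.commute)
  define C2 where "C2 = c * (1 / 2) powr ((p + 1) * a - \<theta>') * geo \<theta>' ((p + 1) * a)"
  have C2: "C2 > 0" unfolding C2_def using params geo_pos[OF th'(2)] by simp
  define C where "C = NG powr (1 / Q0) * C1 powr (1 / Q) * (NF powr (1 / P0) * C2 powr (1 / P))"
  have "C > 0" using N C1 C2 by (simp add: C_def)
  moreover have "0 < e1 / Q" using e1 QP by simp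
  moreover have "(\<integral>\<^sup>+x. ennreal (near_kernel \<epsilon> y x * g x powr (q - 1)) * local_mass \<epsilon> x \<partial>\<tau>) \<le> ennreal (C * \<epsilon> powr (e1 / Q))"
    if e: "0 < \<epsilon>" "\<epsilon> \<le> 1 / 30" and y: "y \<in> space \<sigma>" for \<epsilon> :: real and y
  proof -
    have R: "0 < nx y" using nx_pos[OF y] .
    have [measurable]: "dx y \<in> borel_measurable \<sigma>" using dx_meas[OF y] .
    define w where "w z = (if dx y z < nx y / 2 then dx y z powr (- (\<theta> / Q)) else 0)" for z
    have [measurable]: "w \<in> borel_measurable \<sigma>" unfolding w_def by measurable
    define H where "H = NG powr (1 / Q0) * (C1 * \<epsilon> powr e1 * nx y powr e2) powr (1 / Q)"
    have M: "(\<integral>\<^sup>+x. ennreal (g x powr (q - 1) * (near_kernel \<epsilon> y x * near_kernel \<epsilon> z x)) \<partial>\<tau>)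
        \<le> ennreal (H * w z)" if z: "z \<in> space \<sigma>" "0 < dx y z" for z
    proof (cases "dx y z < nx y / 2")
      case True
      have "(\<integral>\<^sup>+x. ennreal (g x powr (q - 1) * (near_kernel \<epsilon> y x * near_kernel \<epsilon> z x)) \<partial>\<tau>)
        \<le> ennreal (NG powr (1 / Q0) * (C1 * \<epsilon> powr e1 * nx y powr e2 * dx y z powr (- \<theta>)) powr (1 / Q))"
        using N QP C1 e R z y True NG K[OF e y z] by (intro nn_integral_Holder_bound) auto
      also have "NG powr (1 / Q0) * (C1 * \<epsilon> powr e1 * nx y powr e2 * dx y z powr (- \<theta>)) powr (1 / Q) = H * w z"
        using True z C1 by (simp add: H_def w_def powr_mult powr_powr)
      finally show ?thesis .
    next
      \<comment> \<open>The bound \<open>K\<close> is zero here, which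
        \<open>nn_integral_Holder_bound\<close> does not admit; instead, the product of kernels
        vanishes almost everywhere.\<close>
      case False
      then have "(\<integral>\<^sup>+x. ennreal ((near_kernel \<epsilon> y x * near_kernel \<epsilon> z x) powr Q) \<partial>\<tau>) = 0"
        using K[OF e y z] by simp
      then have "AE x in \<tau>. ennreal ((near_kernel \<epsilon> y x * near_kernel \<epsilon> z x) powr Q) = 0"
        using y z by (subst (asm) nn_integral_0_iff_AE) measurable
      then have "AE x in \<tau>. ennreal (g x powr (q - 1) * (near_kernel \<epsilon> y x * near_kernel \<epsilon> z x)) = 0"
      proof eventually_elim
        case (elim x)
        then have "near_kernel \<epsilon> y x * near_kernel \<epsilon> z x = 0"
          by (metis ennreal_eq_0_iff not_less powr_gt_zero)
        then show ?case by (simp only: mult_zero_right ennreal_0)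
      qed
      then have "(\<integral>\<^sup>+x. ennreal (g x powr (q - 1) * (near_kernel \<epsilon> y x * near_kernel \<epsilon> z x)) \<partial>\<tau>) = (\<integral>\<^sup>+x. 0 \<partial>\<tau>)"
        by (intro nn_integral_cong_AE) auto
      then show ?thesis by simp
    qed
    have "(\<integral>\<^sup>+x. ennreal (near_kernel \<epsilon> y x * g x powr (q - 1)) * local_mass \<epsilon> x \<partial>\<tau>)
      = (\<integral>\<^sup>+x. (\<integral>\<^sup>+z. ennreal (f z powr (p - 1)) * ennreal (g x powr (q - 1) * (near_kernel \<epsilon> y x * near_kernel \<epsilon> z x)) \<partial>\<sigma>) \<partial>\<tau>)"
      unfolding local_mass_def using y
      by (intro nn_integral_cong, subst nn_integral_cmult[symmetric])
        (auto simp: ennreal_mult'[symmetric] mult_ac)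
    also have "\<dots> = (\<integral>\<^sup>+z. (\<integral>\<^sup>+x. ennreal (f z powr (p - 1)) * ennreal (g x powr (q - 1) * (near_kernel \<epsilon> y x * near_kernel \<epsilon> z x)) \<partial>\<tau>) \<partial>\<sigma>)"
      using y by (intro Fubini') measurable
    also have "\<dots> = (\<integral>\<^sup>+z. ennreal (f z powr (p - 1)) * (\<integral>\<^sup>+x. ennreal (g x powr (q - 1) * (near_kernel \<epsilon> y x * near_kernel \<epsilon> z x)) \<partial>\<tau>) \<partial>\<sigma>)"
      using y by (intro nn_integral_cong nn_integral_cmult) measurable
    also have "\<dots> \<le> (\<integral>\<^sup>+z. ennreal H * ennreal (f z powr (p - 1) * w z) \<partial>\<sigma>)"
    proof (rule nn_integral_mono_AE)
      show "AE z in \<sigma>. ennreal (f z powr (p - 1)) * (\<integral>\<^sup>+x. ennreal (g x powr (q - 1) * (near_kernel \<epsilon> y x * near_kernel \<epsilon> z x)) \<partial>\<tau>)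
          \<le> ennreal H * ennreal (f z powr (p - 1) * w z)"
        using dx_AE[OF y] AE_space
      proof eventually_elim
        case (elim z)
        have "ennreal (f z powr (p - 1)) * (\<integral>\<^sup>+x. ennreal (g x powr (q - 1) * (near_kernel \<epsilon> y x * near_kernel \<epsilon> z x)) \<partial>\<tau>)
          \<le> ennreal (f z powr (p - 1)) * ennreal (H * w z)"
          using M[of z] elim by (intro mult_left_mono) auto
        then show ?case by (simp add: H_def w_def ennreal_mult'[symmetric] mult_ac)
      qed
    qed
    also have "\<dots> = ennreal H * (\<integral>\<^sup>+z. ennreal (f z powr (p - 1) * w z) \<partial>\<sigma>)"
      by (rule nn_integral_cmult) measurable
    also have "\<dots> \<le> ennreal H * ennreal (NF powr (1 / P0) * (C2 * nx y powr ((p + 1) * A - \<theta>')) powr (1 / P))"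
    proof (intro mult_left_mono nn_integral_Holder_bound NF)
      have "(\<integral>\<^sup>+z. ennreal (w z powr P) \<partial>\<sigma>) = (\<integral>\<^sup>+z. ennreal (if dx y z < nx y / 2 then dx y z powr (- \<theta>') else 0) \<partial>\<sigma>)"
        using QP by (intro nn_integral_cong) (auto simp: w_def powr_powr \<theta>'_def)
      also have "\<dots> \<le> ennreal (c * nx y powr ((p + 1) * (A - a)) * (nx y / 2) powr ((p + 1) * a - \<theta>') * geo \<theta>' ((p + 1) * a))"
        using th' R by (intro powr_int_xx y) auto
      also have "c * nx y powr ((p + 1) * (A - a)) * (nx y / 2) powr ((p + 1) * a - \<theta>') * geo \<theta>' ((p + 1) * a)
        = C2 * (nx y powr ((p + 1) * (A - a)) * nx y powr ((p + 1) * a - \<theta>'))"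
        using R by (simp add: C2_def powr_divide powr_one_eq_one)
      also have "nx y powr ((p + 1) * (A - a)) * nx y powr ((p + 1) * a - \<theta>') = nx y powr ((p + 1) * A - \<theta>')"
        by (simp add: powr_add[symmetric] algebra_simps)
      finally show "(\<integral>\<^sup>+z. ennreal (w z powr P) \<partial>\<sigma>) \<le> ennreal (C2 * nx y powr ((p + 1) * A - \<theta>'))" .
    qed (use QP N C2 R in \<open>auto simp: w_def\<close>)
    also have "\<dots> = ennreal (H * (NF powr (1 / P0) * (C2 * nx y powr ((p + 1) * A - \<theta>')) powr (1 / P)))"
      by (simp add: ennreal_mult'[symmetric] H_def)
    also have "H * (NF powr (1 / P0) * (C2 * nx y powr ((p + 1) * A - \<theta>')) powr (1 / P))
      = C * \<epsilon> powr (e1 / Q) * (nx y powr (e2 / Q) * nx y powr (((p + 1) * A - \<theta>') / P))"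
      using C1 C2 by (simp add: H_def C_def powr_mult powr_powr)
    \<comment> \<open>Scale invariance: the exponents add up to
      \<open>2 * B - 2 * mu + 2 * A = 0\<close>, while the terms with \<open>\<theta>\<close> cancel
      because \<open>\<theta>' / P = \<theta> / Q\<close>.\<close>
    also have "nx y powr (e2 / Q) * nx y powr (((p + 1) * A - \<theta>') / P) = 1"
    proof -
      have "(p + 1) * A / P = 2 * A" "(q + 1) * B / Q = 2 * B" using pq by (auto simp: P_def Q_def)
      then have "e2 / Q + ((p + 1) * A - \<theta>') / P = 0"
        using QP params by (simp add: e2_def \<theta>'_def s_def diff_divide_distrib add_divide_distrib)
      then show ?thesis using R by (simp add: powr_add[symmetric])
    qed
    finally show ?thesis by simp
  qed
  ultimately show ?thesis by blast
qed

section \<open>Transfer to the exchanged system\<close>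

lemma swap_f_potential: "coupled_potentials.f_potential \<tau> ny q mu g = g_potential"
  and swap_g_potential: "coupled_potentials.g_potential \<sigma> nx p mu f = f_potential"
  and swap_near_kernel: "coupled_potentials.near_kernel (\<lambda>x y. d y x) ny nx mu \<epsilon> x y = near_kernel \<epsilon> y x"
proof -
  interpret S: coupled_potentials \<tau> \<sigma> "\<lambda>x y. d y x" dy dx ny nx q p B A b a mu c c' g f
    by (rule swap)
  show "S.f_potential = g_potential" "S.g_potential = f_potential" "S.near_kernel \<epsilon> x y = near_kernel \<epsilon> y x"
    by (simp_all add: fun_eq_iff S.f_potential_def S.g_potential_def f_potential_def g_potential_def
      S.near_kernel_def near_kernel_def add.commute)
qed

lemmas swapped_facts = coupled_potentials.g_potential_antimono[OF swap, unfolded swap_g_potential]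
  coupled_potentials.g_potential_scale[OF swap, unfolded swap_g_potential]
  coupled_potentials.g_potential_le_f[OF swap, unfolded swap_g_potential]
  coupled_potentials.g_potential_finite[OF swap, unfolded swap_g_potential]
  coupled_potentials.f_near_far[OF swap, unfolded swap_g_potential swap_near_kernel]

lemmas f_potential_antimono = swapped_facts(1)
lemmas f_potential_scale = swapped_facts(2)
lemmas f_potential_le_g = swapped_facts(3)
lemmas f_potential_finite = swapped_facts(4)
lemmas g_near_far = swapped_facts(5)

section \<open>Pointwise bound by the far contributions\<close>

definition gpot :: "real \<Rightarrow> real" where "gpot r = enn2real (g_potential r)"
definition fpot :: "real \<Rightarrow> real" where "fpot r = enn2real (f_potential r)"

lemma pot_nonneg [simp]: "0 \<le> gpot r" "0 \<le> fpot r"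
  by (simp_all add: gpot_def fpot_def)

text \<open>The potentials are known to be finite for positive radius only; an infinite value would
  be turned into 0 by \<open>enn2real\<close>.\<close>

lemma ennreal_gpot: "0 < r \<Longrightarrow> ennreal (gpot r) = g_potential r"
  and ennreal_fpot: "0 < r \<Longrightarrow> ennreal (fpot r) = f_potential r"
  using g_potential_finite f_potential_finite by (auto simp: gpot_def fpot_def)

lemma gpot_scale:
  assumes "0 < r" "1 \<le> t" "0 < r'" "r' \<le> t * r"
  shows "gpot r \<le> t powr mu * gpot r'"
proof -
  have "ennreal (gpot r) \<le> ennreal (t powr mu) * g_potential (t * r)"
    using assms by (simp add: ennreal_gpot g_potential_scale)
  also have "\<dots> \<le> ennreal (t powr mu) * g_potential r'"
    using assms by (intro mult_left_mono g_potential_antimono) auto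
  also have "\<dots> = ennreal (t powr mu * gpot r')"
    using assms by (simp add: ennreal_gpot[symmetric] ennreal_mult')
  finally show ?thesis by (simp add: ennreal_le_iff)
qed

lemma fpot_scale:
  assumes "0 < r" "1 \<le> t" "0 < r'" "r' \<le> t * r"
  shows "fpot r \<le> t powr mu * fpot r'"
proof -
  have "ennreal (fpot r) \<le> ennreal (t powr mu) * f_potential (t * r)"
    using assms by (simp add: ennreal_fpot f_potential_scale)
  also have "\<dots> \<le> ennreal (t powr mu) * f_potential r'"
    using assms by (intro mult_left_mono f_potential_antimono) auto
  also have "\<dots> = ennreal (t powr mu * fpot r')"
    using assms by (simp add: ennreal_fpot[symmetric] ennreal_mult')
  finally show ?thesis by (simp add: ennreal_le_iff)
qed

text \<open>The far term S up to a constant. \<open>gpot r\<close> is the far part of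
  \<open>f\<close>; the second summand arises when the far part of \<open>g\<close>, of order
  \<open>fpot r\<close>, is raised to the power \<open>q\<close> and integrated against the near
  kernel.\<close>

definition profile :: "real \<Rightarrow> real" where
  "profile r = gpot r + fpot r powr q * r powr ((q + 1) * B - mu)"

lemma profile_nonneg [simp]: "0 \<le> profile r"
  by (simp add: profile_def)

text \<open>The Harnack property of both potentials, with the factor 4 that \<open>near_pair\<close>
  gives for two points having a common near point.\<close>

lemma profile_comparable:
  "\<exists>\<kappa>\<ge>1. \<forall>r r'. 0 < r \<longrightarrow> 0 < r' \<longrightarrow> r \<le> 4 * r' \<longrightarrow> r' \<le> 4 * r \<longrightarrow> profile r \<le> \<kappa> * profile r'"
proof (intro exI conjI allI impI)
  define e where "e = (q + 1) * B - mu"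
  define \<kappa> where "\<kappa> = 4 powr mu + (4 powr mu) powr q * 4 powr \<bar>e\<bar>"
  have "1 \<le> (4::real) powr mu" using params by (intro ge_one_powr_ge_zero) auto
  then show "1 \<le> \<kappa>" unfolding \<kappa>_def by (intro add_increasing2) auto
  fix r r' :: real
  assume r: "0 < r" "0 < r'" "r \<le> 4 * r'" "r' \<le> 4 * r"
  have 1: "gpot r \<le> 4 powr mu * gpot r'" and 2: "fpot r \<le> 4 powr mu * fpot r'"
    using r by (auto intro!: gpot_scale fpot_scale)
  have 3: "r powr e \<le> 4 powr \<bar>e\<bar> * r' powr e"
    using r by (intro powr_le_comparable) auto
  have "fpot r powr q * r powr e \<le> (4 powr mu * fpot r') powr q * (4 powr \<bar>e\<bar> * r' powr e)"
    using 2 3 pq by (intro mult_mono powr_mono2) auto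
  also have "\<dots> = (4 powr mu) powr q * 4 powr \<bar>e\<bar> * (fpot r' powr q * r' powr e)"
    by (simp add: powr_mult)
  finally have "profile r \<le> 4 powr mu * gpot r' + (4 powr mu) powr q * 4 powr \<bar>e\<bar> * (fpot r' powr q * r' powr e)"
    using 1 unfolding profile_def e_def[symmetric] by linarith
  also have "\<dots> \<le> \<kappa> * gpot r' + \<kappa> * (fpot r' powr q * r' powr e)"
    by (intro add_mono mult_right_mono) (auto simp: \<kappa>_def)
  finally show "profile r \<le> \<kappa> * profile r'" by (simp add: profile_def e_def algebra_simps)
qed

text \<open>A linearisation: one factor of \<open>g\<close> and one of \<open>f\<close> are split
  off their powers, and the remaining powers are frozen as weights.\<close>

definition local_operator :: "real \<Rightarrow> ('x \<Rightarrow> ennreal) \<Rightarrow> 'x \<Rightarrow> ennreal" where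
  "local_operator \<epsilon> h y = (\<integral>\<^sup>+x. ennreal (near_kernel \<epsilon> y x * g x powr (q - 1)) *
     (\<integral>\<^sup>+z. ennreal (near_kernel \<epsilon> z x * f z powr (p - 1)) * h z \<partial>\<sigma>) \<partial>\<tau>)"

lemma measurable_inner [measurable]:
  assumes [measurable]: "h \<in> borel_measurable \<sigma>"
  shows "(\<lambda>x. \<integral>\<^sup>+z. ennreal (near_kernel \<epsilon> z x * f z powr (p - 1)) * h z \<partial>\<sigma>) \<in> borel_measurable \<tau>"
proof -
  interpret X: sigma_finite_measure \<sigma> by (rule sigma_finite_x)
  show ?thesis by measurable
qed

text \<open>Write \<open>g\<close> as at most a near part \<open>W\<close> plus a far part
  \<open>F\<close>. If \<open>F <= W\<close>, then \<open>g <= 2 * W\<close> and only one factor of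
  \<open>g powr q\<close> is replaced, which gives twice the operator. Otherwise
  \<open>g <= 2 * F\<close> and the whole power is replaced. Splitting by cases avoids a mixed term
  \<open>g powr (q - 1) * F\<close>.\<close>

lemma near_part_le:
  assumes mu: "mu < (q + 1) * b"
  shows "\<exists>C>0. \<forall>\<epsilon> y. 0 < \<epsilon> \<longrightarrow> \<epsilon> \<le> 1 / 30 \<longrightarrow> y \<in> space \<sigma> \<longrightarrow>
    (\<integral>\<^sup>+x. ennreal (near_kernel \<epsilon> y x * g x powr q) \<partial>\<tau>)
    \<le> 2 * local_operator \<epsilon> (\<lambda>z. ennreal (f z)) y
      + ennreal (C * (\<epsilon> powr (- mu)) powr q * (fpot (nx y) powr q * nx y powr ((q + 1) * B - mu)))"
proof -
  obtain C0 where C0: "C0 > 0" and K: "\<And>\<epsilon> y. 0 < \<epsilon> \<Longrightarrow> \<epsilon> \<le> 1 / 30 \<Longrightarrow> y \<in> space \<sigma> \<Longrightarrow>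
    (\<integral>\<^sup>+x. ennreal (near_kernel \<epsilon> y x) \<partial>\<tau>) \<le> ennreal (C0 * nx y powr ((q + 1) * B - mu))"
    using near_kernel_integral[OF mu] by auto
  define C where "C = (2 * 2 powr mu) powr q * C0"
  have "C > 0" using C0 by (simp add: C_def)
  moreover have "(\<integral>\<^sup>+x. ennreal (near_kernel \<epsilon> y x * g x powr q) \<partial>\<tau>)
    \<le> 2 * local_operator \<epsilon> (\<lambda>z. ennreal (f z)) y
      + ennreal (C * (\<epsilon> powr (- mu)) powr q * (fpot (nx y) powr q * nx y powr ((q + 1) * B - mu)))"
    if e: "0 < \<epsilon>" "\<epsilon> \<le> 1 / 30" and y: "y \<in> space \<sigma>" for \<epsilon> :: real and y
  proof -
    have R: "0 < nx y" using nx_pos[OF y] .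
    define W where "W x = (\<integral>\<^sup>+z. ennreal (near_kernel \<epsilon> z x * f z powr (p - 1)) * ennreal (f z) \<partial>\<sigma>)" for x
    have [measurable]: "W \<in> borel_measurable \<tau>" unfolding W_def by measurable
    define F where "F = \<epsilon> powr (- mu) * (2 powr mu * fpot (nx y))"
    have F: "0 \<le> F" by (simp add: F_def)
    have pt: "ennreal (near_kernel \<epsilon> y x * g x powr q)
        \<le> 2 * (ennreal (near_kernel \<epsilon> y x * g x powr (q - 1)) * W x)
          + ennreal ((2 * F) powr q) * ennreal (near_kernel \<epsilon> y x)" if x: "x \<in> space \<tau>" for x
    proof (cases "d y x < \<epsilon> * (nx y + ny x)")
      case False
      then show ?thesis by (simp add: near_kernel_def)
    next
      case True
      have g0: "0 < g x" using g_pos[OF x] .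
      have W: "(\<integral>\<^sup>+z. ennreal (near_kernel \<epsilon> z x * f z powr p) \<partial>\<sigma>) = W x"
        unfolding W_def
      proof (rule nn_integral_cong)
        fix z assume "z \<in> space \<sigma>"
        then have "0 < f z" by (rule f_pos)
        then have "f z powr p = f z powr (p - 1) * f z" using powr_mult_base[of "f z" "p - 1"]
          by (simp add: mult.commute)
        then show "ennreal (near_kernel \<epsilon> z x * f z powr p)
            = ennreal (near_kernel \<epsilon> z x * f z powr (p - 1)) * ennreal (f z)"
          by (simp add: ennreal_mult'[symmetric] mult.assoc)
      qed
      have "ennreal (g x) \<le> W x + ennreal (\<epsilon> powr (- mu)) * f_potential (ny x)"
        using g_near_far[OF x e(1)] unfolding W .
      also have "f_potential (ny x) = ennreal (fpot (ny x))" using ny_pos[OF x] by (simp add: ennreal_fpot)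
      also have "W x + ennreal (\<epsilon> powr (- mu)) * ennreal (fpot (ny x)) \<le> W x + ennreal F"
      proof -
        have "fpot (ny x) \<le> 2 powr mu * fpot (nx y)"
          using near_comparable[OF y x e True] R ny_pos[OF x] by (intro fpot_scale) auto
        then show ?thesis unfolding F_def
          by (intro add_left_mono) (simp add: ennreal_mult'[symmetric] ennreal_leI mult_left_mono)
      qed
      finally have gx: "ennreal (g x) \<le> W x + ennreal F" .
      have "ennreal (g x powr q) \<le> 2 * (ennreal (g x powr (q - 1)) * W x) + ennreal ((2 * F) powr q)"
      proof (cases "ennreal F \<le> W x")
        case True
        have "ennreal (g x powr q) = ennreal (g x powr (q - 1)) * ennreal (g x)"
          using g0 powr_mult_base[of "g x" "q - 1"] by (simp add: ennreal_mult'[symmetric] mult.commute)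
        also have "\<dots> \<le> ennreal (g x powr (q - 1)) * (W x + W x)"
          using True gx by (intro mult_left_mono) (auto intro: order_trans add_left_mono)
        also have "\<dots> = 2 * (ennreal (g x powr (q - 1)) * W x)"
          by (simp add: mult_2[symmetric] mult.left_commute)
        finally show ?thesis by (simp add: add_increasing2)
      next
        case False
        then have "ennreal (g x) \<le> ennreal F + ennreal F"
          using gx by (meson add_right_mono order_trans linear)
        then have "g x \<le> 2 * F" using F by (simp add: ennreal_plus[symmetric] ennreal_le_iff del: ennreal_plus)
        then have "ennreal (g x powr q) \<le> ennreal ((2 * F) powr q)"
          using g0 pq by (intro ennreal_leI powr_mono2) auto
        then show ?thesis by (simp add: add_increasing)
      qed
      then have "ennreal (near_kernel \<epsilon> y x) * ennreal (g x powr q)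
        \<le> ennreal (near_kernel \<epsilon> y x) * (2 * (ennreal (g x powr (q - 1)) * W x) + ennreal ((2 * F) powr q))"
        by (rule mult_left_mono) simp
      then show ?thesis
        by (simp add: ennreal_mult' distrib_left mult_ac)
    qed
    have "(\<integral>\<^sup>+x. ennreal (near_kernel \<epsilon> y x * g x powr q) \<partial>\<tau>)
      \<le> (\<integral>\<^sup>+x. 2 * (ennreal (near_kernel \<epsilon> y x * g x powr (q - 1)) * W x)
          + ennreal ((2 * F) powr q) * ennreal (near_kernel \<epsilon> y x) \<partial>\<tau>)"
      by (rule nn_integral_mono) (rule pt)
    also have "\<dots> = 2 * local_operator \<epsilon> (\<lambda>z. ennreal (f z)) y
        + ennreal ((2 * F) powr q) * (\<integral>\<^sup>+x. ennreal (near_kernel \<epsilon> y x) \<partial>\<tau>)"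
      using y by (simp add: local_operator_def W_def[symmetric] nn_integral_add nn_integral_cmult)
    also have "\<dots> \<le> 2 * local_operator \<epsilon> (\<lambda>z. ennreal (f z)) y
        + ennreal ((2 * F) powr q) * ennreal (C0 * nx y powr ((q + 1) * B - mu))"
      by (intro add_left_mono mult_left_mono K e y) auto
    also have "ennreal ((2 * F) powr q) * ennreal (C0 * nx y powr ((q + 1) * B - mu))
      = ennreal (C * (\<epsilon> powr (- mu)) powr q * (fpot (nx y) powr q * nx y powr ((q + 1) * B - mu)))"
      by (subst ennreal_mult'[symmetric]) (simp_all add: C_def F_def powr_mult mult_ac)
    finally show ?thesis .
  qed
  ultimately show ?thesis by blast
qed

text \<open>The kernel of the operator is symmetric with respect to the measure with density \<open>f powr (p - 1)\<close>
  and has small total mass, so by Schur's test the operator is a contraction on \<open>L\<^sup>2\<close> of that measure.\<close>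

lemma local_operator_absorb:
  assumes [measurable]: "h \<in> borel_measurable \<sigma>"
    and small: "\<And>y. y \<in> space \<sigma> \<Longrightarrow>
      (\<integral>\<^sup>+x. ennreal (near_kernel \<epsilon> y x * g x powr (q - 1)) * local_mass \<epsilon> x \<partial>\<tau>) \<le> ennreal (1 / 4)"
    and h: "\<And>y. y \<in> space \<sigma> \<Longrightarrow> h y \<le> 2 * local_operator \<epsilon> h y"
    and hf: "\<And>y. y \<in> space \<sigma> \<Longrightarrow> h y \<le> ennreal (f y)"
  shows "AE y in \<sigma>. h y = 0"
proof -
  interpret pair_sigma_finite \<sigma> \<tau> by (rule pair_sigma_finite_xy)
  define k where "k y x = ennreal (near_kernel \<epsilon> y x)" for y x
  define \<phi> where "\<phi> z = ennreal (f z powr (p - 1))" for z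
  define \<psi> where "\<psi> x = ennreal (g x powr (q - 1))" for x
  have [measurable]: "\<phi> \<in> borel_measurable \<sigma>" "\<psi> \<in> borel_measurable \<tau>"
    unfolding \<phi>_def \<psi>_def by measurable
  have [measurable (raw)]: "(\<lambda>w. k (u w) (v w)) \<in> borel_measurable N" if [measurable]: "u \<in> N \<rightarrow>\<^sub>M \<sigma>" "v \<in> N \<rightarrow>\<^sub>M \<tau>" for u v N
    unfolding k_def by measurable
  define W where "W x = (\<integral>\<^sup>+z. k z x * \<phi> z * h z \<partial>\<sigma>)" for x
  have Lh: "local_operator \<epsilon> h y = (\<integral>\<^sup>+x. k y x * \<psi> x * W x \<partial>\<tau>)" for y
    by (simp add: local_operator_def W_def k_def \<phi>_def \<psi>_def ennreal_mult')
  have mass: "local_mass \<epsilon> x = (\<integral>\<^sup>+z. k z x * \<phi> z \<partial>\<sigma>)" for x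
    by (simp add: local_mass_def k_def \<phi>_def ennreal_mult')
  have [measurable]: "W \<in> borel_measurable \<tau>" unfolding W_def by measurable
  define I where "I = (\<integral>\<^sup>+y. \<phi> y * (h y)\<^sup>2 \<partial>\<sigma>)"
  \<comment> \<open>Cauchy-Schwarz for the density \<open>k z x * \<phi> z\<close>, of which each
    factor carries the square root.\<close>
  have CS: "(W x)\<^sup>2 \<le> (\<integral>\<^sup>+z. k z x * \<phi> z * (h z)\<^sup>2 \<partial>\<sigma>) * local_mass \<epsilon> x" if x: "x \<in> space \<tau>" for x
  proof -
    define r where "r z = ennreal (sqrt (near_kernel \<epsilon> z x * f z powr (p - 1)))" for z
    have [measurable]: "r \<in> borel_measurable \<sigma>" unfolding r_def using x by measurable
    have r2: "(r z)\<^sup>2 = k z x * \<phi> z" for z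
      by (simp add: r_def k_def \<phi>_def ennreal_power ennreal_mult'[symmetric])
    have "(\<integral>\<^sup>+z. (r z * h z) * r z \<partial>\<sigma>)\<^sup>2 \<le> (\<integral>\<^sup>+z. (r z * h z)\<^sup>2 \<partial>\<sigma>) * (\<integral>\<^sup>+z. (r z)\<^sup>2 \<partial>\<sigma>)"
      by (rule Cauchy_Schwarz_nn_integral) measurable
    moreover have "(r z * h z) * r z = k z x * \<phi> z * h z" for z
      unfolding r2[symmetric] by (simp add: power2_eq_square mult_ac)
    ultimately show ?thesis by (simp add: W_def mass r2 power_mult_distrib)
  qed
  have "I \<le> (\<integral>\<^sup>+y. \<phi> y * (h y * (2 * local_operator \<epsilon> h y)) \<partial>\<sigma>)"
    unfolding I_def power2_eq_square by (intro nn_integral_mono mult_left_mono h) auto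
  also have "\<dots> = (\<integral>\<^sup>+y. (\<integral>\<^sup>+x. 2 * (\<psi> x * W x * (k y x * \<phi> y * h y)) \<partial>\<tau>) \<partial>\<sigma>)"
    unfolding Lh
    by (intro nn_integral_cong, subst nn_integral_cmult[symmetric], simp, subst nn_integral_cmult[symmetric], simp,
      subst nn_integral_cmult[symmetric], simp) (auto simp: mult_ac)
  also have "\<dots> = (\<integral>\<^sup>+x. (\<integral>\<^sup>+y. 2 * (\<psi> x * W x * (k y x * \<phi> y * h y)) \<partial>\<sigma>) \<partial>\<tau>)"
    by (rule Fubini'[symmetric]) measurable
  also have "\<dots> = (\<integral>\<^sup>+x. 2 * (\<psi> x * (W x)\<^sup>2) \<partial>\<tau>)"
    by (intro nn_integral_cong) (simp add: nn_integral_cmult power2_eq_square mult.assoc, simp add: W_def mult.assoc)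
  also have "\<dots> \<le> (\<integral>\<^sup>+x. 2 * (\<psi> x * ((\<integral>\<^sup>+z. k z x * \<phi> z * (h z)\<^sup>2 \<partial>\<sigma>) * local_mass \<epsilon> x)) \<partial>\<tau>)"
    by (intro nn_integral_mono mult_left_mono CS) auto
  also have "\<dots> = (\<integral>\<^sup>+x. (\<integral>\<^sup>+z. 2 * (\<psi> x * local_mass \<epsilon> x * (k z x * \<phi> z * (h z)\<^sup>2)) \<partial>\<sigma>) \<partial>\<tau>)"
  proof (rule nn_integral_cong)
    fix x assume x: "x \<in> space \<tau>"
    have "(\<integral>\<^sup>+z. 2 * (\<psi> x * local_mass \<epsilon> x * (k z x * \<phi> z * (h z)\<^sup>2)) \<partial>\<sigma>)
      = (\<integral>\<^sup>+z. (2 * (\<psi> x * local_mass \<epsilon> x)) * (k z x * \<phi> z * (h z)\<^sup>2) \<partial>\<sigma>)"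
      by (simp only: mult.assoc)
    also have "\<dots> = (2 * (\<psi> x * local_mass \<epsilon> x)) * (\<integral>\<^sup>+z. k z x * \<phi> z * (h z)\<^sup>2 \<partial>\<sigma>)"
      using x by (intro nn_integral_cmult) measurable
    finally show "2 * (\<psi> x * ((\<integral>\<^sup>+z. k z x * \<phi> z * (h z)\<^sup>2 \<partial>\<sigma>) * local_mass \<epsilon> x))
      = (\<integral>\<^sup>+z. 2 * (\<psi> x * local_mass \<epsilon> x * (k z x * \<phi> z * (h z)\<^sup>2)) \<partial>\<sigma>)"
      by (simp only: mult.assoc mult.commute[of "\<integral>\<^sup>+z. k z x * (\<phi> z * (h z)\<^sup>2) \<partial>\<sigma>"])
  qed
  \<comment> \<open>With the integrals exchanged, the inner one is L 1 at \<open>z\<close>, hence at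
    most 1/4; the factor 2 from the hypothesis on \<open>h\<close> leaves 1/2.\<close>
  also have "\<dots> = (\<integral>\<^sup>+z. (\<integral>\<^sup>+x. 2 * (\<psi> x * local_mass \<epsilon> x * (k z x * \<phi> z * (h z)\<^sup>2)) \<partial>\<tau>) \<partial>\<sigma>)"
    by (rule Fubini') measurable
  also have "\<dots> = (\<integral>\<^sup>+z. 2 * (\<phi> z * (h z)\<^sup>2) * (\<integral>\<^sup>+x. ennreal (near_kernel \<epsilon> z x * g x powr (q - 1)) * local_mass \<epsilon> x \<partial>\<tau>) \<partial>\<sigma>)"
    by (intro nn_integral_cong, subst nn_integral_cmult[symmetric], simp)
      (auto simp: k_def \<psi>_def ennreal_mult' mult_ac)
  also have "\<dots> \<le> (\<integral>\<^sup>+z. 2 * (\<phi> z * (h z)\<^sup>2) * ennreal (1 / 4) \<partial>\<sigma>)"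
    by (intro nn_integral_mono mult_left_mono small) auto
  also have "\<dots> = (\<integral>\<^sup>+z. ennreal (1 / 2) * (\<phi> z * (h z)\<^sup>2) \<partial>\<sigma>)"
  proof (rule nn_integral_cong)
    fix z
    have "2 * ennreal (1 / 4) = ennreal (1 / 2)"
      using ennreal_mult'[of 2 "1/4"] by simp
    then show "2 * (\<phi> z * (h z)\<^sup>2) * ennreal (1 / 4) = ennreal (1 / 2) * (\<phi> z * (h z)\<^sup>2)"
      by (metis mult.assoc mult.commute)
  qed
  also have "\<dots> = ennreal (1 / 2) * I" unfolding I_def by (rule nn_integral_cmult) measurable
  finally have half: "I \<le> ennreal (1 / 2) * I" .
  \<comment> \<open>An infinite \<open>I\<close> would also satisfy \<open>I <= I / 2\<close>.
    Finiteness comes from \<open>h <= f\<close>, since the weight times the square of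
    \<open>f\<close> is \<open>f powr (p + 1)\<close>.\<close>
  have "I \<le> (\<integral>\<^sup>+y. ennreal (f y powr (p + 1)) \<partial>\<sigma>)"
    unfolding I_def
  proof (rule nn_integral_mono)
    fix y assume y: "y \<in> space \<sigma>"
    have "\<phi> y * (h y)\<^sup>2 \<le> \<phi> y * (ennreal (f y))\<^sup>2"
      using hf[OF y] by (intro mult_left_mono power_mono) auto
    also have "\<dots> = ennreal (f y powr (p - 1) * (f y)\<^sup>2)"
      using f_pos[OF y] by (simp add: \<phi>_def ennreal_power ennreal_mult')
    also have "f y powr (p - 1) * (f y)\<^sup>2 = f y powr (p + 1)"
      using f_pos[OF y] powr_add[of "f y" "p - 1" 2] by (simp add: add.commute)
    finally show "\<phi> y * (h y)\<^sup>2 \<le> ennreal (f y powr (p + 1))" .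
  qed
  then have "I < \<infinity>" using f_norm by (rule le_less_trans)
  then obtain i where i: "I = ennreal i" "0 \<le> i" by (cases I) auto
  then have "ennreal i \<le> ennreal (1 / 2 * i)" using half by (subst ennreal_mult') simp_all
  then have "i \<le> 1 / 2 * i" using i by (subst (asm) ennreal_le_iff) auto
  then have "I = 0" using i by simp
  then have "AE y in \<sigma>. \<phi> y * (h y)\<^sup>2 = 0"
    unfolding I_def by (subst (asm) nn_integral_0_iff_AE) measurable
  with AE_space show ?thesis
  proof eventually_elim
    case (elim y)
    then show ?case using f_pos[of y] by (auto simp: \<phi>_def ennreal_eq_0_iff not_le)
  qed
qed

text \<open>On pairs with a common near point \<open>S\<close> varies by a factor at most
  \<open>\<kappa>\<close>, so L (2 S) is at most \<open>2 * \<kappa> * S\<close> times L 1. Once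
  this is below S / 2, subtracting \<open>2 * S\<close> from \<open>f\<close> inside the operator
  turns f <= 2 L f + S into f <= 2 L h + 2 S, and \<open>local_operator_absorb\<close> removes
  h.\<close>

lemma local_bound:
  assumes mu: "mu < 2 * b"
  shows "\<exists>C>0. \<forall>y\<in>space \<sigma>. f y \<le> C * profile (nx y)"
proof -
  have mu': "mu < (q + 1) * b"
  proof -
    have "2 * b < (q + 1) * b" using params pq by (intro mult_strict_right_mono) auto
    then show ?thesis using mu by simp
  qed
  obtain CL \<gamma> where CL: "CL > 0" "\<gamma> > 0" and L: "\<And>\<epsilon> y. 0 < \<epsilon> \<Longrightarrow> \<epsilon> \<le> 1 / 30 \<Longrightarrow> y \<in> space \<sigma> \<Longrightarrow>
    (\<integral>\<^sup>+x. ennreal (near_kernel \<epsilon> y x * g x powr (q - 1)) * local_mass \<epsilon> x \<partial>\<tau>) \<le> ennreal (CL * \<epsilon> powr \<gamma>)"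
    using local_operator_small[OF mu] by blast
  obtain C1 where C1: "C1 > 0" and near: "\<And>\<epsilon> y. 0 < \<epsilon> \<Longrightarrow> \<epsilon> \<le> 1 / 30 \<Longrightarrow> y \<in> space \<sigma> \<Longrightarrow>
    (\<integral>\<^sup>+x. ennreal (near_kernel \<epsilon> y x * g x powr q) \<partial>\<tau>)
    \<le> 2 * local_operator \<epsilon> (\<lambda>z. ennreal (f z)) y
      + ennreal (C1 * (\<epsilon> powr (- mu)) powr q * (fpot (nx y) powr q * nx y powr ((q + 1) * B - mu)))"
    using near_part_le[OF mu'] by blast
  obtain \<kappa> where \<kappa>: "1 \<le> \<kappa>" and comp: "\<And>r r'. 0 < r \<Longrightarrow> 0 < r' \<Longrightarrow> r \<le> 4 * r' \<Longrightarrow> r' \<le> 4 * r \<Longrightarrow> profile r \<le> \<kappa> * profile r'"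
    using profile_comparable by blast
  \<comment> \<open>Chosen so that
    \<open>CL * \<epsilon> powr \<gamma> <= 1 / (4 * \<kappa>)\<close>, which serves both to get L
    (2 S) <= S / 2 and, as \<open>\<kappa> >= 1\<close>, the bound 1/4 for the absorption.\<close>
  define \<epsilon> where "\<epsilon> = min (1 / 30) ((1 / (4 * \<kappa> * CL)) powr (1 / \<gamma>))"
  have e: "0 < \<epsilon>" "\<epsilon> \<le> 1 / 30" using \<kappa> CL by (auto simp: \<epsilon>_def)
  have "\<epsilon> powr \<gamma> \<le> ((1 / (4 * \<kappa> * CL)) powr (1 / \<gamma>)) powr \<gamma>"
    using e CL by (intro powr_mono2) (auto simp: \<epsilon>_def)
  also have "\<dots> = 1 / (4 * \<kappa> * CL)" using \<kappa> CL by (simp add: powr_powr)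
  finally have "CL * \<epsilon> powr \<gamma> \<le> CL * (1 / (4 * \<kappa> * CL))" using CL by (intro mult_left_mono) auto
  then have eL: "CL * \<epsilon> powr \<gamma> \<le> 1 / (4 * \<kappa>)" using CL \<kappa> by simp
  have L1: "(\<integral>\<^sup>+x. ennreal (near_kernel \<epsilon> y x * g x powr (q - 1)) * local_mass \<epsilon> x \<partial>\<tau>) \<le> ennreal (1 / (4 * \<kappa>))"
    if "y \<in> space \<sigma>" for y
    using L[OF e that] eL by (meson ennreal_leI order_trans)
  define C where "C = \<epsilon> powr (- mu) + C1 * (\<epsilon> powr (- mu)) powr q"
  have C: "C > 0" using C1 e by (auto simp: C_def intro: add_pos_pos)
  define S where "S y = C * profile (nx y)" for y
  have S0: "0 \<le> S y" for y using C by (simp add: S_def)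
  have prof_meas: "S \<in> borel_measurable \<sigma>"
  proof -
    interpret X: sigma_finite_measure \<sigma> by (rule sigma_finite_x)
    interpret Y: sigma_finite_measure \<tau> by (rule sigma_finite_y)
    show ?thesis unfolding S_def profile_def gpot_def fpot_def g_potential_def f_potential_def by measurable
  qed
  note [measurable] = prof_meas
  \<comment> \<open>\<open>ennreal\<close> sends negative reals to 0, so this is the positive part
    of \<open>f z - 2 * S z\<close>.\<close>
  define h where "h z = ennreal (f z - 2 * S z)" for z
  have [measurable]: "h \<in> borel_measurable \<sigma>" unfolding h_def by measurable
  have main: "ennreal (f y) \<le> 2 * local_operator \<epsilon> h y + ennreal (2 * S y)" if y: "y \<in> space \<sigma>" for y
  proof -
    have "ennreal (f y) \<le> (\<integral>\<^sup>+x. ennreal (near_kernel \<epsilon> y x * g x powr q) \<partial>\<tau>)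
        + ennreal (\<epsilon> powr (- mu)) * ennreal (gpot (nx y))"
      using f_near_far[OF y e(1)] nx_pos[OF y] by (simp add: ennreal_gpot)
    also have "\<dots> \<le> (2 * local_operator \<epsilon> (\<lambda>z. ennreal (f z)) y
      + ennreal (C1 * (\<epsilon> powr (- mu)) powr q * (fpot (nx y) powr q * nx y powr ((q + 1) * B - mu))))
        + ennreal (\<epsilon> powr (- mu)) * ennreal (gpot (nx y))"
      by (intro add_right_mono near e y)
    also have "\<dots> = 2 * local_operator \<epsilon> (\<lambda>z. ennreal (f z)) y
      + ennreal (C1 * (\<epsilon> powr (- mu)) powr q * (fpot (nx y) powr q * nx y powr ((q + 1) * B - mu))
        + \<epsilon> powr (- mu) * gpot (nx y))"
      using C1 by (simp add: ennreal_mult'[symmetric] add.assoc)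
    also have "\<dots> \<le> 2 * local_operator \<epsilon> (\<lambda>z. ennreal (f z)) y + ennreal (S y)"
    proof (intro add_left_mono ennreal_leI)
      have "C1 * (\<epsilon> powr (- mu)) powr q * (fpot (nx y) powr q * nx y powr ((q + 1) * B - mu)) + \<epsilon> powr (- mu) * gpot (nx y)
        \<le> C * (fpot (nx y) powr q * nx y powr ((q + 1) * B - mu)) + C * gpot (nx y)"
        using C1 by (intro add_mono mult_right_mono) (auto simp: C_def)
      then show "C1 * (\<epsilon> powr (- mu)) powr q * (fpot (nx y) powr q * nx y powr ((q + 1) * B - mu)) + \<epsilon> powr (- mu) * gpot (nx y) \<le> S y"
        by (simp add: S_def profile_def algebra_simps)
    qed
    also have "local_operator \<epsilon> (\<lambda>z. ennreal (f z)) y \<le> local_operator \<epsilon> h y + ennreal (S y / 2)"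
    proof -
      have "local_operator \<epsilon> (\<lambda>z. ennreal (f z)) y \<le> (\<integral>\<^sup>+x. ennreal (near_kernel \<epsilon> y x * g x powr (q - 1)) *
          ((\<integral>\<^sup>+z. ennreal (near_kernel \<epsilon> z x * f z powr (p - 1)) * h z \<partial>\<sigma>) + ennreal (2 * \<kappa> * S y) * local_mass \<epsilon> x) \<partial>\<tau>)"
        unfolding local_operator_def
      proof (rule nn_integral_mono)
        fix x assume x: "x \<in> space \<tau>"
        show "ennreal (near_kernel \<epsilon> y x * g x powr (q - 1)) *
          (\<integral>\<^sup>+z. ennreal (near_kernel \<epsilon> z x * f z powr (p - 1)) * ennreal (f z) \<partial>\<sigma>)
          \<le> ennreal (near_kernel \<epsilon> y x * g x powr (q - 1)) *
          ((\<integral>\<^sup>+z. ennreal (near_kernel \<epsilon> z x * f z powr (p - 1)) * h z \<partial>\<sigma>) + ennreal (2 * \<kappa> * S y) * local_mass \<epsilon> x)"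
        proof (cases "d y x < \<epsilon> * (nx y + ny x)")
          case False
          then show ?thesis by (simp add: near_kernel_def)
        next
          case nyx: True
          have "(\<integral>\<^sup>+z. ennreal (near_kernel \<epsilon> z x * f z powr (p - 1)) * ennreal (f z) \<partial>\<sigma>)
            \<le> (\<integral>\<^sup>+z. ennreal (near_kernel \<epsilon> z x * f z powr (p - 1)) * h z
               + ennreal (2 * \<kappa> * S y) * ennreal (near_kernel \<epsilon> z x * f z powr (p - 1)) \<partial>\<sigma>)"
          proof (rule nn_integral_mono)
            fix z assume z: "z \<in> space \<sigma>"
            show "ennreal (near_kernel \<epsilon> z x * f z powr (p - 1)) * ennreal (f z)
              \<le> ennreal (near_kernel \<epsilon> z x * f z powr (p - 1)) * h z
               + ennreal (2 * \<kappa> * S y) * ennreal (near_kernel \<epsilon> z x * f z powr (p - 1))"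
            proof (cases "d z x < \<epsilon> * (nx z + ny x)")
              case False
              then show ?thesis by (simp add: near_kernel_def)
            next
              case True
              have "profile (nx z) \<le> \<kappa> * profile (nx y)"
                using near_pair[OF y z x e nyx True] nx_pos y z by (intro comp) auto
              then have "C * profile (nx z) \<le> C * (\<kappa> * profile (nx y))" using C by (intro mult_left_mono) auto
              then have "S z \<le> \<kappa> * S y" by (simp add: S_def mult_ac)
              then have "f z \<le> max 0 (f z - 2 * S z) + 2 * \<kappa> * S y" by auto
              then have "ennreal (f z) \<le> ennreal (max 0 (f z - 2 * S z) + 2 * \<kappa> * S y)" by (rule ennreal_leI)
              also have "\<dots> = h z + ennreal (2 * \<kappa> * S y)"
                using S0[of y] \<kappa> by (subst ennreal_plus) (auto simp: h_def max_def ennreal_neg)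
              finally have "ennreal (f z) \<le> h z + ennreal (2 * \<kappa> * S y)" .
              from mult_left_mono[OF this, of "ennreal (near_kernel \<epsilon> z x * f z powr (p - 1))"]
              show ?thesis by (simp add: distrib_left distrib_right mult.commute)
            qed
          qed
          also have "\<dots> = (\<integral>\<^sup>+z. ennreal (near_kernel \<epsilon> z x * f z powr (p - 1)) * h z \<partial>\<sigma>)
             + ennreal (2 * \<kappa> * S y) * local_mass \<epsilon> x"
            using x by (simp add: nn_integral_add nn_integral_cmult local_mass_def)
          finally show ?thesis by (rule mult_left_mono) simp
        qed
      qed
      also have "\<dots> = (\<integral>\<^sup>+x. ennreal (near_kernel \<epsilon> y x * g x powr (q - 1)) *
          (\<integral>\<^sup>+z. ennreal (near_kernel \<epsilon> z x * f z powr (p - 1)) * h z \<partial>\<sigma>)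
          + ennreal (2 * \<kappa> * S y) * (ennreal (near_kernel \<epsilon> y x * g x powr (q - 1)) * local_mass \<epsilon> x) \<partial>\<tau>)"
        by (simp add: distrib_left mult.left_commute)
      also have "\<dots> = local_operator \<epsilon> h y + ennreal (2 * \<kappa> * S y) *
          (\<integral>\<^sup>+x. ennreal (near_kernel \<epsilon> y x * g x powr (q - 1)) * local_mass \<epsilon> x \<partial>\<tau>)"
        unfolding local_operator_def using y
        by (subst nn_integral_add, measurable, subst nn_integral_cmult) auto
      also have "\<dots> \<le> local_operator \<epsilon> h y + ennreal (2 * \<kappa> * S y) * ennreal (1 / (4 * \<kappa>))"
        by (intro add_left_mono mult_left_mono L1 y) auto
      also have "ennreal (2 * \<kappa> * S y) * ennreal (1 / (4 * \<kappa>)) = ennreal (S y / 2)"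
        using \<kappa> S0[of y] by (simp add: ennreal_mult'[symmetric])
      finally show ?thesis .
    qed
    then have "2 * local_operator \<epsilon> (\<lambda>z. ennreal (f z)) y + ennreal (S y)
      \<le> 2 * (local_operator \<epsilon> h y + ennreal (S y / 2)) + ennreal (S y)"
      by (intro add_right_mono mult_left_mono) auto
    also have "\<dots> = 2 * local_operator \<epsilon> h y + (2 * ennreal (S y / 2) + ennreal (S y))"
      by (simp add: distrib_left add.assoc)
    also have "2 * ennreal (S y / 2) + ennreal (S y) = ennreal (2 * S y)"
    proof -
      have "2 * ennreal (S y / 2) = ennreal (2 * (S y / 2))" by (subst ennreal_mult') simp_all
      also have "2 * (S y / 2) = S y" by simp
      finally show ?thesis
        using S0[of y] ennreal_plus[of "S y" "S y"] by (simp only: mult_2)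
    qed
    finally show ?thesis .
  qed
  have "AE y in \<sigma>. h y = 0"
  proof (rule local_operator_absorb[of h \<epsilon>])
    fix y assume y: "y \<in> space \<sigma>"
    show "(\<integral>\<^sup>+x. ennreal (near_kernel \<epsilon> y x * g x powr (q - 1)) * local_mass \<epsilon> x \<partial>\<tau>) \<le> ennreal (1 / 4)"
      by (rule order_trans[OF L1[OF y]]) (use \<kappa> in \<open>auto intro!: ennreal_leI simp: field_simps\<close>)
    show "h y \<le> ennreal (f y)" using S0[of y] by (auto simp: h_def intro!: ennreal_leI)
    have "h y = ennreal (f y) - ennreal (2 * S y)" using S0[of y] by (simp add: h_def ennreal_minus)
    also have "\<dots> \<le> 2 * local_operator \<epsilon> h y"
      using main[OF y] by (simp add: ennreal_minus_le_iff add.commute)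
    finally show "h y \<le> 2 * local_operator \<epsilon> h y" .
  qed measurable
  \<comment> \<open>The null set on which \<open>h\<close> may be nonzero is invisible to the
    operator, so \<open>main\<close> gives \<open>f <= 2 * S\<close> at every point.\<close>
  then have zero: "local_operator \<epsilon> h y = 0" for y
  proof -
    have "(\<integral>\<^sup>+z. ennreal (near_kernel \<epsilon> z x * f z powr (p - 1)) * h z \<partial>\<sigma>) = (\<integral>\<^sup>+z. 0 \<partial>\<sigma>)" for x
      using \<open>AE y in \<sigma>. h y = 0\<close> by (intro nn_integral_cong_AE) auto
    then show ?thesis by (simp add: local_operator_def)
  qed
  have "f y \<le> (2 * C) * profile (nx y)" if y: "y \<in> space \<sigma>" for y
    using main[OF y] zero[of y] S0[of y] by (simp add: S_def mult.assoc ennreal_le_iff)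
  moreover have "2 * C > 0" using C by simp
  ultimately show ?thesis by blast
qed

end

subsection \<open>The limit at the origin\<close>

text \<open>Dominated convergence: \<open>w\<close> is positive, so the sets where \<open>w\<close>
  is below \<open>inverse (real (Suc i))\<close> shrink to the empty set.\<close>

lemma nn_integral_tail_small:
  fixes h :: "'z \<Rightarrow> ennreal" and w :: "'z \<Rightarrow> real"
  assumes [measurable]: "h \<in> borel_measurable M" "w \<in> borel_measurable M"
    and fin: "(\<integral>\<^sup>+z. h z \<partial>M) < \<infinity>" and w: "\<And>z. z \<in> space M \<Longrightarrow> 0 < w z" and e: "0 < e"
  shows "\<exists>r>0. (\<integral>\<^sup>+z. (if w z < r then h z else 0) \<partial>M) \<le> ennreal e"
proof -
  define u where "u i z = (if w z < inverse (real (Suc i)) then h z else 0)" for i z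
  have [measurable]: "u i \<in> borel_measurable M" for i unfolding u_def by measurable
  have "(\<lambda>i. \<integral>\<^sup>+z. u i z \<partial>M) \<longlonglongrightarrow> (\<integral>\<^sup>+z. 0 \<partial>M)"
  proof (rule nn_integral_dominated_convergence[where w = h])
    show "AE z in M. (\<lambda>i. u i z) \<longlonglongrightarrow> 0"
    proof (rule AE_I2)
      fix z assume "z \<in> space M"
      then have "\<forall>\<^sub>F i in sequentially. inverse (real (Suc i)) < w z"
        using w LIMSEQ_inverse_real_of_nat order_tendstoD(2) by blast
      then have "\<forall>\<^sub>F i in sequentially. u i z = 0" by eventually_elim (auto simp: u_def)
      then show "(\<lambda>i. u i z) \<longlonglongrightarrow> 0" by (rule tendsto_eventually)
    qed
  qed (use fin in \<open>auto simp: u_def\<close>)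
  then have "\<forall>\<^sub>F i in sequentially. (\<integral>\<^sup>+z. u i z \<partial>M) < ennreal e"
    using e by (intro order_tendstoD(2)) auto
  then obtain i where "(\<integral>\<^sup>+z. u i z \<partial>M) < ennreal e" by (auto dest: eventually_happens)
  then show ?thesis by (intro exI[of _ "inverse (real (Suc i))"]) (auto simp: u_def)
qed

context coupled_potentials
begin

definition tail :: "real \<Rightarrow> ennreal" where
  "tail r = (\<integral>\<^sup>+x. (if ny x < r then ennreal (g x powr q * ny x powr (- mu)) else 0) \<partial>\<tau>)"

definition origin_value :: ennreal where
  "origin_value = (\<integral>\<^sup>+x. ennreal (g x powr q * ny x powr (- mu)) \<partial>\<tau>)"

lemma tail_mono: "r \<le> r' \<Longrightarrow> tail r \<le> tail r'"
  unfolding tail_def by (intro nn_integral_mono) auto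

lemma tail_le: "tail r \<le> origin_value"
  unfolding tail_def origin_value_def by (intro nn_integral_mono) auto

lemma tail_small:
  assumes "origin_value < \<infinity>" "0 < e"
  shows "\<exists>r>0. tail r \<le> ennreal e"
  unfolding tail_def using assms ny_pos
  by (intro nn_integral_tail_small) (auto simp: origin_value_def)

lemma g_potential_le_origin: "0 < r \<Longrightarrow> g_potential r \<le> origin_value"
  unfolding g_potential_def origin_value_def using ny_pos params
  by (intro nn_integral_mono ennreal_leI mult_left_mono powr_mono2') auto

text \<open>On the annulus \<open>R < ny x < 2 * R\<close>, of measure at least
  \<open>c' * R powr ((q + 1) * B)\<close>, \<open>g\<close> is at least
  \<open>2 powr (- mu) * fpot R\<close>. So the second term of \<open>profile\<close> is at most a
  constant times the share of that annulus in the integral at the origin.\<close>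

lemma fpot_tail:
  assumes R: "0 < R"
  shows "ennreal ((2 powr (- mu)) powr q * 2 powr (- mu) * c' * (fpot R powr q * R powr ((q + 1) * B - mu))) \<le> tail (2 * R)"
proof -
  define H where "H = (2 powr (- mu) * fpot R) powr q * (2 * R) powr (- mu)"
  have "R powr ((q + 1) * B - mu) = R powr (- mu) * R powr ((q + 1) * B)"
    by (simp add: powr_add[symmetric])
  then have "(2 powr (- mu)) powr q * 2 powr (- mu) * c' * (fpot R powr q * R powr ((q + 1) * B - mu))
    = H * (c' * R powr ((q + 1) * B))"
    using R by (simp only: H_def powr_mult mult_ac)
  then have "ennreal ((2 powr (- mu)) powr q * 2 powr (- mu) * c' * (fpot R powr q * R powr ((q + 1) * B - mu)))
    = ennreal H * ennreal (c' * R powr ((q + 1) * B))"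
    by (simp only: ennreal_mult'[symmetric] H_def mult_nonneg_nonneg powr_ge_zero)
  also have "\<dots> \<le> ennreal H * emeasure \<tau> {x \<in> space \<tau>. R < ny x \<and> ny x < 2 * R}"
    by (intro mult_left_mono annulus_y R) auto
  also have "\<dots> = (\<integral>\<^sup>+x. ennreal H * indicator {x \<in> space \<tau>. R < ny x \<and> ny x < 2 * R} x \<partial>\<tau>)"
    by (simp add: nn_integral_cmult_indicator)
  also have "\<dots> \<le> tail (2 * R)"
    unfolding tail_def
  proof (rule nn_integral_mono)
    fix x assume x: "x \<in> space \<tau>"
    show "ennreal H * indicator {x \<in> space \<tau>. R < ny x \<and> ny x < 2 * R} x
      \<le> (if ny x < 2 * R then ennreal (g x powr q * ny x powr (- mu)) else 0)"
    proof (cases "R < ny x \<and> ny x < 2 * R")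
      case False
      then show ?thesis by auto
    next
      case True
      have "fpot R \<le> 2 powr mu * fpot (ny x)" using True R by (intro fpot_scale) auto
      then have "2 powr (- mu) * fpot R \<le> fpot (ny x)"
        by (simp add: powr_minus field_simps)
      moreover have "fpot (ny x) \<le> g x"
        using f_potential_le_g[OF x] True R g_pos[OF x] by (simp add: ennreal_fpot[symmetric] ennreal_le_iff)
      ultimately have "(2 powr (- mu) * fpot R) powr q \<le> g x powr q"
        using pq by (intro powr_mono2) auto
      moreover have "(2 * R) powr (- mu) \<le> ny x powr (- mu)"
        using True R params by (intro powr_mono2') auto
      ultimately have "H \<le> g x powr q * ny x powr (- mu)" unfolding H_def by (intro mult_mono) auto
      then show ?thesis using True x by (simp add: ennreal_leI)
    qed
  qed
  finally show ?thesis .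
qed

text \<open>The integrand is positive, and the annulus of radius 1 shows that \<open>\<tau>\<close>
  is not the zero measure.\<close>

lemma gpot_pos: assumes "0 < r" shows "0 < gpot r"
proof (rule ccontr)
  assume "\<not> 0 < gpot r"
  then have "gpot r = 0" using pot_nonneg(1)[of r] by linarith
  then have "g_potential r = 0" using ennreal_gpot[OF assms] by simp
  then have "AE x in \<tau>. ennreal (g x powr q * (r + ny x) powr (- mu)) = 0"
    unfolding g_potential_def by (subst (asm) nn_integral_0_iff_AE) auto
  with AE_space have "AE x in \<tau>. \<not> (1 < ny x \<and> ny x < 2 * 1)"
  proof eventually_elim
    case (elim x)
    then have "0 < g x powr q * (r + ny x) powr (- mu)" using assms g_pos[of x] ny_pos[of x] by simp
    then show ?case using elim by (simp add: ennreal_eq_0_iff)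
  qed
  then have "emeasure \<tau> {x \<in> space \<tau>. 1 < ny x \<and> ny x < 2 * 1} = 0" by (rule emeasure_eq_0_AE)
  then have "ennreal c' \<le> 0" using annulus_y[of 1] by simp
  then show False using params by (simp add: ennreal_eq_0_iff)
qed

text \<open>If \<open>A \<le> 0\<close>, small annuli carry a fixed amount of \<open>\<sigma>\<close>-mass, while \<open>f\<close> is bounded below
  near the origin.\<close>

lemma A_pos: "0 < A"
proof (rule ccontr)
  assume A: "\<not> 0 < A"
  \<comment> \<open>If \<open>A <= 0\<close>, this bounds from below the integral of
    \<open>f powr (p + 1)\<close> over each annulus with \<open>R <= 1\<close>; a tail of at most
    \<open>m / 2\<close> contradicts it.\<close>
  define m where "m = gpot 2 powr (p + 1) * c'"
  have m: "0 < m" using gpot_pos[of 2] params by (simp add: m_def)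
  obtain r where r: "0 < r" and tail: "(\<integral>\<^sup>+y. (if nx y < r then ennreal (f y powr (p + 1)) else 0) \<partial>\<sigma>) \<le> ennreal (m / 2)"
    using nn_integral_tail_small[of "\<lambda>y. ennreal (f y powr (p + 1))" \<sigma> nx "m / 2"] f_norm nx_pos m by auto
  define R where "R = min 1 (r / 2)"
  have R: "0 < R" "R \<le> 1" "2 * R \<le> r" using r by (auto simp: R_def)
  have "1 \<le> R powr ((p + 1) * A)"
    using R A pq powr_mono2'[of "- ((p + 1) * A)" R 1] by (simp add: mult_nonneg_nonpos powr_le1 ge_one_powr_ge_zero)
      (smt (verit, best) A mult_nonneg_nonpos powr_mono' powr_zero_eq_one pq)
  then have "c' * 1 \<le> c' * R powr ((p + 1) * A)" using params by (intro mult_left_mono) auto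
  then have "ennreal c' \<le> emeasure \<sigma> {y \<in> space \<sigma>. R < nx y \<and> nx y < 2 * R}"
    using annulus_x[OF R(1)] by (auto intro: order_trans[rotated] ennreal_leI)
  then have "ennreal (gpot 2 powr (p + 1)) * ennreal c'
      \<le> ennreal (gpot 2 powr (p + 1)) * emeasure \<sigma> {y \<in> space \<sigma>. R < nx y \<and> nx y < 2 * R}"
    by (intro mult_left_mono) auto
  also have "\<dots> = (\<integral>\<^sup>+y. ennreal (gpot 2 powr (p + 1)) * indicator {y \<in> space \<sigma>. R < nx y \<and> nx y < 2 * R} y \<partial>\<sigma>)"
    by (simp add: nn_integral_cmult_indicator)
  also have "\<dots> \<le> (\<integral>\<^sup>+y. (if nx y < r then ennreal (f y powr (p + 1)) else 0) \<partial>\<sigma>)"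
  proof (rule nn_integral_mono)
    fix y assume y: "y \<in> space \<sigma>"
    show "ennreal (gpot 2 powr (p + 1)) * indicator {y \<in> space \<sigma>. R < nx y \<and> nx y < 2 * R} y
      \<le> (if nx y < r then ennreal (f y powr (p + 1)) else 0)"
    proof (cases "R < nx y \<and> nx y < 2 * R")
      case False
      then show ?thesis by auto
    next
      case True
      have "ennreal (gpot 2) \<le> g_potential (nx y)"
        using True R by (simp add: ennreal_gpot g_potential_antimono)
      also have "\<dots> \<le> ennreal (f y)" by (rule g_potential_le_f[OF y])
      finally have "gpot 2 \<le> f y" using f_pos[OF y] by (simp add: ennreal_le_iff)
      then have "gpot 2 powr (p + 1) \<le> f y powr (p + 1)" using pq by (intro powr_mono2) auto
      then show ?thesis using True R y by (simp add: ennreal_leI)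
    qed
  qed
  also note tail
  finally have "ennreal m \<le> ennreal (m / 2)" by (simp add: m_def ennreal_mult')
  then show False using m by (simp add: ennreal_le_iff)
qed

text \<open>If \<open>mu < 2 * b\<close>, \<open>f\<close> is bounded by a constant, so L f is small
  with \<open>\<epsilon>\<close>, and the far term of \<open>near_part_le\<close> is small near the
  origin by \<open>fpot_tail\<close>. If \<open>mu < 2 * a\<close>, \<open>g\<close> is bounded by
  the exchanged profile; its \<open>q\<close>-th power times the integral of the near kernel gives
  the same far term plus a positive power of \<open>nx y\<close>.\<close>

lemma near_small:
  assumes mu: "mu < (q + 1) * b" and fin: "origin_value < \<infinity>" and e: "0 < (e::real)"
  shows "\<exists>\<epsilon>>0. \<epsilon> \<le> 1 / 30 \<and> (\<exists>r>0. \<forall>y\<in>space \<sigma>. nx y < r \<longrightarrow>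
    (\<integral>\<^sup>+x. ennreal (near_kernel \<epsilon> y x * g x powr q) \<partial>\<tau>) \<le> ennreal e)"
proof -
  define i0 where "i0 = enn2real origin_value"
  have i0: "0 \<le> i0" "origin_value = ennreal i0" using fin by (auto simp: i0_def)
  define ex where "ex = (q + 1) * B - mu"
  define k where "k = (2 powr (- mu)) powr q * 2 powr (- mu) * c'"
  have k: "0 < k" using params by (simp add: k_def)
  \<comment> \<open>Turns a bound on the tail into a bound on the far part of \<open>g\<close>, in
    the form in which both cases use it.\<close>
  have ft: "fpot R powr q * R powr ex \<le> t" if "0 < R" "tail (2 * R) \<le> ennreal (k * t)" "0 \<le> t" for R t
  proof -
    have "ennreal (k * (fpot R powr q * R powr ex)) \<le> ennreal (k * t)"
      using fpot_tail[OF that(1)] that(2) unfolding k_def ex_def by (rule order_trans)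
    then have "k * (fpot R powr q * R powr ex) \<le> k * t" using k that by (subst (asm) ennreal_le_iff) auto
    then show ?thesis using k by simp
  qed
  have gp: "gpot R \<le> i0" if "0 < R" for R
    using g_potential_le_origin[OF that] i0 by (simp add: ennreal_gpot[OF that, symmetric] ennreal_le_iff)
  have "mu < 2 * b \<or> mu < 2 * a" using params by auto
  then show ?thesis
  proof
    assume mub: "mu < 2 * b"
    obtain C where C: "C > 0" and fb: "\<And>y. y \<in> space \<sigma> \<Longrightarrow> f y \<le> C * profile (nx y)"
      using local_bound[OF mub] by blast
    \<comment> \<open>\<open>i0\<close> bounds \<open>gpot\<close>, and \<open>i0 / k\<close> bounds
      the other term of the profile by \<open>ft\<close>, with all of \<open>origin_value\<close> as
      bound for the tail. The 1 makes \<open>S\<close> positive.\<close>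
    define S where "S = C * (i0 + i0 / k) + 1"
    have S: "0 < S" using C i0 k by (auto simp: S_def intro!: add_nonneg_pos)
    have fS: "f y \<le> S" if y: "y \<in> space \<sigma>" for y
    proof -
      have "tail (2 * nx y) \<le> ennreal (k * (i0 / k))" using tail_le i0 k by simp
      then have "profile (nx y) \<le> i0 + i0 / k"
        unfolding profile_def ex_def[symmetric] using gp ft nx_pos[OF y] i0 k by (intro add_mono) auto
      then have "C * profile (nx y) \<le> C * (i0 + i0 / k)" using C by (intro mult_left_mono) auto
      then show ?thesis using fb[OF y] by (simp add: S_def)
    qed
    obtain CL \<gamma> where CL: "CL > 0" "\<gamma> > 0" and L: "\<And>\<epsilon> y. 0 < \<epsilon> \<Longrightarrow> \<epsilon> \<le> 1 / 30 \<Longrightarrow> y \<in> space \<sigma> \<Longrightarrow>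
      (\<integral>\<^sup>+x. ennreal (near_kernel \<epsilon> y x * g x powr (q - 1)) * local_mass \<epsilon> x \<partial>\<tau>) \<le> ennreal (CL * \<epsilon> powr \<gamma>)"
      using local_operator_small[OF mub] by blast
    obtain C1 where C1: "C1 > 0" and near: "\<And>\<epsilon> y. 0 < \<epsilon> \<Longrightarrow> \<epsilon> \<le> 1 / 30 \<Longrightarrow> y \<in> space \<sigma> \<Longrightarrow>
      (\<integral>\<^sup>+x. ennreal (near_kernel \<epsilon> y x * g x powr q) \<partial>\<tau>)
      \<le> 2 * local_operator \<epsilon> (\<lambda>z. ennreal (f z)) y
        + ennreal (C1 * (\<epsilon> powr (- mu)) powr q * (fpot (nx y) powr q * nx y powr ex))"
      using near_part_le[OF mu] unfolding ex_def by blast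
    define \<epsilon> where "\<epsilon> = min (1 / 30) ((e / (4 * S * CL)) powr (1 / \<gamma>))"
    have eps: "0 < \<epsilon>" "\<epsilon> \<le> 1 / 30" using S CL e by (auto simp: \<epsilon>_def)
    have "\<epsilon> powr \<gamma> \<le> ((e / (4 * S * CL)) powr (1 / \<gamma>)) powr \<gamma>"
      using eps CL by (intro powr_mono2) (auto simp: \<epsilon>_def)
    also have "\<dots> = e / (4 * S * CL)" using S CL e by (simp add: powr_powr)
    finally have "2 * S * CL * \<epsilon> powr \<gamma> \<le> 2 * S * CL * (e / (4 * S * CL))"
      using CL S by (intro mult_left_mono) auto
    then have eL: "2 * (S * (CL * \<epsilon> powr \<gamma>)) \<le> e / 2" using CL S by (simp add: field_simps)
    define K where "K = C1 * (\<epsilon> powr (- mu)) powr q"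
    have K: "0 < K" using C1 eps by (simp add: K_def)
    obtain r where r: "0 < r" "tail r \<le> ennreal (k * (e / (2 * K)))"
      using tail_small[OF fin, of "k * (e / (2 * K))"] k e K by auto
    have "(\<integral>\<^sup>+x. ennreal (near_kernel \<epsilon> y x * g x powr q) \<partial>\<tau>) \<le> ennreal e"
      if y: "y \<in> space \<sigma>" and yr: "nx y < r / 2" for y
    proof -
      have "tail (2 * nx y) \<le> ennreal (k * (e / (2 * K)))"
        by (rule order_trans[OF tail_mono r(2)]) (use yr in auto)
      then have "fpot (nx y) powr q * nx y powr ex \<le> e / (2 * K)"
        using ft[OF nx_pos[OF y]] e K by simp
      then have "K * (fpot (nx y) powr q * nx y powr ex) \<le> K * (e / (2 * K))"
        using K by (intro mult_left_mono) auto
      then have t2: "K * (fpot (nx y) powr q * nx y powr ex) \<le> e / 2" using K by simp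
      have "local_operator \<epsilon> (\<lambda>z. ennreal (f z)) y
        \<le> (\<integral>\<^sup>+x. ennreal (near_kernel \<epsilon> y x * g x powr (q - 1)) * (ennreal S * local_mass \<epsilon> x) \<partial>\<tau>)"
        unfolding local_operator_def
      proof (intro nn_integral_mono mult_left_mono)
        fix x assume x: "x \<in> space \<tau>"
        have "(\<integral>\<^sup>+z. ennreal (near_kernel \<epsilon> z x * f z powr (p - 1)) * ennreal (f z) \<partial>\<sigma>)
          \<le> (\<integral>\<^sup>+z. ennreal S * ennreal (near_kernel \<epsilon> z x * f z powr (p - 1)) \<partial>\<sigma>)"
          using fS by (intro nn_integral_mono) (subst mult.commute, intro mult_right_mono ennreal_leI, auto)
        then show "(\<integral>\<^sup>+z. ennreal (near_kernel \<epsilon> z x * f z powr (p - 1)) * ennreal (f z) \<partial>\<sigma>)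
          \<le> ennreal S * local_mass \<epsilon> x"
          unfolding local_mass_def using x by (subst nn_integral_cmult[symmetric]) auto
      qed auto
      also have "\<dots> = ennreal S * (\<integral>\<^sup>+x. ennreal (near_kernel \<epsilon> y x * g x powr (q - 1)) * local_mass \<epsilon> x \<partial>\<tau>)"
        using y by (subst nn_integral_cmult[symmetric]) (auto simp: mult.left_commute)
      also have "\<dots> \<le> ennreal S * ennreal (CL * \<epsilon> powr \<gamma>)"
        by (intro mult_left_mono L eps y) auto
      also have "\<dots> = ennreal (S * (CL * \<epsilon> powr \<gamma>))" using S by (simp add: ennreal_mult')
      finally have "2 * local_operator \<epsilon> (\<lambda>z. ennreal (f z)) y \<le> 2 * ennreal (S * (CL * \<epsilon> powr \<gamma>))"
        by (intro mult_left_mono) auto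
      also have "\<dots> = ennreal (2 * (S * (CL * \<epsilon> powr \<gamma>)))" by (subst (2) ennreal_mult') simp_all
      also have "\<dots> \<le> ennreal (e / 2)" using eL by (rule ennreal_leI)
      finally have t1: "2 * local_operator \<epsilon> (\<lambda>z. ennreal (f z)) y \<le> ennreal (e / 2)" .
      have "(\<integral>\<^sup>+x. ennreal (near_kernel \<epsilon> y x * g x powr q) \<partial>\<tau>) \<le> ennreal (e / 2) + ennreal (e / 2)"
        using near[OF eps y] t1 ennreal_leI[OF t2] unfolding K_def by (meson add_mono order_trans)
      also have "\<dots> = ennreal e" using e by (subst ennreal_plus[symmetric]) auto
      finally show ?thesis .
    qed
    then show ?thesis using eps r by (intro exI[of _ \<epsilon>] conjI exI[of _ "r / 2"]) auto
  next
    assume mua: "mu < 2 * a"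
    interpret S: coupled_potentials \<tau> \<sigma> "\<lambda>x y. d y x" dy dx ny nx q p B A b a mu c c' g f
      by (rule swap)
    have Sprof: "S.profile r = fpot r + gpot r powr p * r powr ((p + 1) * A - mu)" for r
      by (simp add: S.profile_def S.gpot_def S.fpot_def swap_f_potential swap_g_potential fpot_def gpot_def)
    obtain C where C: "C > 0" and gb: "\<And>x. x \<in> space \<tau> \<Longrightarrow> g x \<le> C * S.profile (ny x)"
      using S.local_bound[OF mua] by blast
    obtain \<kappa> where \<kappa>: "1 \<le> \<kappa>" and comp: "\<And>r r'. 0 < r \<Longrightarrow> 0 < r' \<Longrightarrow> r \<le> 4 * r' \<Longrightarrow> r' \<le> 4 * r \<Longrightarrow> S.profile r \<le> \<kappa> * S.profile r'"
      using S.profile_comparable by blast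
    obtain C0 where C0: "C0 > 0" and kern: "\<And>\<epsilon> y. 0 < \<epsilon> \<Longrightarrow> \<epsilon> \<le> 1 / 30 \<Longrightarrow> y \<in> space \<sigma> \<Longrightarrow>
      (\<integral>\<^sup>+x. ennreal (near_kernel \<epsilon> y x) \<partial>\<tau>) \<le> ennreal (C0 * nx y powr ex)"
      using near_kernel_integral[OF mu] unfolding ex_def by auto
    define K where "K = (C * \<kappa>) powr q * C0 * 2 powr q"
    have K: "0 < K" using C C0 \<kappa> by (simp add: K_def)
    define K2 where "K2 = K * (i0 powr p) powr q + 1"
    have K2: "0 < K2" using K by (auto simp: K2_def intro!: add_nonneg_pos)
    \<comment> \<open>What \<open>((p + 1) * A - mu) * q + (q + 1) * B - mu\<close> becomes after
      inserting \<open>mu = A + B\<close>. It is positive by \<open>A_pos\<close>.\<close>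
    define E where "E = (p * q - 1) * A"
    have "1 * 1 < p * q" using pq by (intro mult_strict_mono) auto
    then have E: "0 < E" using A_pos by (simp add: E_def)
    obtain r where r: "0 < r" "tail r \<le> ennreal (k * (e / (2 * K)))"
      using tail_small[OF fin, of "k * (e / (2 * K))"] k e K by auto
    define r' where "r' = min (r / 2) ((e / (2 * K2)) powr (1 / E))"
    have r': "0 < r'" using r e K2 by (simp add: r'_def)
    \<comment> \<open>In this case \<open>\<epsilon>\<close> stays fixed; smallness comes from
      \<open>nx y\<close> alone.\<close>
    have eps: "0 < (1 / 30 :: real)" "(1 / 30 :: real) \<le> 1 / 30" by auto
    have "(\<integral>\<^sup>+x. ennreal (near_kernel (1 / 30) y x * g x powr q) \<partial>\<tau>) \<le> ennreal e"
      if y: "y \<in> space \<sigma>" and yr: "nx y < r'" for y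
    proof -
      define R where "R = nx y"
      have R: "0 < R" using nx_pos[OF y] by (simp add: R_def)
      define H where "H = (C * \<kappa> * S.profile R) powr q"
      have "(\<integral>\<^sup>+x. ennreal (near_kernel (1 / 30) y x * g x powr q) \<partial>\<tau>)
        \<le> (\<integral>\<^sup>+x. ennreal H * ennreal (near_kernel (1 / 30) y x) \<partial>\<tau>)"
      proof (rule nn_integral_mono)
        fix x assume x: "x \<in> space \<tau>"
        show "ennreal (near_kernel (1 / 30) y x * g x powr q) \<le> ennreal H * ennreal (near_kernel (1 / 30) y x)"
        proof (cases "d y x < 1 / 30 * (nx y + ny x)")
          case False
          then show ?thesis by (simp add: near_kernel_def)
        next
          case True
          have "S.profile (ny x) \<le> \<kappa> * S.profile R"
            using near_comparable[OF y x eps True] R ny_pos[OF x] by (intro comp) (auto simp: R_def)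
          then have "C * S.profile (ny x) \<le> C * (\<kappa> * S.profile R)" using C by (intro mult_left_mono) auto
          then have "g x \<le> C * \<kappa> * S.profile R" using gb[OF x] by simp
          then have "g x powr q \<le> H" using g_pos[OF x] pq unfolding H_def by (intro powr_mono2) auto
          then have "near_kernel (1 / 30) y x * g x powr q \<le> near_kernel (1 / 30) y x * H"
            by (intro mult_left_mono) auto
          then have "ennreal (near_kernel (1 / 30) y x * g x powr q) \<le> ennreal (H * near_kernel (1 / 30) y x)"
            by (intro ennreal_leI) (simp add: mult.commute)
          then show ?thesis by (simp add: H_def ennreal_mult')
        qed
      qed
      also have "\<dots> = ennreal H * (\<integral>\<^sup>+x. ennreal (near_kernel (1 / 30) y x) \<partial>\<tau>)"
        using y by (intro nn_integral_cmult) measurable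
      also have "\<dots> \<le> ennreal H * ennreal (C0 * R powr ex)"
        unfolding R_def by (intro mult_left_mono kern y) auto
      also have "\<dots> = ennreal (H * (C0 * R powr ex))" by (simp add: H_def ennreal_mult')
      also have "H * (C0 * R powr ex) \<le> e"
      proof -
        define v where "v = gpot R powr p * R powr ((p + 1) * A - mu)"
        have v: "0 \<le> v" by (simp add: v_def)
        have "(fpot R + v) powr q \<le> (2 * max (fpot R) v) powr q"
          using pq v by (intro powr_mono2) auto
        also have "\<dots> = 2 powr q * (max (fpot R) v) powr q" using v by (simp add: powr_mult)
        also have "\<dots> \<le> 2 powr q * (fpot R powr q + v powr q)" by (intro mult_left_mono) (auto simp: max_def)
        finally have "H \<le> (C * \<kappa>) powr q * (2 powr q * (fpot R powr q + v powr q))"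
          using C \<kappa> v unfolding H_def Sprof v_def[symmetric] by (simp add: powr_mult mult_left_mono)
        then have "H * (C0 * R powr ex) \<le> (C * \<kappa>) powr q * (2 powr q * (fpot R powr q + v powr q)) * (C0 * R powr ex)"
          using C0 by (intro mult_right_mono) auto
        also have "\<dots> = K * (fpot R powr q * R powr ex) + K * (v powr q * R powr ex)"
          by (simp add: K_def algebra_simps)
        also have "K * (fpot R powr q * R powr ex) \<le> e / 2"
        proof -
          have "tail (2 * R) \<le> ennreal (k * (e / (2 * K)))"
            by (rule order_trans[OF tail_mono r(2)]) (use yr in \<open>auto simp: r'_def R_def\<close>)
          then have "fpot R powr q * R powr ex \<le> e / (2 * K)"
            using ft[OF R] e K by simp
          then have "K * (fpot R powr q * R powr ex) \<le> K * (e / (2 * K))"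
            using K by (intro mult_left_mono) auto
          then show ?thesis using K by simp
        qed
        also have "K * (v powr q * R powr ex) \<le> e / 2"
        proof -
          have "v powr q * R powr ex = (gpot R powr p) powr q * R powr (((p + 1) * A - mu) * q + ex)"
            by (simp add: v_def powr_mult powr_powr powr_add)
          also have "((p + 1) * A - mu) * q + ex = E"
            using params by (simp add: ex_def E_def algebra_simps)
          also have "(gpot R powr p) powr q * R powr E \<le> (i0 powr p) powr q * R powr E"
            using gp[OF R] pq by (intro mult_right_mono powr_mono2) auto
          finally have "K * (v powr q * R powr ex) \<le> K * ((i0 powr p) powr q * R powr E)"
            using K by (intro mult_left_mono) auto
          also have "\<dots> \<le> K2 * R powr E"
            by (simp add: K2_def algebra_simps)
          also have "\<dots> \<le> K2 * ((e / (2 * K2)) powr (1 / E)) powr E"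
            using K2 R E yr by (intro mult_left_mono powr_mono2) (auto simp: r'_def R_def)
          also have "\<dots> = e / 2" using K2 E e by (simp add: powr_powr)
          finally show ?thesis .
        qed
        finally show ?thesis by simp
      qed
      finally show ?thesis by (simp add: ennreal_leI)
    qed
    then show ?thesis using r' by (intro exI[of _ "1 / 30"] conjI exI[of _ r']) auto
  qed
qed

text \<open>The upper bound splits the integral for \<open>f y\<close> into near points, handled by
  \<open>near_small\<close>; far points with \<open>ny x < s\<close>, where
  \<open>d y x >= \<epsilon> * ny x\<close> and the tail absorbs the factor
  \<open>\<epsilon> powr (- mu)\<close>; and far points with \<open>ny x >= s\<close>, where
  \<open>d y x >= t * ny x\<close> as soon as \<open>nx y < s * (1 - t)\<close>. If the value is
  infinite, only the lower bound is at stake. The filter is left general to cover limits at a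
  boundary point and from inside the half space.\<close>

theorem f_tendsto:
  assumes mu: "mu < (q + 1) * b"
    and F: "(nx \<longlongrightarrow> 0) F" "\<forall>\<^sub>F y in F. y \<in> space \<sigma>"
  shows "((\<lambda>y. ennreal (f y)) \<longlongrightarrow> origin_value) F"
proof (rule order_tendstoI)
  fix l assume l: "l < origin_value"
  define G where "G n x = ennreal (g x powr q * (inverse (real (Suc n)) + ny x) powr (- mu))" for n x
  have mono: "G i x \<le> G j x" if "i \<le> j" "x \<in> space \<tau>" for i j x
  proof -
    have "inverse (real (Suc j)) \<le> inverse (real (Suc i))" using that(1) by (intro le_imp_inverse_le) auto
    moreover have "0 < inverse (real (Suc j)) + ny x" using ny_pos[OF that(2)] by (intro add_pos_pos) auto
    ultimately show ?thesis
      unfolding G_def using params by (intro ennreal_leI mult_left_mono powr_mono2') auto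
  qed
  have "origin_value = (\<integral>\<^sup>+x. (SUP n. G n x) \<partial>\<tau>)"
    unfolding origin_value_def
  proof (rule nn_integral_cong)
    fix x assume x: "x \<in> space \<tau>"
    have "(\<lambda>n. G n x) \<longlonglongrightarrow> ennreal (g x powr q * (0 + ny x) powr (- mu))"
      unfolding G_def using ny_pos[OF x]
      by (intro tendsto_ennrealI tendsto_intros LIMSEQ_inverse_real_of_nat) auto
    moreover have "(\<lambda>n. G n x) \<longlonglongrightarrow> (SUP n. G n x)"
      using mono[OF _ x] by (intro LIMSEQ_SUP) (auto simp: incseq_def)
    ultimately show "ennreal (g x powr q * ny x powr (- mu)) = (SUP n. G n x)"
      using LIMSEQ_unique by fastforce
  qed
  also have "\<dots> = (SUP n. g_potential (inverse (real (Suc n))))"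
    unfolding g_potential_def G_def[symmetric]
    by (rule nn_integral_monotone_convergence_SUP_AE) (auto intro!: mono, simp add: G_def)
  finally obtain n where n: "l < g_potential (inverse (real (Suc n)))"
    using l by (auto simp: less_SUP_iff)
  have "\<forall>\<^sub>F y in F. nx y < inverse (real (Suc n))" using F(1) by (rule order_tendstoD(2)) simp
  then show "\<forall>\<^sub>F y in F. l < ennreal (f y)" using F(2)
  proof eventually_elim
    case (elim y)
    have "g_potential (inverse (real (Suc n))) \<le> g_potential (nx y)"
      using elim nx_pos[of y] by (intro g_potential_antimono) auto
    also have "\<dots> \<le> ennreal (f y)" by (rule g_potential_le_f[OF elim(2)])
    finally show ?case using n by simp
  qed
next
  fix u assume u: "origin_value < u"
  then have fin: "origin_value < \<infinity>" using top.not_eq_extremum by fastforce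
  define i0 where "i0 = enn2real origin_value"
  have i0: "0 \<le> i0" "origin_value = ennreal i0" using fin by (auto simp: i0_def)
  obtain e where e: "0 < e" "ennreal (i0 + e) < u"
  proof (cases u)
    case (real v)
    then have "i0 < v" using u i0 by (simp add: ennreal_less_iff)
    then have "0 < (v - i0) / 2" "ennreal (i0 + (v - i0) / 2) < u"
      using i0 real by (auto simp: ennreal_less_iff field_simps)
    then show ?thesis by (rule that)
  next
    case top
    then show ?thesis by (intro that[of 1]) auto
  qed
  \<comment> \<open>\<open>t\<close> is taken so close to 1 that replacing \<open>d y x\<close> by
    \<open>t * ny x\<close> costs at most \<open>e / 3\<close>.\<close>
  have "((\<lambda>t. t powr (- mu) * i0) \<longlongrightarrow> 1 powr (- mu) * i0) (at_left (1::real))"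
    by (intro tendsto_intros) auto
  then have "\<forall>\<^sub>F t in at_left (1::real). t powr (- mu) * i0 < i0 + e / 3"
    using e by (intro order_tendstoD(2)) auto
  moreover have "\<forall>\<^sub>F t in at_left (1::real). t \<in> {0<..<1}"
    by (rule eventually_at_left_real) simp
  ultimately have "\<forall>\<^sub>F t in at_left (1::real). t powr (- mu) * i0 < i0 + e / 3 \<and> t \<in> {0<..<1}"
    by eventually_elim simp
  then obtain t where t: "t powr (- mu) * i0 < i0 + e / 3" "0 < t" "t < 1"
    using eventually_happens'[of "at_left (1::real)"] by auto
  obtain \<epsilon> r where eps: "0 < \<epsilon>" "\<epsilon> \<le> 1 / 30" and r: "0 < r" and near: "\<And>y. y \<in> space \<sigma> \<Longrightarrow> nx y < r \<Longrightarrow>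
    (\<integral>\<^sup>+x. ennreal (near_kernel \<epsilon> y x * g x powr q) \<partial>\<tau>) \<le> ennreal (e / 3)"
    using near_small[OF mu fin, of "e / 3"] e by auto
  define m where "m = \<epsilon> powr (- mu)"
  have m: "0 < m" using eps by (simp add: m_def)
  obtain s where s: "0 < s" "tail s \<le> ennreal (e / (3 * m))"
    using tail_small[OF fin, of "e / (3 * m)"] e m by auto
  have "\<forall>\<^sub>F y in F. nx y < min r (s * (1 - t))"
    using F(1) r s t by (intro order_tendstoD(2)) auto
  then show "\<forall>\<^sub>F y in F. ennreal (f y) < u" using F(2)
  proof eventually_elim
    case (elim y)
    note y = elim(2)
    have "ennreal (f y) \<le> (\<integral>\<^sup>+x. ennreal (near_kernel \<epsilon> y x * g x powr q)
      + (ennreal (t powr (- mu)) * ennreal (g x powr q * ny x powr (- mu))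
      + ennreal m * (if ny x < s then ennreal (g x powr q * ny x powr (- mu)) else 0)) \<partial>\<tau>)"
      unfolding f_eq[OF y]
    proof (rule nn_integral_mono)
      fix x assume x: "x \<in> space \<tau>"
      have dp: "0 < d y x" "0 < nx y" "0 < ny x" using d_pos[OF y x] nx_pos[OF y] ny_pos[OF x] by auto
      have "d y x powr (- mu) \<le> near_kernel \<epsilon> y x + (t powr (- mu) * ny x powr (- mu)
        + m * (if ny x < s then ny x powr (- mu) else 0))"
      proof (cases "d y x < \<epsilon> * (nx y + ny x)")
        case True
        then show ?thesis using m by (simp add: near_kernel_def)
      next
        case far: False
        show ?thesis
        proof (cases "ny x < s")
          case True
          have "\<epsilon> * ny x \<le> \<epsilon> * (nx y + ny x)" using dp eps by (intro mult_left_mono) auto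
          then have "\<epsilon> * ny x \<le> d y x" using far by linarith
          then have "d y x powr (- mu) \<le> (\<epsilon> * ny x) powr (- mu)"
            using dp eps params by (intro powr_mono2') auto
          also have "\<dots> = m * ny x powr (- mu)" by (simp add: m_def powr_mult)
          finally show ?thesis using True by (simp add: add_increasing)
        next
          case False
          have "nx y < s * (1 - t)" using elim by simp
          also have "\<dots> \<le> ny x * (1 - t)" using False t by (intro mult_right_mono) auto
          finally have "t * ny x \<le> d y x" using nx_diff[OF y x] by (simp add: algebra_simps)
          then have "d y x powr (- mu) \<le> (t * ny x) powr (- mu)"
            using dp t params by (intro powr_mono2') auto
          then show ?thesis using m False by (simp add: powr_mult add_increasing)
        qed
      qed
      from mult_left_mono[OF this, of "g x powr q"]
      show "ennreal (g x powr q * d y x powr (- mu)) \<le> ennreal (near_kernel \<epsilon> y x * g x powr q)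
      + (ennreal (t powr (- mu)) * ennreal (g x powr q * ny x powr (- mu))
      + ennreal m * (if ny x < s then ennreal (g x powr q * ny x powr (- mu)) else 0))"
        using m by (auto simp: ennreal_mult'[symmetric] ennreal_plus[symmetric] algebra_simps
          intro!: ennreal_leI simp del: ennreal_plus)
    qed
    also have "\<dots> = (\<integral>\<^sup>+x. ennreal (near_kernel \<epsilon> y x * g x powr q) \<partial>\<tau>)
      + (ennreal (t powr (- mu)) * origin_value + ennreal m * tail s)"
      unfolding origin_value_def tail_def using y by (simp add: nn_integral_add nn_integral_cmult)
    also have "\<dots> \<le> ennreal (e / 3) + (ennreal (i0 + e / 3) + ennreal m * ennreal (e / (3 * m)))"
    proof (intro add_mono near y mult_left_mono s)
      show "nx y < r" using elim by simp
      show "ennreal (t powr (- mu)) * origin_value \<le> ennreal (i0 + e / 3)"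
        using t i0 by (simp add: ennreal_mult'[symmetric] ennreal_leI)
    qed auto
    also have "\<dots> = ennreal (i0 + e)"
      using m e i0 by (simp add: ennreal_mult'[symmetric] ennreal_plus[symmetric] del: ennreal_plus)
    finally show ?case using e(2) by simp
  qed
qed

end

subsection \<open>Weighted Lebesgue measures on the half space and its boundary\<close>

text \<open>Completion keeps Borel sets and their measures, so the countable cover for
  \<open>lborel\<close> still works.\<close>

lemma sigma_finite_lebesgue: "sigma_finite_measure (lebesgue :: 'a::euclidean_space measure)"
proof -
  obtain F :: "'a set set" where F: "countable F" "F \<subseteq> sets lborel" "\<Union>F = space lborel"
    "\<forall>X\<in>F. emeasure lborel X \<noteq> \<infinity>"
    using lborel.sigma_finite_countable by blast
  then show ?thesis
    by (intro sigma_finite_measure.intro exI[of _ F]) (auto simp: subset_eq)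
qed

text \<open>Restricting the space to \<open>S\<close> allows positivity and the equations to be
  demanded on \<open>S\<close> only. The base is Lebesgue rather than Borel measure because the
  solutions are only Lebesgue measurable.\<close>

definition weighted_lebesgue :: "'a::euclidean_space set \<Rightarrow> ('a \<Rightarrow> real) \<Rightarrow> 'a measure" where
  "weighted_lebesgue S w = density (lebesgue_on S) (\<lambda>z. ennreal (w z))"

lemma space_weighted_lebesgue [simp]: "space (weighted_lebesgue S w) = S"
  by (simp add: weighted_lebesgue_def)

lemma measurable_weighted_lebesgue [simp]:
  "h \<in> measurable (weighted_lebesgue S w) N \<longleftrightarrow> h \<in> measurable (lebesgue_on S) N"
  by (simp add: weighted_lebesgue_def)

lemma borel_measurable_lebesgue_on:
  "h \<in> measurable borel N \<Longrightarrow> h \<in> measurable (lebesgue_on S) N"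
  by (intro measurable_restrict_space1 measurable_completion) simp

context
  fixes S :: "'a::euclidean_space set" and w :: "'a \<Rightarrow> real"
  assumes S: "S \<in> sets lebesgue" and w [measurable]: "w \<in> borel_measurable borel"
begin

lemma weight_measurable: "w \<in> borel_measurable (lebesgue_on S)"
  using w by (rule borel_measurable_lebesgue_on)

lemma sigma_finite_weighted_lebesgue: "sigma_finite_measure (weighted_lebesgue S w)"
proof -
  interpret sigma_finite_measure "lebesgue_on S"
    by (rule sigma_finite_measure_restrict_space[OF sigma_finite_lebesgue S])
  show ?thesis unfolding weighted_lebesgue_def
    using weight_measurable by (subst sigma_finite_iff_density_finite) auto
qed

lemma nn_integral_weighted_lebesgue:
  assumes "h \<in> borel_measurable (lebesgue_on S)"
  shows "(\<integral>\<^sup>+z. h z \<partial>weighted_lebesgue S w) = (\<integral>\<^sup>+z. ennreal (w z) * h z \<partial>lebesgue_on S)"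
  unfolding weighted_lebesgue_def using assms weight_measurable by (intro nn_integral_density) auto

lemma emeasure_weighted_lebesgue:
  assumes "E \<in> sets (weighted_lebesgue S w)"
  shows "emeasure (weighted_lebesgue S w) E = (\<integral>\<^sup>+z. ennreal (w z) * indicator E z * indicator S z \<partial>lebesgue)"
proof -
  have "E \<in> sets (lebesgue_on S)" using assms by (simp add: weighted_lebesgue_def)
  then show ?thesis
    unfolding weighted_lebesgue_def using weight_measurable S
    by (subst emeasure_density) (auto simp: nn_integral_restrict_space)
qed

text \<open>A nonmeasurable set has \<open>emeasure\<close> 0 by convention, so the bound covers
  that case too.\<close>

lemma weighted_lebesgue_ball_le:
  assumes "E \<subseteq> ball c r" "0 \<le> r" "\<And>z. z \<in> E \<Longrightarrow> z \<in> S \<Longrightarrow> w z \<le> W"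
  shows "emeasure (weighted_lebesgue S w) E \<le> ennreal (W * (unit_ball_vol (DIM('a)) * r ^ DIM('a)))"
proof (cases "E \<in> sets (weighted_lebesgue S w)")
  case True
  have "emeasure (weighted_lebesgue S w) E \<le> (\<integral>\<^sup>+z. ennreal W * indicator (ball c r) z \<partial>lebesgue)"
    unfolding emeasure_weighted_lebesgue[OF True]
    using assms by (intro nn_integral_mono) (auto simp: indicator_def intro!: ennreal_leI)
  also have "\<dots> = ennreal W * emeasure lborel (ball c r)"
    by (simp add: nn_integral_cmult_indicator)
  also have "\<dots> = ennreal (W * (unit_ball_vol (DIM('a)) * r ^ DIM('a)))"
    using assms by (subst emeasure_ball) (auto simp: ennreal_mult'')
  finally show ?thesis .
qed (simp add: emeasure_notin_sets)

lemma weighted_lebesgue_ball_ge: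
  assumes "ball c r \<subseteq> E" "E \<subseteq> S" "E \<in> sets (weighted_lebesgue S w)" "0 \<le> r" "\<And>z. z \<in> ball c r \<Longrightarrow> W \<le> w z"
  shows "ennreal (W * (unit_ball_vol (DIM('a)) * r ^ DIM('a))) \<le> emeasure (weighted_lebesgue S w) E"
proof -
  have "ennreal (W * (unit_ball_vol (DIM('a)) * r ^ DIM('a))) = ennreal W * emeasure lborel (ball c r)"
    using assms by (subst emeasure_ball) (auto simp: ennreal_mult'')
  also have "\<dots> = (\<integral>\<^sup>+z. ennreal W * indicator (ball c r) z \<partial>lebesgue)"
    by (simp add: nn_integral_cmult_indicator)
  also have "\<dots> \<le> emeasure (weighted_lebesgue S w) E"
    unfolding emeasure_weighted_lebesgue[OF assms(3)]
    using assms(1,2,5) by (intro nn_integral_mono) (auto simp: indicator_def subset_eq intro!: ennreal_leI)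
  finally show ?thesis .
qed

end

text \<open>The origin, where the boundary weight degenerates and the sign of \<open>u\<close> is
  not prescribed, is a null set.\<close>

lemma nn_integral_lebesgue_punctured:
  fixes h :: "'a::euclidean_space \<Rightarrow> ennreal"
  shows "(\<integral>\<^sup>+z. h z \<partial>lebesgue_on (- {0})) = (\<integral>\<^sup>+z. h z \<partial>lebesgue)"
proof -
  have "AE z in lebesgue. z \<noteq> (0::'a)" by (intro AE_completion AE_lborel_singleton)
  then show ?thesis
    by (subst nn_integral_restrict_space) (auto intro!: nn_integral_cong_AE)
qed

lemma P_kernel_eq:
  assumes "0 < snd x"
  shows "P_kernel lam x y \<mu> = snd x powr lam * norm (x - (y, 0)) powr (- \<mu>)"
proof -
  have "0 < norm (x - (y, 0))" using assms by auto
  moreover have "(norm (fst x - y))\<^sup>2 + (snd x)\<^sup>2 = (norm (x - (y, 0)))\<^sup>2"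
    by (cases x) (simp add: norm_Pair)
  ultimately have *: "(norm (fst x - y))\<^sup>2 + (snd x)\<^sup>2 = norm (x - (y, 0)) powr 2"
    by simp
  show ?thesis
    unfolding P_kernel_def * powr_powr powr_minus by (simp flip: divide_inverse)
qed

lemma norm_fst_le_norm: "norm (fst w) \<le> norm w" and norm_snd_le_norm: "norm (snd w) \<le> norm w"
  by (metis norm_fst_le norm_snd_le prod.collapse)+

lemma half_space_sets: "upper_half_space \<in> sets (borel :: ((real ^ 'm) \<times> real) measure)"
  unfolding upper_half_space_def by (intro borel_open open_Collect_less continuous_intros)

lemma snd_borel: "snd \<in> borel_measurable (borel :: ((real ^ 'm) \<times> real) measure)"
  by (intro borel_measurable_continuous_onI continuous_intros)

lemma snd_powr_borel: "(\<lambda>x. snd x powr e) \<in> borel_measurable (borel :: ((real ^ 'm) \<times> real) measure)"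
  by (rule measurable_compose[OF snd_borel, of "\<lambda>r. r powr e"]) measurable

lemma half_space_lebesgue: "(upper_half_space :: ((real ^ 'm) \<times> real) set) \<in> sets lebesgue"
  by (simp add: half_space_sets)

lemma punctured_lebesgue: "- {0 :: real ^ 'm} \<in> sets lebesgue"
  by simp

section \<open>The transformed system on the half space and its boundary\<close>

context
  fixes lam \<alpha> \<beta> \<mu> p q :: real
    and u :: "real ^ 'm \<Rightarrow> real" and v :: "(real ^ 'm) \<times> real \<Rightarrow> real"
  assumes lam: "0 \<le> lam" and pos: "0 < \<alpha>" "0 < \<beta>" "0 < \<mu>" and pq: "1 < p" "1 < q"
    and balance: "real CARD('m) / (p + 1) + real (CARD('m) + 1) / (q + 1) = \<alpha> + \<beta> + \<mu> - lam"
    and u: "u \<in> Lp_space (p + 1) lebesgue"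
    and v: "v \<in> Lp_space (q + 1) (lebesgue_on upper_half_space)"
    and sol: "positive_solution lam \<alpha> \<beta> \<mu> p q u v"
begin

definition bdry_measure :: "(real ^ 'm) measure" where
  "bdry_measure = weighted_lebesgue (- {0}) (\<lambda>y. norm y powr (- (\<alpha> * (p + 1))))"

definition half_measure :: "((real ^ 'm) \<times> real) measure" where
  "half_measure = weighted_lebesgue upper_half_space
     (\<lambda>x. norm x powr (- (\<beta> * (q + 1))) * snd x powr (lam * (q + 1)))"

lemma bdry_weight: "(\<lambda>y :: real ^ 'm. norm y powr (- (\<alpha> * (p + 1)))) \<in> borel_measurable borel"
  by measurable

lemma half_weight: "(\<lambda>x :: (real ^ 'm) \<times> real. norm x powr (- (\<beta> * (q + 1))) * snd x powr (lam * (q + 1)))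
    \<in> borel_measurable borel"
  by (intro borel_measurable_times snd_powr_borel) measurable

lemma u_pos: "y \<noteq> 0 \<Longrightarrow> 0 < u y"
  using sol by (simp add: positive_solution_def)

lemma v_pos: "x \<in> upper_half_space \<Longrightarrow> 0 < v x"
  using sol by (simp add: positive_solution_def)

lemma u_meas: "u \<in> borel_measurable (lebesgue_on (- {0}))"
  using u by (intro measurable_restrict_space1) (simp add: Lp_space_def)

lemma v_meas: "v \<in> borel_measurable (lebesgue_on upper_half_space)"
  using v by (simp add: Lp_space_def)

lemma scaled_u_meas: "(\<lambda>y. u y * norm y powr \<alpha>) \<in> borel_measurable (lebesgue_on (- {0}))"
  by (intro borel_measurable_times u_meas borel_measurable_lebesgue_on) measurable

lemma scaled_v_meas: "(\<lambda>x. v x * norm x powr \<beta> / snd x powr lam) \<in> borel_measurable (lebesgue_on upper_half_space)"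
  by (intro borel_measurable_divide borel_measurable_times v_meas borel_measurable_lebesgue_on snd_powr_borel) measurable

lemma bdry_integral:
  assumes "h \<in> borel_measurable (lebesgue_on (- {0}))"
  shows "(\<integral>\<^sup>+y. h y \<partial>bdry_measure)
    = (\<integral>\<^sup>+y. ennreal (norm y powr (- (\<alpha> * (p + 1)))) * h y \<partial>lebesgue_on (- {0}))"
  unfolding bdry_measure_def by (rule nn_integral_weighted_lebesgue[OF punctured_lebesgue bdry_weight assms])

lemma half_integral:
  assumes "h \<in> borel_measurable (lebesgue_on upper_half_space)"
  shows "(\<integral>\<^sup>+x. h x \<partial>half_measure)
    = (\<integral>\<^sup>+x. ennreal (norm x powr (- (\<beta> * (q + 1))) * snd x powr (lam * (q + 1))) * h x
        \<partial>lebesgue_on upper_half_space)"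
  unfolding half_measure_def by (rule nn_integral_weighted_lebesgue[OF half_space_lebesgue half_weight assms])

text \<open>The powers of \<open>norm y\<close> combine to
  \<open>- \<alpha> * (p + 1) + \<alpha> * p = - \<alpha>\<close>. With \<open>h\<close> the kernel
  this gives the equation for \<open>g\<close>, with \<open>h\<close> a power of
  \<open>norm y\<close> the value at the origin.\<close>

lemma bdry_integral_source:
  assumes h: "h \<in> borel_measurable borel"
  shows "(\<integral>\<^sup>+y. ennreal ((u y * norm y powr \<alpha>) powr p * h y) \<partial>bdry_measure)
    = (\<integral>\<^sup>+y. ennreal (norm y powr (- \<alpha>) * h y * u y powr p) \<partial>lebesgue_on (- {0}))"
proof -
  note [measurable] = scaled_u_meas borel_measurable_lebesgue_on[OF h]
  have "(\<integral>\<^sup>+y. ennreal ((u y * norm y powr \<alpha>) powr p * h y) \<partial>bdry_measure)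
    = (\<integral>\<^sup>+y. ennreal (norm y powr (- (\<alpha> * (p + 1)))) * ennreal ((u y * norm y powr \<alpha>) powr p * h y) \<partial>lebesgue_on (- {0}))"
    by (rule bdry_integral) measurable
  also have "\<dots> = (\<integral>\<^sup>+y. ennreal (norm y powr (- \<alpha>) * h y * u y powr p) \<partial>lebesgue_on (- {0}))"
  proof (rule nn_integral_cong)
    fix y :: "real ^ 'm" assume "y \<in> space (lebesgue_on (- {0}))"
    then have y: "y \<noteq> 0" by simp
    have "norm y powr (- (\<alpha> * (p + 1))) * (u y * norm y powr \<alpha>) powr p = (norm y powr (- (\<alpha> * (p + 1))) * norm y powr (\<alpha> * p)) * u y powr p"
      using y u_pos[OF y] by (simp add: powr_mult powr_powr)
    also have "\<dots> = norm y powr (- \<alpha>) * u y powr p"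
      using y by (simp add: powr_add[symmetric] algebra_simps)
    finally show "ennreal (norm y powr (- (\<alpha> * (p + 1)))) * ennreal ((u y * norm y powr \<alpha>) powr p * h y)
        = ennreal (norm y powr (- \<alpha>) * h y * u y powr p)"
      by (simp add: ennreal_mult'[symmetric] mult.assoc[symmetric]) (simp add: mult_ac)
  qed
  finally show ?thesis .
qed

text \<open>As on the boundary, with \<open>lam * (q + 1) - lam * q = lam\<close> for the powers of
  \<open>snd x\<close>.\<close>

lemma half_integral_source:
  assumes h: "h \<in> borel_measurable borel"
  shows "(\<integral>\<^sup>+x. ennreal ((v x * norm x powr \<beta> / snd x powr lam) powr q * h x) \<partial>half_measure)
    = (\<integral>\<^sup>+x. ennreal ((norm x powr (- \<beta>) * snd x powr lam) * h x * v x powr q) \<partial>lebesgue_on upper_half_space)"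
    (is "(\<integral>\<^sup>+x. ennreal (?g x powr q * h x) \<partial>half_measure) = _")
proof -
  note [measurable] = scaled_v_meas borel_measurable_lebesgue_on[OF h]
  have "(\<integral>\<^sup>+x. ennreal (?g x powr q * h x) \<partial>half_measure)
    = (\<integral>\<^sup>+x. ennreal (norm x powr (- (\<beta> * (q + 1))) * snd x powr (lam * (q + 1))) * ennreal (?g x powr q * h x)
      \<partial>lebesgue_on upper_half_space)"
    by (rule half_integral) measurable
  also have "\<dots> = (\<integral>\<^sup>+x. ennreal ((norm x powr (- \<beta>) * snd x powr lam) * h x * v x powr q) \<partial>lebesgue_on upper_half_space)"
  proof (rule nn_integral_cong)
    fix x :: "(real ^ 'm) \<times> real" assume "x \<in> space (lebesgue_on upper_half_space)"
    then have x: "x \<in> upper_half_space" by simp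
    then have x0: "0 < snd x" "0 < norm x" "0 < v x" using v_pos by (auto simp: upper_half_space_def)
    have "norm x powr (- (\<beta> * (q + 1))) * snd x powr (lam * (q + 1)) * ?g x powr q
      = (norm x powr (- (\<beta> * (q + 1))) * norm x powr (\<beta> * q)) * (snd x powr (lam * (q + 1)) * snd x powr (- (lam * q))) * v x powr q"
      using x0 by (simp add: powr_mult powr_divide powr_powr powr_minus field_simps)
    also have "\<dots> = norm x powr (- \<beta>) * snd x powr lam * v x powr q"
      using x0 by (simp add: powr_add[symmetric] algebra_simps)
    finally show "ennreal (norm x powr (- (\<beta> * (q + 1))) * snd x powr (lam * (q + 1))) * ennreal (?g x powr q * h x)
        = ennreal ((norm x powr (- \<beta>) * snd x powr lam) * h x * v x powr q)"
      by (simp add: ennreal_mult'[symmetric] mult.assoc[symmetric]) (simp add: mult_ac)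
  qed
  finally show ?thesis .
qed

text \<open>On the half space \<open>max (norm (x - z)) (snd x)\<close> replaces the distance: its balls of radius
  \<open>r\<close> lie in \<open>{z. snd z < 2 * r}\<close>, so their measure decays with the boundary dimension
  \<open>n + lam * (q + 1)\<close> also around interior points.\<close>

lemma coupled_potentials_half_space: "\<exists>c c'. coupled_potentials bdry_measure half_measure (\<lambda>y x. norm (x - (y, 0)))
    (\<lambda>y z. norm (y - z)) (\<lambda>x z. max (norm (x - z)) (snd x)) norm norm p q
    (real CARD('m) / (p + 1) - \<alpha>) (real (CARD('m) + 1) / (q + 1) - \<beta> + lam)
    (real CARD('m) / (p + 1)) (real (CARD('m) + 1) / (q + 1) + lam) \<mu> c c'
    (\<lambda>y. u y * norm y powr \<alpha>) (\<lambda>x. v x * norm x powr \<beta> / snd x powr lam)"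
proof -
  define m where "m = real CARD('m)"
  define n where "n = real (CARD('m) + 1)"
  have dim: "real DIM(real ^ 'm) = m" "real DIM((real ^ 'm) \<times> real) = n" by (simp_all add: m_def n_def)
  have m: "0 < m" "0 < n" by (simp_all add: m_def n_def)
  define V1 where "V1 = unit_ball_vol (real DIM(real ^ 'm))"
  define V2 where "V2 = unit_ball_vol (real DIM((real ^ 'm) \<times> real))"
  have V: "0 < V1" "0 < V2" by (auto simp: V1_def V2_def)
  have vol1: "unit_ball_vol (real DIM(real ^ 'm)) * r ^ DIM(real ^ 'm) = V1 * r powr m" if "0 < r" for r
    by (simp only: V1_def powr_realpow[OF that, symmetric] dim)
  have vol2: "unit_ball_vol (real DIM((real ^ 'm) \<times> real)) * r ^ DIM((real ^ 'm) \<times> real) = V2 * r powr n" if "0 < r" for r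
    by (simp only: V2_def powr_realpow[OF that, symmetric] dim)
  define s where "s = \<alpha> * (p + 1)"
  define t where "t = \<beta> * (q + 1)"
  define l where "l = lam * (q + 1)"
  have stl: "0 < s" "0 < t" "0 \<le> l" using pos pq lam by (auto simp: s_def t_def l_def)
  \<comment> \<open>The factors \<open>2 powr s\<close> and \<open>2 powr t\<close> come from
    evaluating the weights at half the norm of the centre, \<open>2 powr l\<close> from
    \<open>snd x <= 2 * r\<close>.\<close>
  define c1 where "c1 = 2 powr s * V1"
  define c2 where "c2 = 2 powr t * 2 powr l * V2"
  define c where "c = max c1 c2"
  \<comment> \<open>A ball of radius \<open>R / 4\<close> about a point of norm
    \<open>3 * R / 2\<close> lies in the annulus, where the norm is below
    \<open>2 * R\<close>.\<close>
  define b1 where "b1 = 2 powr (- s) * V1 * (1 / 4) powr m"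
  define b2 where "b2 = 2 powr (- t) * V2 * (1 / 4) powr n"
  define c' where "c' = min b1 b2"
  have c: "0 < c" "0 < c'" "c1 \<le> c" "c2 \<le> c" "c' \<le> b1" "c' \<le> b2"
    using V by (auto simp: c_def c1_def c2_def c'_def b1_def b2_def less_max_iff_disj)
  let ?H = "upper_half_space :: ((real ^ 'm) \<times> real) set"
  let ?w1 = "\<lambda>y :: real ^ 'm. norm y powr (- (\<alpha> * (p + 1)))"
  let ?w2 = "\<lambda>x :: (real ^ 'm) \<times> real. norm x powr (- (\<beta> * (q + 1))) * snd x powr (lam * (q + 1))"
  let ?f = "\<lambda>y. u y * norm y powr \<alpha>"
  let ?g = "\<lambda>x. v x * norm x powr \<beta> / snd x powr lam"
  note upos = u_pos and vpos = v_pos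
  have snd0: "0 < snd x" "0 < norm x" if "x \<in> ?H" for x
    using that by (auto simp: upper_half_space_def)
  have norm_d: "0 < norm (x - (y, 0))" if "x \<in> ?H" for x and y :: "real ^ 'm"
    using that by (auto simp: upper_half_space_def prod_eq_iff)
  have snd_d: "snd x \<le> norm (x - (y, 0))" for x :: "(real ^ 'm) \<times> real" and y
    using norm_snd_le_norm[of "x - (y, 0)"] by auto
  have fst_d: "norm (y - fst x) \<le> norm (x - (y, 0))" for x :: "(real ^ 'm) \<times> real" and y
    using norm_fst_le_norm[of "x - (y, 0)"] by (simp add: norm_minus_commute)
  have norm_y0: "norm (y, 0::real) = norm y" for y :: "real ^ 'm" by (simp add: norm_Pair)
  note [measurable] = u_meas v_meas
  have id1 [measurable]: "(\<lambda>y. y) \<in> measurable (lebesgue_on (- {0 :: real ^ 'm})) borel"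
    and id2 [measurable]: "(\<lambda>x. x) \<in> measurable (lebesgue_on ?H) borel"
    by (rule borel_measurable_lebesgue_on, measurable)+
  have meas1: "h \<in> borel_measurable (lebesgue_on (- {0}))" if "h \<in> borel_measurable borel" for h :: "real ^ 'm \<Rightarrow> real"
    using that by (rule borel_measurable_lebesgue_on)
  have meas2: "h \<in> borel_measurable (lebesgue_on ?H)" if "h \<in> borel_measurable borel" for h :: "(real ^ 'm) \<times> real \<Rightarrow> real"
    using that by (rule borel_measurable_lebesgue_on)
  note fm [measurable] = scaled_u_meas and gm [measurable] = scaled_v_meas
  note int1 = bdry_integral and int2 = half_integral
  have ball1: "emeasure bdry_measure E \<le> ennreal (c * R powr (- s) * r powr m)"
    if E: "E \<subseteq> ball z r" "\<And>y. y \<in> E \<Longrightarrow> R / 2 \<le> norm y" and R: "0 < R" "0 < r" for E z r R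
  proof -
    have "emeasure bdry_measure E \<le> ennreal ((R / 2) powr (- s) * (unit_ball_vol (real DIM(real ^ 'm)) * r ^ DIM(real ^ 'm)))"
      unfolding bdry_measure_def
      using E R stl by (intro weighted_lebesgue_ball_le[OF punctured_lebesgue bdry_weight]) (auto simp: s_def intro!: powr_mono2')
    also have "(R / 2) powr (- s) * (unit_ball_vol (real DIM(real ^ 'm)) * r ^ DIM(real ^ 'm)) = c1 * (R powr (- s) * r powr m)"
      using R by (simp add: vol1 c1_def powr_divide powr_minus field_simps del: DIM_cart)
    also have "\<dots> \<le> c * (R powr (- s) * r powr m)" using c by (intro mult_right_mono) auto
    finally show ?thesis by (auto simp: mult.assoc intro: order_trans ennreal_leI)
  qed
  \<comment> \<open>Bounding \<open>snd x\<close> by twice the radius turns the weight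
    \<open>snd x powr l\<close> into \<open>l\<close> additional powers of \<open>r\<close>, hence
    the dimension \<open>n + l\<close>.\<close>
  have ball2: "emeasure half_measure E \<le> ennreal (c * R powr (- t) * r powr (n + l))"
    if E: "E \<subseteq> ball z r" "\<And>x. x \<in> E \<Longrightarrow> R / 2 \<le> norm x" "\<And>x. x \<in> E \<Longrightarrow> x \<in> ?H \<Longrightarrow> snd x \<le> 2 * r"
      and R: "0 < R" "0 < r" for E z r R
  proof -
    have "emeasure half_measure E \<le> ennreal (((R / 2) powr (- t) * (2 * r) powr l)
        * (unit_ball_vol (real DIM((real ^ 'm) \<times> real)) * r ^ DIM((real ^ 'm) \<times> real)))"
      unfolding half_measure_def
    proof (rule weighted_lebesgue_ball_le[OF half_space_lebesgue half_weight E(1)])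
      fix x assume x: "x \<in> E" "x \<in> ?H"
      show "norm x powr (- (\<beta> * (q + 1))) * snd x powr (lam * (q + 1)) \<le> (R / 2) powr (- t) * (2 * r) powr l"
        unfolding t_def[symmetric] l_def[symmetric] using E(2,3)[of x] x snd0[of x] R stl
        by (intro mult_mono powr_mono2 powr_mono2') auto
    qed (use R in auto)
    also have "((R / 2) powr (- t) * (2 * r) powr l)
        * (unit_ball_vol (real DIM((real ^ 'm) \<times> real)) * r ^ DIM((real ^ 'm) \<times> real)) = c2 * (R powr (- t) * (r powr n * r powr l))"
      using R by (simp add: vol2 c2_def powr_divide powr_mult powr_minus field_simps del: DIM_cart DIM_prod)
    also have "\<dots> \<le> c * (R powr (- t) * (r powr n * r powr l))" using c by (intro mult_right_mono) auto
    finally show ?thesis by (auto simp: mult.assoc powr_add intro: order_trans ennreal_leI)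
  qed
  have "(p + 1) * (X - \<alpha> - X) = - s" "(p + 1) * (X - \<alpha>) = (p + 1) * X - s" for X
    by (simp_all add: s_def algebra_simps)
  moreover have "(p + 1) * (m / (p + 1)) = m" using pq by simp
  ultimately have ex1: "(p + 1) * (m / (p + 1) - \<alpha> - m / (p + 1)) = - s" "(p + 1) * (m / (p + 1)) = m"
    "(p + 1) * (m / (p + 1) - \<alpha>) = m - s"
    by (simp_all only:)
  have "(q + 1) * (X - \<beta> + lam - (X + lam)) = - t" "(q + 1) * (X + lam) = (q + 1) * X + l"
    "(q + 1) * (X - \<beta> + lam) = (q + 1) * X + l - t" for X
    by (simp_all add: t_def l_def algebra_simps)
  moreover have "(q + 1) * (n / (q + 1)) = n" using pq by simp
  ultimately have ex2: "(q + 1) * (n / (q + 1) - \<beta> + lam - (n / (q + 1) + lam)) = - t" "(q + 1) * (n / (q + 1) + lam) = n + l"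
    "(q + 1) * (n / (q + 1) - \<beta> + lam) = n + l - t"
    by (simp_all only:)
  \<comment> \<open>Radii up to half the norm of the centre keep the ball away from the origin,
    where the weights are singular.\<close>
  have lower: "R / 2 \<le> norm z" if "r \<le> R / 2" "norm (z - w) \<le> r" "norm w = R" for z w :: "'b::real_normed_vector" and r R
    using norm_triangle_ineq2[of w z] that by (simp add: norm_minus_commute)
  show ?thesis
    unfolding m_def[symmetric] n_def[symmetric]
  proof (rule exI[of _ c], rule exI[of _ c'], rule coupled_potentials.intro, unfold ex1 ex2)
    show "sigma_finite_measure bdry_measure" "sigma_finite_measure half_measure"
      unfolding bdry_measure_def half_measure_def
      by (intro sigma_finite_weighted_lebesgue punctured_lebesgue bdry_weight half_space_lebesgue half_weight)+
    show "(\<lambda>(y, x). norm (x - (y, 0))) \<in> borel_measurable (bdry_measure \<Otimes>\<^sub>M half_measure)"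
    proof -
      \<comment> \<open>The weighted spaces carry restricted Lebesgue sigma-algebras; viewing their
        points as Borel points makes continuous functions of pairs measurable for the
        product.\<close>
      have [measurable]: "(\<lambda>y. y) \<in> measurable bdry_measure borel" "(\<lambda>x. x) \<in> measurable half_measure borel"
        using id1 id2 by (simp_all add: bdry_measure_def half_measure_def)
      have [measurable]: "fst \<in> measurable (bdry_measure \<Otimes>\<^sub>M half_measure) borel" "snd \<in> measurable (bdry_measure \<Otimes>\<^sub>M half_measure) borel"
        by (auto intro: measurable_compose[OF measurable_fst, of "\<lambda>y. y", simplified] measurable_compose[OF measurable_snd, of "\<lambda>y. y", simplified])
      show ?thesis unfolding case_prod_unfold by measurable
    qed
    show "AE z in bdry_measure. 0 < norm (y - z)" if "y \<in> space bdry_measure" for y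
    proof -
      have "AE z in lebesgue. z \<noteq> y" by (intro AE_completion AE_lborel_singleton)
      then have "AE z in lebesgue_on (- {0}). z \<noteq> y"
        by (auto simp: AE_restrict_space_iff elim: eventually_mono)
      then show ?thesis
        unfolding bdry_measure_def weighted_lebesgue_def
        by (subst AE_density) (auto intro: weight_measurable[OF punctured_lebesgue bdry_weight, THEN measurable_compose, OF measurable_ennreal])
    qed
    show "AE z in half_measure. 0 < max (norm (x - z)) (snd x)" if "x \<in> space half_measure" for x
      using that snd0[of x] by (auto simp: half_measure_def)
    show "emeasure bdry_measure {z \<in> space bdry_measure. norm (y - z) < r} \<le> ennreal (c * norm y powr (- s) * r powr m)"
      if "y \<in> space bdry_measure" "0 < r" "r \<le> norm y / 2" for y r
    proof (rule ball1[of _ y])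
      show "norm y / 2 \<le> norm z" if "z \<in> {z \<in> space bdry_measure. norm (y - z) < r}" for z
        using lower[of r "norm y" z y] that \<open>r \<le> norm y / 2\<close> by (auto simp: norm_minus_commute)
    qed (use that in \<open>auto simp: dist_norm bdry_measure_def\<close>)
    show "emeasure half_measure {x \<in> space half_measure. norm (x - (y, 0)) < r} \<le> ennreal (c * norm y powr (- t) * r powr (n + l))"
      if "y \<in> space bdry_measure" "0 < r" "r \<le> norm y / 2" for y r
    proof (rule ball2[of _ "(y, 0)"])
      show "snd x \<le> 2 * r" if "x \<in> {x \<in> space half_measure. norm (x - (y, 0)) < r}" for x
        using that snd_d[of x y] \<open>0 < r\<close> by auto
      show "norm y / 2 \<le> norm x" if "x \<in> {x \<in> space half_measure. norm (x - (y, 0)) < r}" for x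
        using lower[of r "norm y" x "(y, 0)"] that \<open>r \<le> norm y / 2\<close> by (auto simp: norm_y0)
      show "{x \<in> space half_measure. norm (x - (y, 0)) < r} \<subseteq> ball (y, 0) r"
        by (intro subsetI) (simp add: dist_norm norm_minus_commute)
    qed (use that in \<open>auto simp: bdry_measure_def\<close>)
    show "emeasure bdry_measure {y \<in> space bdry_measure. norm (x - (y, 0)) < r} \<le> ennreal (c * norm x powr (- s) * r powr m)"
      if "x \<in> space half_measure" "0 < r" "r \<le> norm x / 2" for x r
    proof (rule ball1[of _ "fst x"])
      show "{y \<in> space bdry_measure. norm (x - (y, 0)) < r} \<subseteq> ball (fst x) r"
        by (auto simp: dist_norm norm_minus_commute intro!: le_less_trans[OF fst_d])
      show "norm x / 2 \<le> norm y" if "y \<in> {y \<in> space bdry_measure. norm (x - (y, 0)) < r}" for y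
        using lower[of r "norm x" "(y, 0)" x] that \<open>r \<le> norm x / 2\<close> by (auto simp: norm_y0 norm_minus_commute)
    qed (use that snd0[of x] in \<open>auto simp: half_measure_def\<close>)
    show "emeasure half_measure {z \<in> space half_measure. max (norm (x - z)) (snd x) < r} \<le> ennreal (c * norm x powr (- t) * r powr (n + l))"
      if "x \<in> space half_measure" "0 < r" "r \<le> norm x / 2" for x r
    proof (rule ball2[of _ x])
      show "snd z \<le> 2 * r" if "z \<in> {z \<in> space half_measure. max (norm (x - z)) (snd x) < r}" for z
        using that norm_snd_le_norm[of "z - x"] by (auto simp: norm_minus_commute)
      show "norm x / 2 \<le> norm z" if "z \<in> {z \<in> space half_measure. max (norm (x - z)) (snd x) < r}" for z
        using lower[of r "norm x" z x] that \<open>r \<le> norm x / 2\<close> by (auto simp: norm_minus_commute)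
    qed (use that snd0[of x] in \<open>auto simp: dist_norm half_measure_def\<close>)
    show "ennreal (c' * R powr (m - s)) \<le> emeasure bdry_measure {y \<in> space bdry_measure. R < norm y \<and> norm y < 2 * R}"
      if R: "0 < R" for R
    proof -
      obtain e :: "real ^ 'm" where e: "norm e = 3 * R / 2" using vector_choose_size[of "3 * R / 2"] R by auto
      have nz: "R < norm z \<and> norm z < 2 * R" if "z \<in> ball e (R / 4)" for z
        using that e R norm_triangle_ineq2[of e z] norm_triangle_ineq2[of z e] by (auto simp: dist_norm norm_minus_commute)
      have "ennreal ((2 * R) powr (- s) * (unit_ball_vol (real DIM(real ^ 'm)) * (R / 4) ^ DIM(real ^ 'm)))
        \<le> emeasure bdry_measure {y \<in> space bdry_measure. R < norm y \<and> norm y < 2 * R}"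
        unfolding bdry_measure_def
      proof (rule weighted_lebesgue_ball_ge[OF punctured_lebesgue bdry_weight])
        show "ball e (R / 4) \<subseteq> {y \<in> space (weighted_lebesgue (- {0}) ?w1). R < norm y \<and> norm y < 2 * R}"
          using nz R by force
        show "{y \<in> space (weighted_lebesgue (- {0}) ?w1). R < norm y \<and> norm y < 2 * R} \<in> sets (weighted_lebesgue (- {0}) ?w1)"
        proof -
          have [measurable]: "norm \<in> borel_measurable (weighted_lebesgue (- {0}) ?w1)"
            by (simp add: meas1)
          show ?thesis by measurable
        qed
        show "(2 * R) powr (- s) \<le> norm z powr (- (\<alpha> * (p + 1)))" if "z \<in> ball e (R / 4)" for z
          using nz[OF that] R stl unfolding s_def[symmetric] by (intro powr_mono2') auto
      qed (use R in auto)
      also have "(2 * R) powr (- s) * (unit_ball_vol (real DIM(real ^ 'm)) * (R / 4) ^ DIM(real ^ 'm)) = b1 * (R powr (- s) * R powr m)"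
        using R by (simp add: vol1 b1_def powr_divide powr_mult del: DIM_cart)
      also have "R powr (- s) * R powr m = R powr (m - s)" by (simp add: powr_add[symmetric])
      finally have "ennreal (b1 * R powr (m - s)) \<le> emeasure bdry_measure {y \<in> space bdry_measure. R < norm y \<and> norm y < 2 * R}" .
      moreover have "ennreal (c' * R powr (m - s)) \<le> ennreal (b1 * R powr (m - s))"
        using c by (intro ennreal_leI mult_right_mono) auto
      ultimately show ?thesis by (rule order_trans[rotated])
    qed
    show "ennreal (c' * R powr (n + l - t)) \<le> emeasure half_measure {x \<in> space half_measure. R < norm x \<and> norm x < 2 * R}"
      if R: "0 < R" for R
    proof -
      \<comment> \<open>The centre lies on the normal axis, so the ball also keeps
        \<open>snd z >= R\<close> and the weight \<open>snd z powr l\<close> stays bounded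
        below.\<close>
      define e :: "(real ^ 'm) \<times> real" where "e = (0, 3 * R / 2)"
      have e: "norm e = 3 * R / 2" using R by (simp add: e_def norm_Pair)
      have nz: "R < norm z \<and> norm z < 2 * R" if "z \<in> ball e (R / 4)" for z
        using that e R norm_triangle_ineq2[of e z] norm_triangle_ineq2[of z e] by (auto simp: dist_norm norm_minus_commute)
      have sz: "R \<le> snd z" if "z \<in> ball e (R / 4)" for z
        using that norm_snd_le_norm[of "e - z"] R by (auto simp: dist_norm e_def)
      have "ennreal (((2 * R) powr (- t) * R powr l) * (unit_ball_vol (real DIM((real ^ 'm) \<times> real)) * (R / 4) ^ DIM((real ^ 'm) \<times> real)))
        \<le> emeasure half_measure {x \<in> space half_measure. R < norm x \<and> norm x < 2 * R}"
        unfolding half_measure_def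
      proof (rule weighted_lebesgue_ball_ge[OF half_space_lebesgue half_weight])
        show "ball e (R / 4) \<subseteq> {x \<in> space (weighted_lebesgue ?H ?w2). R < norm x \<and> norm x < 2 * R}"
          using nz sz R by (force simp: upper_half_space_def)
        show "{x \<in> space (weighted_lebesgue ?H ?w2). R < norm x \<and> norm x < 2 * R} \<in> sets (weighted_lebesgue ?H ?w2)"
        proof -
          have [measurable]: "norm \<in> borel_measurable (weighted_lebesgue ?H ?w2)"
            by (simp add: meas2)
          show ?thesis by measurable
        qed
        show "(2 * R) powr (- t) * R powr l \<le> norm z powr (- (\<beta> * (q + 1))) * snd z powr (lam * (q + 1))" if "z \<in> ball e (R / 4)" for z
          using nz[OF that] sz[OF that] R stl unfolding t_def[symmetric] l_def[symmetric]
          by (intro mult_mono powr_mono2 powr_mono2') auto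
      qed (use R in auto)
      also have "((2 * R) powr (- t) * R powr l) * (unit_ball_vol (real DIM((real ^ 'm) \<times> real)) * (R / 4) ^ DIM((real ^ 'm) \<times> real))
        = b2 * (R powr (- t) * R powr l * R powr n)"
        using R by (simp add: vol2 b2_def powr_divide powr_mult del: DIM_cart DIM_prod)
      also have "R powr (- t) * R powr l * R powr n = R powr (n + l - t)" by (simp add: powr_add[symmetric] algebra_simps)
      finally have "ennreal (b2 * R powr (n + l - t)) \<le> emeasure half_measure {x \<in> space half_measure. R < norm x \<and> norm x < 2 * R}" .
      moreover have "ennreal (c' * R powr (n + l - t)) \<le> ennreal (b2 * R powr (n + l - t))"
        using c by (intro ennreal_leI mult_right_mono) auto
      ultimately show ?thesis by (rule order_trans[rotated])
    qed
    show "ennreal (?f y) = (\<integral>\<^sup>+x. ennreal (?g x powr q * norm (x - (y, 0)) powr (- \<mu>)) \<partial>half_measure)"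
      if "y \<in> space bdry_measure" for y
    proof -
      have y: "y \<noteq> 0" using that by (simp add: bdry_measure_def)
      have [measurable]: "(\<lambda>x. norm (x - (y, 0)) powr (- \<mu>)) \<in> borel_measurable (lebesgue_on ?H)"
        "(\<lambda>x. norm x powr (- \<beta>) * snd x powr lam) \<in> borel_measurable (lebesgue_on ?H)"
        by (intro meas2 borel_measurable_times snd_powr_borel; measurable)+
      have "ennreal (?f y) = ennreal (norm y powr \<alpha>) * ennreal (u y)"
        using upos[OF y] by (simp add: ennreal_mult'[symmetric] mult.commute)
      also have "ennreal (u y) = (\<integral>\<^sup>+x\<in>?H. ennreal (norm x powr (- \<beta>) * P_kernel lam x y \<mu> * v x powr q * norm y powr (- \<alpha>)) \<partial>lebesgue)"
        using sol y by (simp add: positive_solution_def)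
      also have "\<dots> = (\<integral>\<^sup>+x. ennreal (norm x powr (- \<beta>) * P_kernel lam x y \<mu> * v x powr q * norm y powr (- \<alpha>)) \<partial>lebesgue_on ?H)"
        by (simp add: nn_integral_restrict_space half_space_lebesgue)
      also have "\<dots> = (\<integral>\<^sup>+x. ennreal (norm y powr (- \<alpha>)) * ennreal ((norm x powr (- \<beta>) * snd x powr lam) * norm (x - (y, 0)) powr (- \<mu>) * v x powr q) \<partial>lebesgue_on ?H)"
        using snd0 by (intro nn_integral_cong) (simp add: P_kernel_eq ennreal_mult'[symmetric] mult_ac)
      also have "\<dots> = ennreal (norm y powr (- \<alpha>)) * (\<integral>\<^sup>+x. ennreal ((norm x powr (- \<beta>) * snd x powr lam) * norm (x - (y, 0)) powr (- \<mu>) * v x powr q) \<partial>lebesgue_on ?H)"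
        by (rule nn_integral_cmult) measurable
      also have "ennreal (norm y powr \<alpha>) * \<dots> = (\<integral>\<^sup>+x. ennreal ((norm x powr (- \<beta>) * snd x powr lam) * norm (x - (y, 0)) powr (- \<mu>) * v x powr q) \<partial>lebesgue_on ?H)"
        using y by (simp add: mult.assoc[symmetric] ennreal_mult'[symmetric] powr_add[symmetric])
      also have "\<dots> = (\<integral>\<^sup>+x. ennreal (?g x powr q * norm (x - (y, 0)) powr (- \<mu>)) \<partial>half_measure)"
        by (rule half_integral_source[symmetric]) measurable
      finally show ?thesis .
    qed
    show "ennreal (?g x) = (\<integral>\<^sup>+y. ennreal (?f y powr p * norm (x - (y, 0)) powr (- \<mu>)) \<partial>bdry_measure)"
      if "x \<in> space half_measure" for x
    proof -
      have x: "x \<in> ?H" using that by (simp add: half_measure_def)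
      note x0 = snd0[OF x] vpos[OF x]
      have [measurable]: "(\<lambda>y. norm (x - (y, 0)) powr (- \<mu>)) \<in> borel_measurable (lebesgue_on (- {0}))"
        "(\<lambda>y. norm y powr (- \<alpha>)) \<in> borel_measurable (lebesgue_on (- {0 :: real ^ 'm}))"
        by (rule meas1, measurable)+
      define C where "C = snd x powr lam * norm x powr (- \<beta>)"
      have "ennreal (?g x) = ennreal (norm x powr \<beta> / snd x powr lam) * ennreal (v x)"
        using x0 by (simp add: ennreal_mult'[symmetric] mult.commute)
      also have "ennreal (v x) = (\<integral>\<^sup>+y. ennreal (norm y powr (- \<alpha>) * P_kernel lam x y \<mu> * u y powr p * norm x powr (- \<beta>)) \<partial>lebesgue)"
        using sol x by (simp add: positive_solution_def)
      also have "\<dots> = (\<integral>\<^sup>+y. ennreal (norm y powr (- \<alpha>) * P_kernel lam x y \<mu> * u y powr p * norm x powr (- \<beta>)) \<partial>lebesgue_on (- {0}))"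
        by (rule nn_integral_lebesgue_punctured[symmetric])
      also have "\<dots> = (\<integral>\<^sup>+y. ennreal C * ennreal (norm y powr (- \<alpha>) * norm (x - (y, 0)) powr (- \<mu>) * u y powr p) \<partial>lebesgue_on (- {0}))"
        using x0 by (intro nn_integral_cong) (simp add: P_kernel_eq C_def ennreal_mult'[symmetric] mult_ac)
      also have "\<dots> = ennreal C * (\<integral>\<^sup>+y. ennreal (norm y powr (- \<alpha>) * norm (x - (y, 0)) powr (- \<mu>) * u y powr p) \<partial>lebesgue_on (- {0}))"
        by (rule nn_integral_cmult) measurable
      also have "ennreal (norm x powr \<beta> / snd x powr lam) * \<dots> = (\<integral>\<^sup>+y. ennreal (norm y powr (- \<alpha>) * norm (x - (y, 0)) powr (- \<mu>) * u y powr p) \<partial>lebesgue_on (- {0}))"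
      proof -
        have "norm x powr \<beta> / snd x powr lam * C = 1" using x0 by (simp add: C_def powr_minus)
        then show ?thesis by (simp add: mult.assoc[symmetric] ennreal_mult'[symmetric] C_def)
      qed
      also have "\<dots> = (\<integral>\<^sup>+y. ennreal (?f y powr p * norm (x - (y, 0)) powr (- \<mu>)) \<partial>bdry_measure)"
        by (rule bdry_integral_source[symmetric]) measurable
      finally show ?thesis .
    qed
    show "(\<integral>\<^sup>+y. ennreal (?f y powr (p + 1)) \<partial>bdry_measure) < \<infinity>"
    proof -
      have "(\<integral>\<^sup>+y. ennreal (?f y powr (p + 1)) \<partial>bdry_measure) = (\<integral>\<^sup>+y. ennreal (?w1 y) * ennreal (?f y powr (p + 1)) \<partial>lebesgue_on (- {0}))"
        by (rule int1) measurable
      also have "\<dots> = (\<integral>\<^sup>+y. ennreal (\<bar>u y\<bar> powr (p + 1)) \<partial>lebesgue_on (- {0}))"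
      proof (rule nn_integral_cong)
        fix y :: "real ^ 'm" assume "y \<in> space (lebesgue_on (- {0}))"
        then have y: "y \<noteq> 0" by simp
        have "?w1 y * ?f y powr (p + 1) = \<bar>u y\<bar> powr (p + 1)"
          using y upos[OF y] by (simp add: powr_mult powr_powr powr_minus)
        then show "ennreal (?w1 y) * ennreal (?f y powr (p + 1)) = ennreal (\<bar>u y\<bar> powr (p + 1))"
          by (simp add: ennreal_mult'[symmetric])
      qed
      also have "\<dots> = (\<integral>\<^sup>+y. ennreal (norm (\<bar>u y\<bar> powr (p + 1))) \<partial>lebesgue)"
        by (simp add: nn_integral_lebesgue_punctured)
      also have "\<dots> < \<infinity>" using u by (simp add: Lp_space_def integrable_iff_bounded)
      finally show ?thesis .
    qed
    show "(\<integral>\<^sup>+x. ennreal (?g x powr (q + 1)) \<partial>half_measure) < \<infinity>"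
    proof -
      have "(\<integral>\<^sup>+x. ennreal (?g x powr (q + 1)) \<partial>half_measure) = (\<integral>\<^sup>+x. ennreal (?w2 x) * ennreal (?g x powr (q + 1)) \<partial>lebesgue_on ?H)"
        by (rule int2) measurable
      also have "\<dots> = (\<integral>\<^sup>+x. ennreal (norm (\<bar>v x\<bar> powr (q + 1))) \<partial>lebesgue_on ?H)"
      proof (rule nn_integral_cong)
        fix x assume "x \<in> space (lebesgue_on ?H)"
        then have x: "x \<in> ?H" by simp
        have "?w2 x * ?g x powr (q + 1) = \<bar>v x\<bar> powr (q + 1)"
          using snd0[OF x] vpos[OF x] by (simp add: powr_mult powr_divide powr_powr powr_minus)
        then show "ennreal (?w2 x) * ennreal (?g x powr (q + 1)) = ennreal (norm (\<bar>v x\<bar> powr (q + 1)))"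
          by (simp add: ennreal_mult'[symmetric])
      qed
      also have "\<dots> < \<infinity>" using v by (simp add: Lp_space_def integrable_iff_bounded)
      finally show ?thesis .
    qed
    show "0 \<le> max (norm (x - z)) (snd x)" for x z :: "(real ^ 'm) \<times> real"
      by (simp add: le_max_iff_disj)
    show "\<bar>norm y - norm x\<bar> \<le> norm (x - (y, 0))" for y :: "real ^ 'm" and x :: "(real ^ 'm) \<times> real"
      using norm_triangle_ineq3[of x "(y, 0)"] by (simp only: norm_y0 abs_minus_commute)
    show "norm (x - (y, 0)) \<le> norm y + norm x" for y :: "real ^ 'm" and x :: "(real ^ 'm) \<times> real"
      using norm_triangle_ineq4[of x "(y, 0)"] by (simp only: norm_y0 add.commute)
    show "norm (y - z) \<le> norm (x - (y, 0)) + norm (x - (z, 0))" for y z :: "real ^ 'm" and x :: "(real ^ 'm) \<times> real"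
      using norm_triangle_ineq4[of "y - fst x" "z - fst x"] fst_d[of y x] fst_d[of z x] by simp
    show "max (norm (x - z)) (snd x) \<le> norm (x - (y, 0)) + norm (z - (y, 0))"
      for y :: "real ^ 'm" and x z :: "(real ^ 'm) \<times> real"
    proof (rule max.boundedI)
      show "norm (x - z) \<le> norm (x - (y, 0)) + norm (z - (y, 0))"
        using norm_triangle_ineq4[of "x - (y, 0)" "z - (y, 0)"] by (simp only: diff_diff_eq2 diff_add_cancel)
      show "snd x \<le> norm (x - (y, 0)) + norm (z - (y, 0))"
        using snd_d[of x y] norm_ge_zero[of "z - (y, 0)"] by linarith
    qed
    show "0 < ?g x" if "x \<in> space half_measure" for x
      using that snd0[of x] vpos[of x] by (simp add: half_measure_def)
    show "0 < n / (q + 1) + lam" using m pq lam by (intro add_pos_nonneg) auto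
    show "0 < norm (x - (y, 0))" if "x \<in> space half_measure" for x and y :: "real ^ 'm"
      using that norm_d by (simp only: half_measure_def space_weighted_lebesgue)
  \<comment> \<open>Among the remaining conditions, \<open>balance\<close> gives
    \<open>mu = A + B\<close>; since \<open>a + b\<close> exceeds \<open>A + B\<close> by
    \<open>\<alpha> + \<beta>\<close>, it also gives \<open>mu < a + b\<close>.\<close>
  qed (use fm gm snd0 upos vpos pq pos m c balance in
      \<open>auto simp: bdry_measure_def half_measure_def m_def n_def\<close>)
qed

end

section \<open>The two limits\<close>

theorem theorem1p5:
  fixes n :: nat
    and lam \<alpha> \<beta> \<mu> p0 q0 :: real
    and u :: "real ^ 'm \<Rightarrow> real"
    and v :: "(real ^ 'm) \<times> real \<Rightarrow> real"
  assumes "n = CARD('m) + 1" and "n \<ge> 3"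
    and "lam \<ge> 0"
    and "0 < \<alpha>" "\<alpha> < real n"
    and "0 < \<beta>" "\<beta> < real n"
    and "0 < \<mu>" "\<mu> < real n - 2 * lam"
    and "p0 > 1" "q0 > 1"
    and "(real n - 1) / real n * (1 / (p0 + 1)) + 1 / (q0 + 1) = (\<alpha> + \<beta> + \<mu> - lam) / real n"
    and "u \<in> Lp_space (p0 + 1) lebesgue"
    and "v \<in> Lp_space (q0 + 1) (lebesgue_on upper_half_space)"
    and "positive_solution lam \<alpha> \<beta> \<mu> p0 q0 u v"
  shows
    "(1 / q0 - (\<mu> + \<beta> - lam) / (q0 * real n) > (\<beta> - 1) / real n \<longrightarrow>
        ((\<lambda>y. ennreal (u y * norm y powr \<alpha>)) \<longlongrightarrow>
          (\<integral>\<^sup>+ x\<in>upper_half_space.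
             ennreal (snd x powr lam * v x powr q0 / norm x powr (\<mu> + \<beta>)) \<partial>lebesgue)) (at 0))
     \<and>
     (1 / p0 - (\<mu> + \<alpha> - lam + 1) / (p0 * (real n - 1)) > \<alpha> / (real n - 1) \<longrightarrow>
        ((\<lambda>x. ennreal (v x * norm x powr \<beta> / snd x powr lam)) \<longlongrightarrow>
          (\<integral>\<^sup>+ y. ennreal (u y powr p0 / norm y powr (\<alpha> + \<mu>)) \<partial>lebesgue))
        (at 0 within upper_half_space))"
proof -
  define m where "m = real CARD('m)"
  have n: "real n = m + 1" "0 < m" using assms(1,2) by (auto simp: m_def)
  have bal: "m / (p0 + 1) + real (CARD('m) + 1) / (q0 + 1) = \<alpha> + \<beta> + \<mu> - lam"
  proof -
    have "N * (m / N * (1 / P) + 1 / Q) = m / P + N / Q" if "0 < N" for N P Q :: real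
      using that by (simp add: distrib_left)
    from this[of "real n" "p0 + 1" "q0 + 1"] have "m / (p0 + 1) + real n / (q0 + 1) = real n * ((\<alpha> + \<beta> + \<mu> - lam) / real n)"
      using assms(12) n by simp
    then show ?thesis using n by (simp add: m_def add.commute)
  qed
  note prem = assms(3,4,6,8,10,11) bal[unfolded m_def] assms(13-15)
  obtain c c' where "coupled_potentials (bdry_measure \<alpha> p0) (half_measure lam \<beta> q0) (\<lambda>y x. norm (x - (y, 0)))
    (\<lambda>y z. norm (y - z)) (\<lambda>x z. max (norm (x - z)) (snd x)) norm norm p0 q0
    (real CARD('m) / (p0 + 1) - \<alpha>) (real (CARD('m) + 1) / (q0 + 1) - \<beta> + lam)
    (real CARD('m) / (p0 + 1)) (real (CARD('m) + 1) / (q0 + 1) + lam) \<mu> c c'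
    (\<lambda>y. u y * norm y powr \<alpha>) (\<lambda>x. v x * norm x powr \<beta> / snd x powr lam)"
    using coupled_potentials_half_space[OF prem] by blast
  then interpret E: coupled_potentials "bdry_measure \<alpha> p0" "half_measure lam \<beta> q0" "\<lambda>y x. norm (x - (y, 0))"
    "\<lambda>y z. norm (y - z)" "\<lambda>x z. max (norm (x - z)) (snd x)" norm norm p0 q0
    "real CARD('m) / (p0 + 1) - \<alpha>" "real (CARD('m) + 1) / (q0 + 1) - \<beta> + lam"
    "real CARD('m) / (p0 + 1)" "real (CARD('m) + 1) / (q0 + 1) + lam" \<mu> c c'
    "\<lambda>y. u y * norm y powr \<alpha>" "\<lambda>x. v x * norm x powr \<beta> / snd x powr lam" .
  \<comment> \<open>In the exchanged system \<open>f_tendsto\<close> speaks about \<open>v\<close>,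
    and \<open>origin_value\<close> is the boundary integral.\<close>
  interpret S: coupled_potentials "half_measure lam \<beta> q0" "bdry_measure \<alpha> p0" "\<lambda>x y. norm (x - (y, 0))"
    "\<lambda>x z. max (norm (x - z)) (snd x)" "\<lambda>y z. norm (y - z)" norm norm q0 p0
    "real (CARD('m) + 1) / (q0 + 1) - \<beta> + lam" "real CARD('m) / (p0 + 1) - \<alpha>"
    "real (CARD('m) + 1) / (q0 + 1) + lam" "real CARD('m) / (p0 + 1)" \<mu> c c'
    "\<lambda>x. v x * norm x powr \<beta> / snd x powr lam" "\<lambda>y. u y * norm y powr \<alpha>"
    by (rule E.swap)
  have E: "E.origin_value = (\<integral>\<^sup>+ x\<in>upper_half_space.
      ennreal (snd x powr lam * v x powr q0 / norm x powr (\<mu> + \<beta>)) \<partial>lebesgue)"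
  proof -
    have "E.origin_value = (\<integral>\<^sup>+x. ennreal ((norm x powr (- \<beta>) * snd x powr lam) * norm x powr (- \<mu>) * v x powr q0)
        \<partial>lebesgue_on upper_half_space)"
      unfolding E.origin_value_def by (rule half_integral_source[OF prem]) measurable
    also have "\<dots> = (\<integral>\<^sup>+x. ennreal (snd x powr lam * v x powr q0 / norm x powr (\<mu> + \<beta>)) \<partial>lebesgue_on upper_half_space)"
      by (intro nn_integral_cong) (simp add: powr_minus powr_add field_simps)
    finally show ?thesis by (simp add: nn_integral_restrict_space half_space_lebesgue)
  qed
  have S: "S.origin_value = (\<integral>\<^sup>+ y. ennreal (u y powr p0 / norm y powr (\<alpha> + \<mu>)) \<partial>lebesgue)"
  proof -
    have "S.origin_value = (\<integral>\<^sup>+y. ennreal (norm y powr (- \<alpha>) * norm y powr (- \<mu>) * u y powr p0) \<partial>lebesgue_on (- {0}))"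
      unfolding S.origin_value_def by (rule bdry_integral_source[OF prem]) measurable
    also have "\<dots> = (\<integral>\<^sup>+y. ennreal (u y powr p0 / norm y powr (\<alpha> + \<mu>)) \<partial>lebesgue_on (- {0}))"
      by (intro nn_integral_cong) (simp add: powr_minus powr_add field_simps)
    finally show ?thesis by (simp add: nn_integral_lebesgue_punctured)
  qed
  have "((\<lambda>y. ennreal (u y * norm y powr \<alpha>)) \<longlongrightarrow> E.origin_value) (at 0)"
  proof (rule E.f_tendsto)
    \<comment> \<open>The product is \<open>n + (q0 + 1) * lam\<close>, at least \<open>n\<close>
      and hence above \<open>\<mu>\<close>.\<close>
    have "(q0 + 1) * (X / (q0 + 1) + lam) = X + (q0 + 1) * lam" for X
      using assms(11) by (simp add: distrib_left)
    moreover have "0 \<le> (q0 + 1) * lam" using assms(3,11) by simp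
    ultimately have "real n \<le> (q0 + 1) * (real (CARD('m) + 1) / (q0 + 1) + lam)"
      unfolding assms(1) by simp
    then show "\<mu> < (q0 + 1) * (real (CARD('m) + 1) / (q0 + 1) + lam)" using assms(3,9) by linarith
    show "(norm \<longlongrightarrow> 0) (at (0 :: real ^ 'm))" by (intro tendsto_norm_zero tendsto_ident_at)
    show "\<forall>\<^sub>F y in at (0 :: real ^ 'm). y \<in> space (bdry_measure \<alpha> p0)"
      by (simp add: bdry_measure_def[OF prem] eventually_at_filter)
  qed
  moreover have "((\<lambda>x. ennreal (v x * norm x powr \<beta> / snd x powr lam)) \<longlongrightarrow> S.origin_value) (at 0 within upper_half_space)"
    if cond: "1 / p0 - (\<mu> + \<alpha> - lam + 1) / (p0 * (real n - 1)) > \<alpha> / (real n - 1)"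
  proof (rule S.f_tendsto)
    have "\<alpha> / m * (p0 * m) < (1 / p0 - (\<mu> + \<alpha> - lam + 1) / (p0 * m)) * (p0 * m)"
      using cond n assms(10) by (intro mult_strict_right_mono) auto
    then have "\<alpha> * p0 < m - (\<mu> + \<alpha> - lam + 1)"
      using n assms(10) by (simp add: left_diff_distrib)
    moreover have "0 < \<alpha> * p0" using assms(4,10) by simp
    \<comment> \<open>Twice the inequality just obtained plus \<open>\<mu> < n - 2 * lam\<close>
      eliminates \<open>lam\<close>; as \<open>n = m + 1\<close>, this gives
      \<open>3 * \<mu> < 3 * m - 1\<close>.\<close>
    ultimately have "\<mu> < m" using assms(4,9) n by linarith
    then show "\<mu> < (p0 + 1) * (real CARD('m) / (p0 + 1))" using assms(10) by (simp add: m_def)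
    show "(norm \<longlongrightarrow> 0) (at (0 :: (real ^ 'm) \<times> real) within upper_half_space)"
      by (intro tendsto_norm_zero tendsto_ident_at)
    show "\<forall>\<^sub>F x in at (0 :: (real ^ 'm) \<times> real) within upper_half_space. x \<in> space (half_measure lam \<beta> q0)"
      by (simp add: half_measure_def[OF prem] eventually_at_filter)
  qed
  ultimately show ?thesis unfolding E S by blast
qed

end
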